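(* Let $u\in\mathbb R^n$. Suppose that the solution map $S(x)$ is inner semi-continuous at $(\bar x,\bar y)\in\mathrm{gph}\,S$ in direction $u$. Moreover assume that the feasible map $\mathcal F$ is RCR-regular at $(\bar x,\bar y)$. Then the value function $V$ is directionally differentiable at $\bar x$ in direction $u$ and $$V'(\bar x;u)=\min_{v\in\mathbb L(\bar x,\bar y;u)}\nabla f(\bar x,\bar y)(u,v)=\max_{\lambda\in\Lambda(\bar x,\bar y)}\nabla_x\mathcal L(\bar x,\bar y;\lambda)u.$$
   Context: Let $f:\mathbb R^n\times\mathbb R^m\to\mathbb R$ and $g:\mathbb R^n\times\mathbb R^m\to\mathbb R^p$ be continuously differentiable. Consider $(P_x)$: $\min_y f(x,y)$ s.t. $g(x,y)\le0$. Feasible map $\mathcal F(x)=\{y:g(x,y)\le0\}$; value function $V(x)=\inf\{f(x,y):y\in\mathcal F(x)\}$; $S(x)$ = set of optimal solutions of $(P_x)$; $\mathrm{gph}$ denotes the graph. $I_g(x,y)=\{i:g_i(x,y)=0\}$; $\mathcal L(x,y;\lambda)=f(x,y)+g(x,y)^T\lambda$; $\Lambda(x,y)=\{\lambda\in\mathbb R^p:\nabla_y\mathcal L(x,y;\lambda)=0,\ g(x,y)^T\lambda=0,\ \lambda\ge0\}$; $\mathbb L(\bar x,\bar y;u)=\{v\in\mathbb R^m:\nabla g_i(\bar x,\bar y)(u,v)\le0\ \forall i\in I_g(\bar x,\bar y)\}$. Directional derivative: $V'(\bar x;u)=\lim_{t\downarrow0}(V(\bar x+tu)-V(\bar x))/t$;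 $V$ is directionally differentiable at $\bar x$ in direction $u$ if this limit exists. Directional inner semi-continuity: for $\bar y\in S(\bar x)$, $S$ is inner semi-continuous at $(\bar x,\bar y)$ in direction $u$ if for any sequences $t_k\downarrow0$, $u^k\to u$, there exists a sequence $y^k\in S(\bar x+t_ku^k)$ converging to $\bar y$. RCR regularity of $\mathcal F$ at $(\bar x,\bar y)\in\mathrm{gph}\,\mathcal F$: there is $\delta>0$ such that for any $K\subseteq I_g(\bar x,\bar y)$ the family $\{\nabla_yg_j(x,y)\}_{j\in K}$ has the same rank at all $(x,y)$ in the open ball of radius $\delta$ about $(\bar x,\bar y)$. *)

theory Defs
  imports "HOL-Analysis.Analysis"
begin

definition continuously_differentiable ::
    "('a::real_normed_vector \<Rightarrow> 'b::real_normed_vector) \<Rightarrow> bool" where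
  "continuously_differentiable h \<longleftrightarrow>
     (\<exists>h' :: 'a \<Rightarrow> ('a \<Rightarrow>\<^sub>L 'b).
        (\<forall>z. (h has_derivative blinfun_apply (h' z)) (at z)) \<and> continuous_on UNIV h')"

definition gradient :: "('a::real_inner \<Rightarrow> real) \<Rightarrow> 'a \<Rightarrow> 'a" where
  "gradient h z = (THE d. GDERIV h z :> d)"

definition gph :: "('a \<Rightarrow> 'b set) \<Rightarrow> ('a \<times> 'b) set" where
  "gph M = {(x, y). y \<in> M x}"

definition is_minimum :: "real \<Rightarrow> real set \<Rightarrow> bool" where
  "is_minimum d A \<longleftrightarrow> d \<in> A \<and> (\<forall>a\<in>A. d \<le> a)"

definition is_maximum :: "real \<Rightarrow> real set \<Rightarrow> bool" where
  "is_maximum d A \<longleftrightarrow> d \<in> A \<and> (\<forall>a\<in>A. a \<le> d)"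

text \<open>The order on \<^typ>\<open>real ^ 'p\<close> is componentwise.\<close>

definition feasible_map ::
    "((real ^ 'n) \<times> (real ^ 'm) \<Rightarrow> real ^ 'p) \<Rightarrow> real ^ 'n \<Rightarrow> (real ^ 'm) set" where
  "feasible_map g x = {y. g (x, y) \<le> 0}"

text \<open>The value function is extended-real-valued: it is \<open>\<infinity>\<close> where the problem is infeasible and
  \<open>-\<infinity>\<close> where it is unbounded below.\<close>

definition value_function ::
    "((real ^ 'n) \<times> (real ^ 'm) \<Rightarrow> real) \<Rightarrow> ((real ^ 'n) \<times> (real ^ 'm) \<Rightarrow> real ^ 'p) \<Rightarrow>
     real ^ 'n \<Rightarrow> ereal" where
  "value_function f g x = (INF y\<in>feasible_map g x. ereal (f (x, y)))"

definition solution_map ::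
    "((real ^ 'n) \<times> (real ^ 'm) \<Rightarrow> real) \<Rightarrow> ((real ^ 'n) \<times> (real ^ 'm) \<Rightarrow> real ^ 'p) \<Rightarrow>
     real ^ 'n \<Rightarrow> (real ^ 'm) set" where
  "solution_map f g x =
     {y \<in> feasible_map g x. \<forall>y'\<in>feasible_map g x. f (x, y) \<le> f (x, y')}"

definition active_set ::
    "((real ^ 'n) \<times> (real ^ 'm) \<Rightarrow> real ^ 'p) \<Rightarrow> real ^ 'n \<Rightarrow> real ^ 'm \<Rightarrow> 'p set" where
  "active_set g x y = {i. g (x, y) $ i = 0}"

definition lagrangian ::
    "((real ^ 'n) \<times> (real ^ 'm) \<Rightarrow> real) \<Rightarrow> ((real ^ 'n) \<times> (real ^ 'm) \<Rightarrow> real ^ 'p) \<Rightarrow>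
     real ^ 'n \<Rightarrow> real ^ 'm \<Rightarrow> real ^ 'p \<Rightarrow> real" where
  "lagrangian f g x y l = f (x, y) + g (x, y) \<bullet> l"

definition multipliers ::
    "((real ^ 'n) \<times> (real ^ 'm) \<Rightarrow> real) \<Rightarrow> ((real ^ 'n) \<times> (real ^ 'm) \<Rightarrow> real ^ 'p) \<Rightarrow>
     real ^ 'n \<Rightarrow> real ^ 'm \<Rightarrow> (real ^ 'p) set" where
  "multipliers f g x y =
     {l. gradient (\<lambda>y'. lagrangian f g x y' l) y = 0 \<and> g (x, y) \<bullet> l = 0 \<and> 0 \<le> l}"

definition linearization_cone ::
    "((real ^ 'n) \<times> (real ^ 'm) \<Rightarrow> real ^ 'p) \<Rightarrow> real ^ 'n \<Rightarrow> real ^ 'm \<Rightarrow> real ^ 'n \<Rightarrow>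
     (real ^ 'm) set" where
  "linearization_cone g x y u =
     {v. \<forall>i\<in>active_set g x y. gradient (\<lambda>z. g z $ i) (x, y) \<bullet> (u, v) \<le> 0}"

text \<open>The directional derivative is a finite limit of extended-real difference quotients.\<close>

definition has_dir_deriv :: "('a::real_vector \<Rightarrow> ereal) \<Rightarrow> 'a \<Rightarrow> 'a \<Rightarrow> real \<Rightarrow> bool" where
  "has_dir_deriv W x u d \<longleftrightarrow>
     ((\<lambda>t. (W (x + t *\<^sub>R u) - W x) / ereal t) \<longlongrightarrow> ereal d) (at_right 0)"

definition dir_differentiable :: "('a::real_vector \<Rightarrow> ereal) \<Rightarrow> 'a \<Rightarrow> 'a \<Rightarrow> bool" where
  "dir_differentiable W x u \<longleftrightarrow> (\<exists>d. has_dir_deriv W x u d)"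

definition dir_deriv :: "('a::real_vector \<Rightarrow> ereal) \<Rightarrow> 'a \<Rightarrow> 'a \<Rightarrow> real" where
  "dir_deriv W x u = (THE d. has_dir_deriv W x u d)"

definition inner_semicontinuous_dir ::
    "('a::real_normed_vector \<Rightarrow> ('b::topological_space) set) \<Rightarrow> 'a \<Rightarrow> 'b \<Rightarrow> 'a \<Rightarrow> bool" where
  "inner_semicontinuous_dir M x y u \<longleftrightarrow>
     (\<forall>(t :: nat \<Rightarrow> real) (w :: nat \<Rightarrow> 'a).
        (\<forall>k. t k > 0) \<longrightarrow> t \<longlonglongrightarrow> 0 \<longrightarrow> w \<longlonglongrightarrow> u \<longrightarrow>
        (\<exists>s :: nat \<Rightarrow> 'b. (\<forall>k. s k \<in> M (x + t k *\<^sub>R w k)) \<and> s \<longlonglongrightarrow> y))"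

text \<open>The rank of a family of vectors is the dimension of its span, which for a set \<open>A\<close> of vectors
  is \<^term>\<open>dim A\<close>. The norm on the product type is the Euclidean one.\<close>

definition RCR_regular ::
    "((real ^ 'n) \<times> (real ^ 'm) \<Rightarrow> real ^ 'p) \<Rightarrow> real ^ 'n \<Rightarrow> real ^ 'm \<Rightarrow> bool" where
  "RCR_regular g x y \<longleftrightarrow>
     (\<exists>\<delta>>0. \<forall>K \<subseteq> active_set g x y. \<exists>r. \<forall>(x', y')\<in>ball (x, y) \<delta>.
        dim ((\<lambda>j. gradient (\<lambda>y''. g (x', y'') $ j) y') ` K) = r)"

end

theory Submission
  imports Defs
begin

text \<open>Linear independence of gradients persists from nearby points to the reference point, so
  multipliers supported on linearly independent families stay bounded. This gives multipliers by a
  penalty argument and, applied to projections onto the feasible set, the error bound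
  \<open>dist (z, F x) \<le> M * residual\<close> wherever \<open>F x\<close> has a point near \<open>ybar\<close>; no constant rank theorem is
  needed.

  Upper bound: correct \<open>ybar + t v\<close> to a feasible point with an error \<open>o(t)\<close>.

  Lower bound: solutions \<open>y\<close> at \<open>xbar + t u\<close> converge to \<open>ybar\<close> without any rate, so they cannot be
  compared with \<open>ybar\<close> itself. Instead \<open>y\<close> is projected onto the feasible set at \<open>xbar\<close>, keeping the
  constraints in the support of a multiplier of \<open>y\<close> active; this moves it by \<open>O(t)\<close> only. At the
  projected point the constraints in the support of every multiplier of \<open>(xbar, ybar)\<close> are active
  too, because constant rank turns a positive dependence of gradients into equalities. Hence the
  Lagrangian with a dual optimal multiplier can be used for the comparison, and linear programming
  duality closes the gap.\<close>

section \<open>Linearly independent families\<close>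

text \<open>A finite family is independent exactly when the \<open>dim\<close> of its image equals
  its cardinality. This is how constancy of rank turns independence of a subfamily into the same
  question at \<open>(xbar, ybar)\<close> and at every nearby point.

  Constant rank, unlike linear independence of all active gradients or a Mangasarian-Fromovitz
  condition, survives adding the negative of a gradient, because spans do not change. Equations can
  therefore be treated as pairs of opposite inequalities, and one error bound also serves for
  projections that keep chosen constraints active.

  The multiplier set may be unbounded, so an optimal multiplier cannot be found by compactness;
  closedness of finitely generated cones takes its place. Feasibility of the linearized program
  comes, through Farkas' lemma, from the lower bound for the zero objective: the solutions near
  \<open>ybar\<close> witness that the perturbed systems are solvable.\<close>

definition lin_indep_family :: "('q \<Rightarrow> 'b::real_vector) \<Rightarrow> 'q set \<Rightarrow> bool" where
  "lin_indep_family a J \<longleftrightarrow> (\<forall>c. (\<Sum>q\<in>J. c q *\<^sub>R a q) = 0 \<longrightarrow> (\<forall>q\<in>J. c q = 0))"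

lemma lin_indep_familyD:
  "lin_indep_family a J \<Longrightarrow> (\<Sum>q\<in>J. c q *\<^sub>R a q) = 0 \<Longrightarrow> q \<in> J \<Longrightarrow> c q = 0"
  unfolding lin_indep_family_def by blast

lemma lin_indep_family_subset:
  assumes "lin_indep_family a J" "K \<subseteq> J" "finite J"
  shows "lin_indep_family a K"
  unfolding lin_indep_family_def
proof (intro allI impI ballI)
  fix c q assume c: "(\<Sum>q\<in>K. c q *\<^sub>R a q) = 0" and q: "q \<in> K"
  have "(\<Sum>q\<in>J. (if q \<in> K then c q else 0) *\<^sub>R a q) = (\<Sum>q\<in>K. c q *\<^sub>R a q)"
    using assms by (intro sum.mono_neutral_cong_right) auto
  then show "c q = 0"
    using lin_indep_familyD[OF assms(1), of "\<lambda>q. if q \<in> K then c q else 0" q] c q assms(2) by auto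
qed

text \<open>The conjunct \<open>inj_on a J\<close> is what a family has beyond its set of values:
  two constraints with equal gradients form a dependent family.\<close>

lemma lin_indep_family_iff_independent:
  assumes "finite J"
  shows "lin_indep_family a J \<longleftrightarrow> inj_on a J \<and> independent (a ` J)"
proof
  assume L: "lin_indep_family a J"
  have inj: "inj_on a J"
  proof (rule inj_onI, rule ccontr)
    fix p q assume pq: "p \<in> J" "q \<in> J" "a p = a q" "p \<noteq> q"
    have "(\<Sum>r\<in>J. (if r = p then 1 else if r = q then - 1 else 0) *\<^sub>R a r) =
        (\<Sum>r\<in>{p, q}. (if r = p then 1 else if r = q then - 1 else 0) *\<^sub>R a r)"
      using assms pq by (intro sum.mono_neutral_right) auto
    also have "\<dots> = 0" using pq by simp
    finally have "(\<Sum>r\<in>J. (if r = p then 1 else if r = q then - 1 else 0) *\<^sub>R a r) = 0" .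
    from lin_indep_familyD[OF L this pq(1)] pq(4) show False by auto
  qed
  have "independent (a ` J)"
    unfolding independent_explicit_finite_subsets
  proof (intro allI impI ballI)
    fix S u v assume S: "S \<subseteq> a ` J" "finite S" and s: "(\<Sum>v\<in>S. u v *\<^sub>R v) = 0" and v: "v \<in> S"
    obtain K where K: "K \<subseteq> J" "inj_on a K" "S = a ` K"
      using S(1) unfolding subset_image_inj by blast
    have "(\<Sum>q\<in>K. u (a q) *\<^sub>R a q) = 0" using s K by (simp add: sum.reindex)
    moreover obtain q where "q \<in> K" "v = a q" using v K(3) by blast
    ultimately show "u v = 0"
      using lin_indep_familyD[OF lin_indep_family_subset[OF L K(1) assms], of "\<lambda>q. u (a q)" q]
      by simp
  qed
  then show "inj_on a J \<and> independent (a ` J)" using inj by blast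
next
  assume R: "inj_on a J \<and> independent (a ` J)"
  show "lin_indep_family a J"
    unfolding lin_indep_family_def
  proof (intro allI impI ballI)
    fix c q assume c: "(\<Sum>q\<in>J. c q *\<^sub>R a q) = 0" and q: "q \<in> J"
    have "(\<Sum>v\<in>a ` J. c (inv_into J a v) *\<^sub>R v) = (\<Sum>q\<in>J. c (inv_into J a (a q)) *\<^sub>R a q)"
      using R by (simp add: sum.reindex)
    also have "\<dots> = (\<Sum>q\<in>J. c q *\<^sub>R a q)" using R by (intro sum.cong) auto
    finally have "(\<Sum>v\<in>a ` J. c (inv_into J a v) *\<^sub>R v) = 0" using c by simp
    then have "c (inv_into J a (a q)) = 0"
      using R assms q independentD[of "a ` J" "a ` J" "\<lambda>v. c (inv_into J a v)" "a q"] by simp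
    then show "c q = 0" using R q by simp
  qed
qed

text \<open>The bridge from rank hypotheses to independence: a family fails to have full rank either
  by a repetition or by a dependence, and both lower \<open>dim\<close> below
  \<open>card J\<close>.\<close>

lemma lin_indep_family_iff_dim:
  fixes a :: "'q \<Rightarrow> 'b::euclidean_space"
  assumes "finite J"
  shows "lin_indep_family a J \<longleftrightarrow> dim (a ` J) = card J"
proof
  assume "lin_indep_family a J"
  then show "dim (a ` J) = card J"
    using assms by (simp add: lin_indep_family_iff_independent dim_eq_card_independent card_image)
next
  assume d: "dim (a ` J) = card J"
  have "card (a ` J) \<le> card J" using assms by (rule card_image_le)
  moreover have "dim (a ` J) \<le> card (a ` J)" using assms by (simp add: dim_le_card')
  ultimately have c: "card (a ` J) = card J" using d by linarith
  then have "inj_on a J" using assms by (simp add: eq_card_imp_inj_on)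
  moreover have "independent (a ` J)"
    by (rule card_le_dim_spanning[of _ "a ` J"]) (use assms c d in \<open>auto simp: span_superset\<close>)
  ultimately show "lin_indep_family a J" using assms by (simp add: lin_indep_family_iff_independent)
qed

text \<open>Biorthogonal vectors: the coordinate functionals extend linearly from the independent
  set and are represented through the adjoint. They read a coefficient off the value of a
  combination.\<close>

lemma lin_indep_family_dual:
  fixes a :: "'q \<Rightarrow> 'b::euclidean_space"
  assumes "finite J" "lin_indep_family a J"
  obtains w where "\<And>c q. q \<in> J \<Longrightarrow> w q \<bullet> (\<Sum>p\<in>J. c p *\<^sub>R a p) = c q"
proof -
  have inj: "inj_on a J" and ind: "independent (a ` J)"
    using assms by (auto simp: lin_indep_family_iff_independent)
  have "\<exists>w. \<forall>p\<in>J. w \<bullet> a p = (if p = q then 1 else 0)" for q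
  proof -
    obtain f where f: "linear f" "\<forall>x\<in>a ` J. f x = (if inv_into J a x = q then 1 else (0::real))"
      using linear_independent_extend[OF ind, of "\<lambda>x. if inv_into J a x = q then 1 else (0::real)"]
      by blast
    have "adjoint f 1 \<bullet> x = f x" for x
      using adjoint_works[OF f(1), of x 1] by (simp add: inner_commute)
    then show ?thesis using f(2) inj by (intro exI[of _ "adjoint f 1"]) auto
  qed
  then have "\<exists>w. \<forall>q. \<forall>p\<in>J. w q \<bullet> a p = (if p = q then 1 else 0)" by (intro choice allI)
  then obtain w where w: "\<And>q p. p \<in> J \<Longrightarrow> w q \<bullet> a p = (if p = q then 1 else 0)" by blast
  have "w q \<bullet> (\<Sum>p\<in>J. c p *\<^sub>R a p) = c q" if "q \<in> J" for c q
    proof -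
    have "w q \<bullet> (\<Sum>p\<in>J. c p *\<^sub>R a p) = (\<Sum>p\<in>J. if p = q then c p else 0)"
      by (auto simp: inner_sum_right w intro!: sum.cong)
    then show ?thesis using that assms(1) by simp
  qed
  then show ?thesis using that by blast
qed

text \<open>For \<open>a\<close> itself the biorthogonal vectors give the bound \<open>W\<close>. A
  perturbation of size \<open>1 / (2 * W)\<close> costs at most half of the coefficient sum, which
  is absorbed on the left. The constants do not depend on the perturbed family
  \<open>A\<close>.\<close>

lemma lin_indep_family_coeff_bound:
  fixes a :: "'q \<Rightarrow> 'b::euclidean_space"
  assumes "finite J" "lin_indep_family a J"
  obtains e C where "e > 0" "C > 0"
    "\<And>A c. (\<And>q. q \<in> J \<Longrightarrow> norm (A q - a q) \<le> e) \<Longrightarrow>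
       (\<Sum>q\<in>J. \<bar>c q\<bar>) \<le> C * norm (\<Sum>q\<in>J. c q *\<^sub>R A q)"
proof -
  obtain w where w: "\<And>c q. q \<in> J \<Longrightarrow> w q \<bullet> (\<Sum>p\<in>J. c p *\<^sub>R a p) = c q"
    using lin_indep_family_dual[OF assms] by blast
  \<comment> \<open>The summand 1 keeps \<open>W\<close> positive, also for empty
    \<open>J\<close>.\<close>
  define W where "W = (\<Sum>q\<in>J. norm (w q)) + 1"
  have W: "W > 0" unfolding W_def by (simp add: add_nonneg_pos sum_nonneg)
  have "(\<Sum>q\<in>J. \<bar>c q\<bar>) \<le> 2 * W * norm (\<Sum>q\<in>J. c q *\<^sub>R A q)"
    if A: "\<And>q. q \<in> J \<Longrightarrow> norm (A q - a q) \<le> 1 / (2 * W)" for A c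
  proof -
    let ?s = "\<Sum>q\<in>J. \<bar>c q\<bar>"
    have "norm ((\<Sum>q\<in>J. c q *\<^sub>R a q) - (\<Sum>q\<in>J. c q *\<^sub>R A q)) \<le> (\<Sum>q\<in>J. \<bar>c q\<bar> * (1 / (2 * W)))"
      unfolding sum_subtractf[symmetric] scaleR_diff_right[symmetric]
      by (intro sum_norm_le) (use A in \<open>simp add: norm_minus_commute mult_left_mono del: times_divide_eq_right\<close>)
    then have "norm (\<Sum>q\<in>J. c q *\<^sub>R a q) \<le> norm (\<Sum>q\<in>J. c q *\<^sub>R A q) + ?s / (2 * W)"
      using norm_triangle_ineq2[of "\<Sum>q\<in>J. c q *\<^sub>R a q" "\<Sum>q\<in>J. c q *\<^sub>R A q"]
      by (simp add: sum_divide_distrib[symmetric])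
    moreover have "?s \<le> W * norm (\<Sum>q\<in>J. c q *\<^sub>R a q)"
    proof -
      have "?s \<le> (\<Sum>q\<in>J. norm (w q) * norm (\<Sum>q\<in>J. c q *\<^sub>R a q))"
        by (intro sum_mono) (metis w Cauchy_Schwarz_ineq2)
      also have "\<dots> \<le> W * norm (\<Sum>q\<in>J. c q *\<^sub>R a q)"
        unfolding W_def by (simp add: sum_distrib_right[symmetric] distrib_right)
      finally show ?thesis .
    qed
    ultimately have "?s \<le> W * (norm (\<Sum>q\<in>J. c q *\<^sub>R A q) + ?s / (2 * W))"
      using W by (meson order_trans mult_left_mono less_imp_le)
    then show ?thesis using W by (simp add: field_simps)
  qed
  then show ?thesis using that[of "1 / (2 * W)" "2 * W"] W by force
qed

lemma lin_indep_family_perturb: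
  fixes a :: "'q \<Rightarrow> 'b::euclidean_space"
  assumes "finite J" "lin_indep_family a J" "\<And>q. q \<in> J \<Longrightarrow> (\<lambda>k. A k q) \<longlonglongrightarrow> a q"
  shows "\<forall>\<^sub>F k in sequentially. lin_indep_family (A k) J"
proof -
  obtain e C where eC: "e > 0" "C > 0"
    "\<And>A c. (\<And>q. q \<in> J \<Longrightarrow> norm (A q - a q) \<le> e) \<Longrightarrow>
       (\<Sum>q\<in>J. \<bar>c q\<bar>) \<le> C * norm (\<Sum>q\<in>J. c q *\<^sub>R A q)"
    using lin_indep_family_coeff_bound[OF assms(1,2)] by blast
  have "\<forall>\<^sub>F k in sequentially. \<forall>q\<in>J. dist (A k q) (a q) < e"
    using assms(1,3) eC(1) by (auto intro!: eventually_ball_finite tendstoD)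
  then show ?thesis
  proof eventually_elim
    case (elim k)
    show ?case unfolding lin_indep_family_def
    proof (intro allI impI ballI)
      fix c q assume c: "(\<Sum>q\<in>J. c q *\<^sub>R A k q) = 0" and q: "q \<in> J"
      have "(\<Sum>q\<in>J. \<bar>c q\<bar>) \<le> 0"
        using eC(3)[of "A k" c] elim c by (auto simp: dist_norm less_imp_le)
      then show "c q = 0"
        using assms(1) q sum_nonneg_eq_0_iff[of J "\<lambda>q. \<bar>c q\<bar>"]
        by (metis abs_ge_zero abs_eq_0 order_antisym sum_nonneg)
    qed
  qed
qed

text \<open>The coefficients are eventually bounded, so replacing \<open>A k\<close> by
  \<open>a\<close> changes the combinations by a null sequence, and biorthogonal vectors then yield
  each limit. The whole sequence of coefficients converges.\<close>

lemma lin_indep_family_coeff_tendsto: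
  fixes a :: "'q \<Rightarrow> 'b::euclidean_space"
  assumes "finite J" "lin_indep_family a J" "\<And>q. q \<in> J \<Longrightarrow> (\<lambda>k. A k q) \<longlonglongrightarrow> a q"
    and lim: "(\<lambda>k. \<Sum>q\<in>J. c k q *\<^sub>R A k q) \<longlonglongrightarrow> b"
  obtains d where "\<And>q. q \<in> J \<Longrightarrow> (\<lambda>k. c k q) \<longlonglongrightarrow> d q" "(\<Sum>q\<in>J. d q *\<^sub>R a q) = b"
proof -
  obtain e C where eC: "e > 0" "C > 0"
    "\<And>A c. (\<And>q. q \<in> J \<Longrightarrow> norm (A q - a q) \<le> e) \<Longrightarrow>
       (\<Sum>q\<in>J. \<bar>c q\<bar>) \<le> C * norm (\<Sum>q\<in>J. c q *\<^sub>R A q)"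
    using lin_indep_family_coeff_bound[OF assms(1,2)] by blast
  obtain w where w: "\<And>c q. q \<in> J \<Longrightarrow> w q \<bullet> (\<Sum>p\<in>J. c p *\<^sub>R a p) = c q"
    using lin_indep_family_dual[OF assms(1,2)] by blast
  obtain B where B: "\<And>k. norm (\<Sum>q\<in>J. c k q *\<^sub>R A k q) \<le> B"
    using convergent_imp_Bseq[OF convergentI[OF lim]] unfolding Bseq_def by blast
  have ev: "\<forall>\<^sub>F k in sequentially. \<forall>q\<in>J. \<bar>c k q\<bar> \<le> C * B"
  proof -
    have "\<forall>\<^sub>F k in sequentially. \<forall>q\<in>J. dist (A k q) (a q) < e"
      using assms(1,3) eC(1) by (auto intro!: eventually_ball_finite tendstoD)
    then show ?thesis
    proof eventually_elim
      case (elim k)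
      have "(\<Sum>q\<in>J. \<bar>c k q\<bar>) \<le> C * norm (\<Sum>q\<in>J. c k q *\<^sub>R A k q)"
        using elim by (intro eC(3)) (auto simp: dist_norm less_imp_le)
      also have "\<dots> \<le> C * B" using eC B by (intro mult_left_mono) auto
      finally show ?case using assms(1) member_le_sum[of _ J "\<lambda>q. \<bar>c k q\<bar>"] by fastforce
    qed
  qed
  have 0: "(\<lambda>k. c k q *\<^sub>R (a q - A k q)) \<longlonglongrightarrow> 0" if q: "q \<in> J" for q
  proof (rule Lim_null_comparison)
    show "\<forall>\<^sub>F k in sequentially. norm (c k q *\<^sub>R (a q - A k q)) \<le> C * B * norm (a q - A k q)"
      using ev by eventually_elim (use q in \<open>auto intro: mult_right_mono\<close>)
    have "(\<lambda>k. norm (a q - A k q)) \<longlonglongrightarrow> norm (a q - a q)"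
      using assms(3)[OF q] by (intro tendsto_intros)
    then show "(\<lambda>k. C * B * norm (a q - A k q)) \<longlonglongrightarrow> 0"
      using tendsto_mult_right_zero by fastforce
  qed
  have "(\<lambda>k. \<Sum>q\<in>J. c k q *\<^sub>R (a q - A k q)) \<longlonglongrightarrow> 0"
    using 0 by (rule tendsto_null_sum)
  from tendsto_add[OF lim this]
  have lim': "(\<lambda>k. \<Sum>q\<in>J. c k q *\<^sub>R a q) \<longlonglongrightarrow> b"
    by (simp add: sum.distrib[symmetric] scaleR_add_right[symmetric])
  have cq: "(\<lambda>k. c k q) \<longlonglongrightarrow> w q \<bullet> b" if "q \<in> J" for q
  proof -
    have "(\<lambda>k. w q \<bullet> (\<Sum>p\<in>J. c k p *\<^sub>R a p)) \<longlonglongrightarrow> w q \<bullet> b"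
      using lim' by (intro tendsto_intros)
    then show ?thesis using w[OF that] by simp
  qed
  have "(\<lambda>k. \<Sum>q\<in>J. c k q *\<^sub>R a q) \<longlonglongrightarrow> (\<Sum>q\<in>J. (w q \<bullet> b) *\<^sub>R a q)"
    using cq by (intro tendsto_intros)
  then have "(\<Sum>q\<in>J. (w q \<bullet> b) *\<^sub>R a q) = b" using lim' by (rule LIMSEQ_unique)
  with cq show ?thesis by (rule that)
qed

text \<open>Subtracting a linear relation removes one positive coefficient at a time. That
  \<open>J\<close> lies in the support of \<open>l\<close> matters later: penalty coefficients are
  positive only where a constraint is violated.\<close>

lemma conic_caratheodory:
  fixes a :: "'q \<Rightarrow> 'b::real_vector"
  assumes "finite Q" "\<And>q. q \<in> Q \<Longrightarrow> l q \<ge> 0"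
  obtains J m where "J \<subseteq> {q \<in> Q. l q > 0}" "\<And>q. q \<in> J \<Longrightarrow> m q \<ge> 0" "lin_indep_family a J"
    "(\<Sum>q\<in>J. m q *\<^sub>R a q) = (\<Sum>q\<in>Q. l q *\<^sub>R a q)"
proof -
  have "\<exists>J m. J \<subseteq> {q \<in> Q. l q > 0} \<and> (\<forall>q\<in>J. m q \<ge> 0) \<and> lin_indep_family a J \<and>
          (\<Sum>q\<in>J. m q *\<^sub>R a q) = (\<Sum>q\<in>Q. l q *\<^sub>R a q)"
    using assms
  proof (induction "card {q \<in> Q. l q > 0}" arbitrary: l rule: less_induct)
    case less
    let ?P = "{q \<in> Q. l q > 0}"
    have fP: "finite ?P" using less.prems by simp
    have sumP: "(\<Sum>q\<in>?P. l q *\<^sub>R a q) = (\<Sum>q\<in>Q. l q *\<^sub>R a q)"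
      using less.prems by (intro sum.mono_neutral_left) (auto simp: order_less_le)
    show ?case
    proof (cases "lin_indep_family a ?P")
      case True
      then show ?thesis using sumP by (intro exI[of _ ?P] exI[of _ l]) auto
    next
      case False
      then obtain c q0 where c: "(\<Sum>q\<in>?P. c q *\<^sub>R a q) = 0" and q0: "q0 \<in> ?P" "c q0 \<noteq> 0"
        unfolding lin_indep_family_def by blast
      \<comment> \<open>The sign is chosen so that \<open>d\<close> has a positive entry, hence a
        coefficient that the subtraction drives down to zero.\<close>
      define d where "d = (\<lambda>q. if c q0 > 0 then c q else - c q)"
      have d: "(\<Sum>q\<in>?P. d q *\<^sub>R a q) = 0" "d q0 > 0"
        using c q0 by (cases "c q0 > 0"; auto simp: d_def sum_negf)+
      let ?R = "{q \<in> ?P. d q > 0}"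
      have "\<exists>q1\<in>?R. \<forall>q\<in>?R. l q1 / d q1 \<le> l q / d q"
      proof -
        have "finite ((\<lambda>q. l q / d q) ` ?R)" "(\<lambda>q. l q / d q) ` ?R \<noteq> {}" using fP q0 d by (auto simp del: Collect_conj_eq intro!: finite_imageI intro: finite_subset[OF _ fP])
        from Min_in[OF this] Min_le[OF this(1)] show ?thesis by fastforce
      qed
      then obtain q1 where q1: "q1 \<in> ?R" "\<And>q. q \<in> ?R \<Longrightarrow> l q1 / d q1 \<le> l q / d q" by blast
      \<comment> \<open>The ratio test: the largest step that keeps all coefficients nonnegative.
        The coefficient of \<open>q1\<close> becomes zero, so the support shrinks strictly.\<close>
      define s where "s = l q1 / d q1"
      have s: "s > 0" using q1 by (simp add: s_def)
      define l' where "l' = (\<lambda>q. if q \<in> ?P then l q - s * d q else 0)"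
      have nn: "l' q \<ge> 0" if "q \<in> Q" for q
      proof (cases "q \<in> ?P \<and> d q > 0")
        case True
        then show ?thesis using q1(2)[of q] by (auto simp: l'_def s_def[symmetric] pos_le_divide_eq)
      next
        case False
        then have "q \<notin> ?P \<or> d q \<le> 0" by auto
        then show ?thesis using s less.prems(2)[OF that] mult_nonneg_nonpos[of s "d q"]
          by (auto simp: l'_def)
      qed
      have sub: "{q \<in> Q. l' q > 0} \<subset> ?P"
      proof -
        have "l' q1 = 0" using q1 by (auto simp: l'_def s_def)
        then have "q1 \<in> ?P - {q \<in> Q. l' q > 0}" using q1 by auto
        moreover have "{q \<in> Q. l' q > 0} \<subseteq> ?P" by (auto simp: l'_def split: if_splits)
        ultimately show ?thesis by blast
      qed
      have "(\<Sum>q\<in>Q. l' q *\<^sub>R a q) = (\<Sum>q\<in>?P. (l q - s * d q) *\<^sub>R a q)"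
        using less.prems by (intro sum.mono_neutral_cong_right) (auto simp: l'_def)
      also have "\<dots> = (\<Sum>q\<in>?P. l q *\<^sub>R a q) - s *\<^sub>R (\<Sum>q\<in>?P. d q *\<^sub>R a q)"
        by (simp add: scaleR_left_diff_distrib sum_subtractf scaleR_sum_right)
      finally have eq: "(\<Sum>q\<in>Q. l' q *\<^sub>R a q) = (\<Sum>q\<in>Q. l q *\<^sub>R a q)" using d sumP by simp
      have "\<exists>J m. J \<subseteq> {q \<in> Q. l' q > 0} \<and> (\<forall>q\<in>J. m q \<ge> 0) \<and> lin_indep_family a J \<and>
          (\<Sum>q\<in>J. m q *\<^sub>R a q) = (\<Sum>q\<in>Q. l' q *\<^sub>R a q)"
        using less.hyps[of l'] psubset_card_mono[OF fP sub] less.prems(1) nn by blast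
      then show ?thesis using eq sub by (metis (no_types, lifting) psubset_imp_subset subset_trans)
    qed
  qed
  then show ?thesis using that by blast
qed

text \<open>A subfamily that is a basis at the limit stays independent nearby and, the rank being
  constant, still spans. Keeping the coefficients \<open>b\<close> outside it and solving for those
  inside gives a relation at the nearby points; uniqueness of coordinates makes the solved ones
  converge to \<open>b\<close>.\<close>

lemma linear_relation_persists:
  fixes a :: "'q \<Rightarrow> 'b::euclidean_space"
  assumes K: "finite K" and A: "\<And>q. q \<in> K \<Longrightarrow> (\<lambda>k. A k q) \<longlonglongrightarrow> a q"
    and rank: "\<forall>\<^sub>F k in sequentially. dim (A k ` K) = dim (a ` K)"
    and rel: "(\<Sum>q\<in>K. b q *\<^sub>R a q) = 0"
  obtains c where "\<forall>\<^sub>F k in sequentially. (\<Sum>q\<in>K. c k q *\<^sub>R A k q) = 0"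
    "\<And>q. q \<in> K \<Longrightarrow> (\<lambda>k. c k q) \<longlonglongrightarrow> b q"
proof -
  obtain B where B: "B \<subseteq> a ` K" "independent B" "a ` K \<subseteq> span B" "card B = dim (a ` K)"
    using basis_exists[of "a ` K"] by blast
  obtain J where J: "J \<subseteq> K" "inj_on a J" "B = a ` J"
    using B(1) unfolding subset_image_inj by blast
  have fJ: "finite J" using J(1) K finite_subset by blast
  have L: "lin_indep_family a J" using B J fJ by (simp add: lin_indep_family_iff_independent)
  have cJ: "card J = dim (a ` K)" using B(4) J by (simp add: card_image)
  have evL: "\<forall>\<^sub>F k in sequentially. lin_indep_family (A k) J"
    using A J(1) by (intro lin_indep_family_perturb[OF fJ L]) auto
  have "\<forall>\<^sub>F k in sequentially. \<forall>q\<in>K. A k q \<in> span (A k ` J)"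
    using evL rank
  proof eventually_elim
    case (elim k)
    have "span (A k ` J) = span (A k ` K)"
      using elim cJ fJ J(1) by (intro dim_eq_span) (auto simp: lin_indep_family_iff_dim)
    then show ?case by (auto intro: span_base)
  qed
  then have ex: "\<forall>\<^sub>F k in sequentially. \<exists>c. (\<Sum>p\<in>J. c p *\<^sub>R A k p) = - (\<Sum>q\<in>K - J. b q *\<^sub>R A k q)"
    using evL
  proof eventually_elim
    case (elim k)
    have inj: "inj_on (A k) J" using elim fJ by (simp add: lin_indep_family_iff_independent)
    have "- (\<Sum>q\<in>K - J. b q *\<^sub>R A k q) \<in> span (A k ` J)"
      using elim by (intro span_neg span_sum span_scale) auto
    then obtain u where "- (\<Sum>q\<in>K - J. b q *\<^sub>R A k q) = (\<Sum>v\<in>A k ` J. u v *\<^sub>R v)"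
      using fJ by (auto simp: span_finite)
    then have "(\<Sum>p\<in>J. u (A k p) *\<^sub>R A k p) = - (\<Sum>q\<in>K - J. b q *\<^sub>R A k q)"
      using inj by (simp add: sum.reindex)
    then show ?case by (rule exI[of _ "\<lambda>p. u (A k p)"])
  qed
  \<comment> \<open>The choice is meaningful only for large \<open>k\<close>, where
    \<open>ex\<close> provides a solution.\<close>
  define c0 where "c0 = (\<lambda>k. SOME c. (\<Sum>p\<in>J. c p *\<^sub>R A k p) = - (\<Sum>q\<in>K - J. b q *\<^sub>R A k q))"
  have c0: "\<forall>\<^sub>F k in sequentially. (\<Sum>p\<in>J. c0 k p *\<^sub>R A k p) = - (\<Sum>q\<in>K - J. b q *\<^sub>R A k q)"
    using ex unfolding c0_def by (rule eventually_mono) (fact someI_ex)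
  have split: "(\<Sum>q\<in>K. f q) = (\<Sum>q\<in>J. f q) + (\<Sum>q\<in>K - J. f q)" for f :: "'q \<Rightarrow> 'b"
    using K J(1) by (simp add: sum.subset_diff add.commute)
  have "(\<lambda>k. - (\<Sum>q\<in>K - J. b q *\<^sub>R A k q)) \<longlonglongrightarrow> - (\<Sum>q\<in>K - J. b q *\<^sub>R a q)"
    using A by (intro tendsto_intros) auto
  also have "- (\<Sum>q\<in>K - J. b q *\<^sub>R a q) = (\<Sum>p\<in>J. b p *\<^sub>R a p)"
    using rel split[of "\<lambda>q. b q *\<^sub>R a q"] by (simp add: neg_eq_iff_add_eq_0 add.commute)
  finally have "(\<lambda>k. - (\<Sum>q\<in>K - J. b q *\<^sub>R A k q)) \<longlonglongrightarrow> (\<Sum>p\<in>J. b p *\<^sub>R a p)" .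
  then have "(\<lambda>k. \<Sum>p\<in>J. c0 k p *\<^sub>R A k p) \<longlonglongrightarrow> (\<Sum>p\<in>J. b p *\<^sub>R a p)"
    by (rule Lim_transform_eventually) (use c0 in \<open>auto elim: eventually_mono\<close>)
  from lin_indep_family_coeff_tendsto[OF fJ L _ this] A J(1)
  obtain d where d: "\<And>q. q \<in> J \<Longrightarrow> (\<lambda>k. c0 k q) \<longlonglongrightarrow> d q"
      "(\<Sum>q\<in>J. d q *\<^sub>R a q) = (\<Sum>p\<in>J. b p *\<^sub>R a p)" by blast
  have db: "d q = b q" if "q \<in> J" for q
    using lin_indep_familyD[OF L, of "\<lambda>q. d q - b q"] d(2) that
    by (simp add: scaleR_left_diff_distrib sum_subtractf)
  define c where "c = (\<lambda>k q. if q \<in> J then c0 k q else b q)"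
  show ?thesis
  proof
    show "\<forall>\<^sub>F k in sequentially. (\<Sum>q\<in>K. c k q *\<^sub>R A k q) = 0"
      using c0 by eventually_elim (simp add: split c_def)
    show "(\<lambda>k. c k q) \<longlonglongrightarrow> b q" if "q \<in> K" for q
      using d(1)[of q] db[of q] by (cases "q \<in> J") (auto simp: c_def)
  qed
qed

section \<open>Multipliers from quadratic penalties\<close>

lemma GDERIV_half_square_dist:
  fixes z :: "'b::real_inner"
  shows "GDERIV (\<lambda>y. (norm (y - z))\<^sup>2 / 2) y :> y - z"
  unfolding gderiv_def power2_norm_eq_inner
  by (auto intro!: derivative_eq_intros simp: inner_commute)

text \<open>Squaring removes the kink of \<open>max 0\<close> at the origin, so the penalty below is
  differentiable and its minimizers are stationary.\<close>

lemma DERIV_square_positive_part: "DERIV (\<lambda>x. (max 0 x)\<^sup>2) x :> 2 * max 0 (x::real)"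
proof (cases x "0::real" rule: linorder_cases)
  case less
  have "DERIV (\<lambda>x. 0) x :> 2 * max 0 x" using less by simp
  then show ?thesis
    by (rule DERIV_cong_ev[THEN iffD1, rotated -1, OF _ refl _ refl])
      (use less order_tendstoD(2)[OF tendsto_ident_at[of x UNIV], of 0] in
        \<open>auto simp: eventually_nhds intro!: exI[of _ "{..<0::real}"]\<close>)
next
  case equal
  have "(\<lambda>h. (max 0 h)\<^sup>2 / h) \<midarrow>0\<rightarrow> (0::real)"
  proof (rule Lim_null_comparison)
    show "\<forall>\<^sub>F h in at 0. norm ((max 0 h)\<^sup>2 / h) \<le> \<bar>h\<bar>"
      by (auto simp: max_def power2_eq_square)
    show "(\<lambda>h::real. \<bar>h\<bar>) \<midarrow>0\<rightarrow> 0" by (intro tendsto_eq_intros) auto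
  qed
  then show ?thesis using equal by (simp add: DERIV_def)
next
  case greater
  have "DERIV (\<lambda>x. x\<^sup>2) x :> 2 * max 0 x" using greater by (auto intro!: derivative_eq_intros)
  then show ?thesis
    by (rule DERIV_cong_ev[THEN iffD1, rotated -1, OF _ refl _ refl])
      (use greater in \<open>auto simp: eventually_nhds intro!: exI[of _ "{0::real<..}"]\<close>)
qed

lemma GDERIV_sum:
  assumes "\<And>i. i \<in> I \<Longrightarrow> GDERIV (f i) x :> F i"
  shows "GDERIV (\<lambda>x. \<Sum>i\<in>I. f i x) x :> (\<Sum>i\<in>I. F i)"
  using assms unfolding gderiv_def inner_sum_right by (rule has_derivative_sum)

lemma GDERIV_cmult:
  assumes "GDERIV f x :> F"
  shows "GDERIV (\<lambda>x. c * f x) x :> c *\<^sub>R F"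
  using GDERIV_mult[OF GDERIV_const assms, of c] by simp

lemma GDERIV_isCont: "GDERIV f x :> F \<Longrightarrow> isCont f x"
  unfolding gderiv_def by (rule has_derivative_continuous)

text \<open>The mean value inequality for \<open>h\<close> minus its linearization at
  \<open>z0\<close>, on a ball where the gradient varies by at most \<open>e\<close>. Both endpoints
  are free, as the later comparisons are between two moving points.\<close>

lemma strict_gradient:
  fixes h :: "'a::real_inner \<Rightarrow> real"
  assumes deriv: "\<And>z. GDERIV h z :> G z" and cont: "isCont G z0" and e: "e > 0"
  obtains d where "d > 0"
    "\<And>z z'. z \<in> ball z0 d \<Longrightarrow> z' \<in> ball z0 d \<Longrightarrow>
       \<bar>h z' - h z - G z0 \<bullet> (z' - z)\<bar> \<le> e * norm (z' - z)"
proof -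
  obtain d where d: "d > 0" "\<And>z. dist z z0 < d \<Longrightarrow> dist (G z) (G z0) < e"
    using cont e unfolding continuous_at_eps_delta by blast
  have "\<bar>h z' - h z - G z0 \<bullet> (z' - z)\<bar> \<le> e * norm (z' - z)"
    if z: "z \<in> ball z0 d" "z' \<in> ball z0 d" for z z'
  proof -
    have "norm ((h z' - G z0 \<bullet> z') - (h z - G z0 \<bullet> z)) \<le> e * norm (z' - z)"
    proof (rule differentiable_bound[OF convex_ball[of z0 d], where f' = "\<lambda>x w. w \<bullet> (G x - G z0)"])
      fix x assume x: "x \<in> ball z0 d"
      show "((\<lambda>z. h z - G z0 \<bullet> z) has_derivative (\<lambda>w. w \<bullet> (G x - G z0))) (at x within ball z0 d)"
        using deriv[of x, unfolded gderiv_def]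
        by (auto intro!: derivative_eq_intros simp: inner_diff_right inner_commute
              dest: has_derivative_at_withinI)
      have "norm (G x - G z0) \<le> e" using d(2)[of x] x by (simp add: dist_norm norm_minus_commute)
      then have "norm (w \<bullet> (G x - G z0)) \<le> e * norm w" for w
        using Cauchy_Schwarz_ineq2[of w "G x - G z0"] mult_left_mono[of "norm (G x - G z0)" e "norm w"]
        by (simp add: mult.commute)
      then show "onorm (\<lambda>w. w \<bullet> (G x - G z0)) \<le> e" using e by (intro onorm_bound) auto
    qed (use z in auto)
    then show ?thesis by (simp add: inner_diff_right algebra_simps)
  qed
  then show ?thesis using that d(1) by blast
qed

lemma strict_gradient_quotient:
  fixes h :: "'a::real_inner \<Rightarrow> real"
  assumes deriv: "\<And>z. GDERIV h z :> G z" and cont: "isCont G z0"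
    and t: "\<And>k. t k > 0" and Z: "Z \<longlonglongrightarrow> z0" "Z' \<longlonglongrightarrow> z0"
    and C: "\<forall>\<^sub>F k in sequentially. norm (Z' k - Z k) \<le> C * t k"
  shows "(\<lambda>k. (h (Z' k) - h (Z k) - G z0 \<bullet> (Z' k - Z k)) / t k) \<longlonglongrightarrow> 0"
proof (rule tendstoI)
  fix e :: real assume e: "e > 0"
  \<comment> \<open>Since \<open>C\<close> may be negative, its absolute value enters; adding 1
    makes the denominator positive and the final estimate strict.\<close>
  define e' where "e' = e / (\<bar>C\<bar> + 1)"
  have e': "e' > 0" using e by (simp add: e'_def add_nonneg_pos)
  obtain d where d: "d > 0" "\<And>z z'. z \<in> ball z0 d \<Longrightarrow> z' \<in> ball z0 d \<Longrightarrow>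
       \<bar>h z' - h z - G z0 \<bullet> (z' - z)\<bar> \<le> e' * norm (z' - z)"
    using strict_gradient[OF deriv cont e'] by blast
  show "\<forall>\<^sub>F k in sequentially. dist ((h (Z' k) - h (Z k) - G z0 \<bullet> (Z' k - Z k)) / t k) 0 < e"
    using C tendstoD[OF Z(1) d(1)] tendstoD[OF Z(2) d(1)]
  proof eventually_elim
    case (elim k)
    have "\<bar>h (Z' k) - h (Z k) - G z0 \<bullet> (Z' k - Z k)\<bar> \<le> e' * norm (Z' k - Z k)"
      using elim by (intro d(2)) (auto simp: dist_commute)
    also have "\<dots> \<le> e' * (\<bar>C\<bar> * t k)"
      using elim e' t[of k] mult_right_mono[of C "\<bar>C\<bar>" "t k"]
      by (intro mult_left_mono order_trans[OF elim(1)]) auto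
    also have "\<dots> < e' * ((\<bar>C\<bar> + 1) * t k)" using e' t[of k] by simp
    also have "\<dots> = e * t k" by (simp add: e'_def)
    finally show ?case using t[of k] by (simp add: pos_divide_less_eq)
  qed
qed

text \<open>Pigeonhole, used to freeze a varying index set of constraints along a
  subsequence.\<close>

lemma finite_range_constant_subseq:
  fixes f :: "nat \<Rightarrow> 'c"
  assumes "finite A" "\<And>k. f k \<in> A"
  obtains s a where "strict_mono (s :: nat \<Rightarrow> nat)" "\<And>k. f (s k) = a"
proof -
  have "finite (range f)" using assms by (meson finite_subset image_subsetI)
  then obtain a where "infinite {k \<in> UNIV. f k = f a}"
    using pigeonhole_infinite[of UNIV f] by auto
  then obtain s :: "nat \<Rightarrow> nat" where "strict_mono s" "\<And>k. s k \<in> {k \<in> UNIV. f k = f a}"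
    using infinite_enumerate by blast
  then show ?thesis using that by blast
qed

text \<open>Stationarity of the minimizers of the quadratic penalty functions yields approximate
  multipliers. Reducing them to a linearly independent family of gradients before passing to the
  limit keeps them bounded; the qualification hypothesis ensures that linear independence survives
  in the limit.\<close>

theorem multipliers_exist:
  fixes \<phi> :: "'b::euclidean_space \<Rightarrow> real" and h :: "'q \<Rightarrow> 'b \<Rightarrow> real"
  assumes Q: "finite Q"
    and \<phi>: "\<And>y. GDERIV \<phi> y :> F y" "isCont F y0"
    and h: "\<And>q y. q \<in> Q \<Longrightarrow> GDERIV (h q) y :> D q y" "\<And>q. q \<in> Q \<Longrightarrow> isCont (D q) y0"
    and feas: "\<And>q. q \<in> Q \<Longrightarrow> h q y0 \<le> 0"
    and r: "r > 0"
    and opt: "\<And>y. y \<in> cball y0 r \<Longrightarrow> (\<And>q. q \<in> Q \<Longrightarrow> h q y \<le> 0) \<Longrightarrow> \<phi> y0 \<le> \<phi> y"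
    and cq: "\<And>J. J \<subseteq> Q \<Longrightarrow> \<forall>\<^sub>F y in nhds y0.
               lin_indep_family (\<lambda>q. D q y) J \<longrightarrow> lin_indep_family (\<lambda>q. D q y0) J"
  obtains J m where "J \<subseteq> Q" "\<And>q. q \<in> J \<Longrightarrow> h q y0 = 0" "\<And>q. q \<in> J \<Longrightarrow> m q \<ge> 0"
    "lin_indep_family (\<lambda>q. D q y0) J" "F y0 + (\<Sum>q\<in>J. m q *\<^sub>R D q y0) = 0"
proof -
  define P where "P = (\<lambda>y. \<Sum>q\<in>Q. (max 0 (h q y))\<^sup>2)"
  \<comment> \<open>The factor \<open>k / 2\<close> cancels the 2 from the derivative of the square.
    The proximal term singles out \<open>y0\<close>, which need not be a strict minimizer, so that
    the penalty minimizers must converge to it.\<close>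
  define \<Phi> where "\<Phi> = (\<lambda>k y. \<phi> y + (k / 2) * P y + (norm (y - y0))\<^sup>2 / 2)"
  define G where "G = (\<lambda>k y. F y + (\<Sum>q\<in>Q. (k * max 0 (h q y)) *\<^sub>R D q y) + (y - y0))"
  have P_deriv: "GDERIV P y :> (\<Sum>q\<in>Q. (2 * max 0 (h q y)) *\<^sub>R D q y)" for y
    unfolding P_def
    by (intro GDERIV_sum GDERIV_DERIV_compose[OF h(1) DERIV_square_positive_part])
  have \<Phi>_deriv: "GDERIV (\<Phi> k) y :> G k y" for k y
  proof -
    have "GDERIV (\<Phi> k) y :> F y + (k / 2) *\<^sub>R (\<Sum>q\<in>Q. (2 * max 0 (h q y)) *\<^sub>R D q y) + (y - y0)"
      unfolding \<Phi>_def by (intro GDERIV_add \<phi>(1) GDERIV_cmult P_deriv GDERIV_half_square_dist)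
    moreover have "(k / 2) *\<^sub>R (\<Sum>q\<in>Q. (2 * max 0 (h q y)) *\<^sub>R D q y) =
        (\<Sum>q\<in>Q. (k * max 0 (h q y)) *\<^sub>R D q y)"
      unfolding scaleR_sum_right scaleR_scaleR by simp
    ultimately show ?thesis by (simp only: G_def)
  qed
  have cont: "continuous_on A (\<Phi> k)" "continuous_on A \<phi>" "continuous_on A P" for k A
    using GDERIV_isCont[OF \<Phi>_deriv] GDERIV_isCont[OF \<phi>(1)] GDERIV_isCont[OF P_deriv]
    by (auto intro!: continuous_at_imp_continuous_on)
  have P0: "P y0 = 0" using feas by (auto simp: P_def intro!: sum.neutral)
  have Pnn: "P y \<ge> 0" for y by (simp add: P_def sum_nonneg)
  have ne: "cball y0 r \<noteq> {}" using r by auto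
  have "\<exists>y\<in>cball y0 r. \<forall>y'\<in>cball y0 r. \<Phi> (real k) y \<le> \<Phi> (real k) y'" for k :: nat
    by (rule continuous_attains_inf[OF compact_cball ne cont(1)])
  then obtain Y where Y: "\<And>k. Y k \<in> cball y0 r"
      "\<And>k y'. y' \<in> cball y0 r \<Longrightarrow> \<Phi> (real k) (Y k) \<le> \<Phi> (real k) y'" by metis
  obtain yl s where yl: "yl \<in> cball y0 r" and s: "strict_mono s" and lim: "(Y \<circ> s) \<longlonglongrightarrow> yl"
    using compact_cball[of y0 r] Y(1) unfolding compact_def by metis
  have le: "\<phi> (Y k) + (real k / 2) * P (Y k) + (norm (Y k - y0))\<^sup>2 / 2 \<le> \<phi> y0" for k
    using Y(2)[of y0 k] r P0 by (simp add: \<Phi>_def)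
  have lim\<phi>: "(\<lambda>k. \<phi> (Y (s k))) \<longlonglongrightarrow> \<phi> yl" and limP: "(\<lambda>k. P (Y (s k))) \<longlonglongrightarrow> P yl"
    using lim isCont_tendsto_compose[OF GDERIV_isCont[OF \<phi>(1)]]
      isCont_tendsto_compose[OF GDERIV_isCont[OF P_deriv]] by (auto simp: o_def)
  \<comment> \<open>If \<open>P yl\<close> were positive, the penalty term would tend to infinity
    against the bound \<open>le\<close>. So \<open>yl\<close> is feasible, \<open>opt\<close>
    applies to it, and comparing the limit of \<open>le\<close> with \<open>opt\<close> forces the
    proximal term to vanish.\<close>
  have "yl = y0"
  proof -
    have ge: "0 \<le> (norm (Y k - y0))\<^sup>2 / 2" "0 \<le> (real k / 2) * P (Y k)" for k
      using Pnn by auto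
    have "P yl \<le> 0"
    proof (rule ccontr)
      assume "\<not> P yl \<le> 0"
      then have pos: "P yl > 0" by simp
      have "filterlim (\<lambda>k. P (Y (s k)) * (real (s k) / 2)) at_top sequentially"
        by (intro filterlim_tendsto_pos_mult_at_top[OF limP pos] filterlim_at_top_mult_tendsto_pos
              filterlim_compose[OF filterlim_real_sequentially filterlim_subseq[OF s]]
              filterlim_tendsto_pos_mult_at_top[OF tendsto_const, of "1/2::real", simplified])
      then have "filterlim (\<lambda>k. \<phi> (Y (s k)) + P (Y (s k)) * (real (s k) / 2)) at_top sequentially"
        by (rule filterlim_tendsto_add_at_top[OF lim\<phi>])
      then have "\<forall>\<^sub>F k in sequentially. \<phi> (Y (s k)) + P (Y (s k)) * (real (s k) / 2) > \<phi> y0"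
        unfolding filterlim_at_top_dense by blast
      then obtain k where "\<phi> (Y (s k)) + P (Y (s k)) * (real (s k) / 2) > \<phi> y0"
        by (auto dest: eventually_happens)
      then show False using le[of "s k"] ge(1)[of "s k"] by (simp add: mult.commute)
    qed
    then have "P yl = 0" using Pnn[of yl] by linarith
    then have "h q yl \<le> 0" if "q \<in> Q" for q
      using that Q unfolding P_def by (subst (asm) sum_nonneg_eq_0_iff) auto
    then have 1: "\<phi> y0 \<le> \<phi> yl" using opt yl by blast
    have "(\<lambda>k. \<phi> (Y (s k)) + (norm (Y (s k) - y0))\<^sup>2 / 2) \<longlonglongrightarrow> \<phi> yl + (norm (yl - y0))\<^sup>2 / 2"
      using lim\<phi> lim by (intro tendsto_intros) (auto simp: o_def)
    moreover have "\<phi> (Y (s k)) + (norm (Y (s k) - y0))\<^sup>2 / 2 \<le> \<phi> y0" for k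
      using le[of "s k"] ge(2)[of "s k"] by linarith
    ultimately have "\<phi> yl + (norm (yl - y0))\<^sup>2 / 2 \<le> \<phi> y0"
      by (intro LIMSEQ_le_const2) auto
    then have "(norm (yl - y0))\<^sup>2 \<le> 0" using 1 by linarith
    then show ?thesis by simp
  qed
  with lim have lim: "(\<lambda>k. Y (s k)) \<longlonglongrightarrow> y0" by (simp add: o_def)
  obtain N where N: "\<And>k. k \<ge> N \<Longrightarrow> dist (Y (s k)) y0 < r"
    using tendstoD[OF lim r] unfolding eventually_sequentially by blast
  \<comment> \<open>Dropping \<open>N\<close> terms leaves minimizers in the open ball, where the
    derivative of the penalty function vanishes.\<close>
  define Z where "Z = (\<lambda>k. Y (s (k + N)))"
  have limZ: "Z \<longlonglongrightarrow> y0" unfolding Z_def using lim by (rule LIMSEQ_ignore_initial_segment)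
  have G0: "G (real (s (k + N))) (Z k) = 0" for k
  proof -
    let ?k = "real (s (k + N))"
    have "(\<lambda>w. w \<bullet> G ?k (Z k)) = (\<lambda>w. 0)"
    proof (rule differential_zero_maxmin[where S = "ball y0 r"])
      show "Z k \<in> ball y0 r" using N[of "k + N"] by (simp add: Z_def dist_commute)
      show "(\<Phi> ?k has_derivative (\<lambda>w. w \<bullet> G ?k (Z k))) (at (Z k))"
        using \<Phi>_deriv unfolding gderiv_def .
      show "(\<forall>y\<in>ball y0 r. \<Phi> ?k y \<le> \<Phi> ?k (Z k)) \<or> (\<forall>y\<in>ball y0 r. \<Phi> ?k (Z k) \<le> \<Phi> ?k y)"
        using Y(2)[of _ "s (k + N)"] by (simp add: Z_def)
    qed simp
    then show ?thesis by (metis inner_eq_zero_iff)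
  qed
  have "\<exists>Jm. fst Jm \<subseteq> {q \<in> Q. real (s (k + N)) * max 0 (h q (Z k)) > 0} \<and> (\<forall>q\<in>fst Jm. snd Jm q \<ge> 0) \<and>
      lin_indep_family (\<lambda>q. D q (Z k)) (fst Jm) \<and>
      (\<Sum>q\<in>fst Jm. snd Jm q *\<^sub>R D q (Z k)) =
        (\<Sum>q\<in>Q. (real (s (k + N)) * max 0 (h q (Z k))) *\<^sub>R D q (Z k))" for k
    by (rule conic_caratheodory[OF Q, of "\<lambda>q. real (s (k + N)) * max 0 (h q (Z k))" "\<lambda>q. D q (Z k)"])
      auto
  from choice[OF allI[OF this]] obtain Jm where Jm: "\<forall>k.
      fst (Jm k) \<subseteq> {q \<in> Q. real (s (k + N)) * max 0 (h q (Z k)) > 0} \<and> (\<forall>q\<in>fst (Jm k). snd (Jm k) q \<ge> 0) \<and>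
      lin_indep_family (\<lambda>q. D q (Z k)) (fst (Jm k)) \<and>
      (\<Sum>q\<in>fst (Jm k). snd (Jm k) q *\<^sub>R D q (Z k)) =
        (\<Sum>q\<in>Q. (real (s (k + N)) * max 0 (h q (Z k))) *\<^sub>R D q (Z k))" ..
  define J m where "J = (\<lambda>k. fst (Jm k))" and "m = (\<lambda>k. snd (Jm k))"
  have J: "\<And>k. J k \<subseteq> {q \<in> Q. real (s (k + N)) * max 0 (h q (Z k)) > 0}"
    and m: "\<And>k q. q \<in> J k \<Longrightarrow> m k q \<ge> 0"
    and L: "\<And>k. lin_indep_family (\<lambda>q. D q (Z k)) (J k)"
    and S: "\<And>k. (\<Sum>q\<in>J k. m k q *\<^sub>R D q (Z k)) =
         (\<Sum>q\<in>Q. (real (s (k + N)) * max 0 (h q (Z k))) *\<^sub>R D q (Z k))"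
    using Jm by (auto simp: J_def m_def)
  have "J k \<in> Pow Q" for k using J by blast
  then obtain s' K where s': "strict_mono (s' :: nat \<Rightarrow> nat)" and K: "\<And>k. J (s' k) = K"
    using finite_range_constant_subseq[of "Pow Q" J] Q by blast
  have KQ: "K \<subseteq> Q" using J[of "s' 0"] K[of 0] by auto
  have fK: "finite K" using KQ Q finite_subset by blast
  have limZ': "(\<lambda>k. Z (s' k)) \<longlonglongrightarrow> y0" using LIMSEQ_subseq_LIMSEQ[OF limZ s'] by (simp add: o_def)
  have LK: "lin_indep_family (\<lambda>q. D q y0) K"
  proof -
    have "\<forall>\<^sub>F k in sequentially. lin_indep_family (\<lambda>q. D q (Z (s' k))) K \<longrightarrow>
        lin_indep_family (\<lambda>q. D q y0) K"
      using limZ' cq[OF KQ] unfolding filterlim_iff by blast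
    then show ?thesis using L[of "s' _"] K by (auto dest: eventually_happens)
  qed
  have "(\<lambda>k. - (F (Z (s' k)) + (Z (s' k) - y0))) \<longlonglongrightarrow> - (F y0 + (y0 - y0))"
    by (intro tendsto_intros isCont_tendsto_compose[OF \<phi>(2)] limZ')
  moreover have "(\<Sum>q\<in>K. m (s' k) q *\<^sub>R D q (Z (s' k))) = - (F (Z (s' k)) + (Z (s' k) - y0))" for k
    using S[of "s' k"] G0[of "s' k"] unfolding G_def K
    by (simp add: add_eq_0_iff2 algebra_simps)
  ultimately have lim_sum: "(\<lambda>k. \<Sum>q\<in>K. m (s' k) q *\<^sub>R D q (Z (s' k))) \<longlonglongrightarrow> - F y0" by simp
  have "(\<lambda>k. D q (Z (s' k))) \<longlonglongrightarrow> D q y0" if "q \<in> K" for q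
    using that KQ by (intro isCont_tendsto_compose[OF h(2) limZ']) auto
  then obtain d where d: "\<And>q. q \<in> K \<Longrightarrow> (\<lambda>k. m (s' k) q) \<longlonglongrightarrow> d q" "(\<Sum>q\<in>K. d q *\<^sub>R D q y0) = - F y0"
    using lin_indep_family_coeff_tendsto[OF fK LK _ lim_sum] by blast
  show ?thesis
  proof
    show "K \<subseteq> Q" by fact
    show "lin_indep_family (\<lambda>q. D q y0) K" by fact
    show "F y0 + (\<Sum>q\<in>K. d q *\<^sub>R D q y0) = 0" using d(2) by simp
    fix q assume q: "q \<in> K"
    show "d q \<ge> 0"
      using d(1)[OF q] m K q by (intro LIMSEQ_le_const[of "\<lambda>k. m (s' k) q"]) auto
    \<comment> \<open>Complementarity: constraints with a positive penalty coefficient are violated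
      along the sequence, so in the limit they are at least zero, while \<open>y0\<close> is
      feasible.\<close>
    have "h q (Z (s' k)) > 0" for k
      using J[of "s' k"] K q by (auto simp: zero_less_mult_iff)
    moreover have "(\<lambda>k. h q (Z (s' k))) \<longlonglongrightarrow> h q y0"
      using KQ q by (intro isCont_tendsto_compose[OF GDERIV_isCont[OF h(1)] limZ']) auto
    ultimately have "h q y0 \<ge> 0" by (intro LIMSEQ_le_const) (auto intro: less_imp_le)
    then show "h q y0 = 0" using feas KQ q by (meson order_antisym subsetD)
  qed
qed

section \<open>Constraints of constant rank\<close>

lemma GDERIV_partial_snd: "GDERIV h (x, y) :> d \<Longrightarrow> GDERIV (\<lambda>y. h (x, y)) y :> snd d"
  unfolding gderiv_def
  by (drule has_derivative_compose[of "\<lambda>y. (x, y)", rotated, where f' = "\<lambda>w. (0, w)"])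
    (auto intro!: derivative_eq_intros simp: inner_prod_def)

lemma GDERIV_partial_fst: "GDERIV h (x, y) :> d \<Longrightarrow> GDERIV (\<lambda>x. h (x, y)) x :> fst d"
  unfolding gderiv_def
  by (drule has_derivative_compose[of "\<lambda>x. (x, y)", rotated, where f' = "\<lambda>w. (w, 0)"])
    (auto intro!: derivative_eq_intros simp: inner_prod_def)

text \<open>Signs and repetitions leave the span unchanged. An index \<open>(q, 1)\<close> or
  \<open>(q, - 1)\<close> stands for a constraint or its negative.\<close>

lemma dim_signed_family:
  fixes a :: "'q \<Rightarrow> 'b::euclidean_space"
  assumes "\<And>p. p \<in> J \<Longrightarrow> snd p = 1 \<or> snd p = (- 1 :: real)"
  shows "dim ((\<lambda>p. snd p *\<^sub>R a (fst p)) ` J) = dim (a ` fst ` J)"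
proof -
  have "span ((\<lambda>p. snd p *\<^sub>R a (fst p)) ` J) = span (a ` fst ` J)"
  proof (rule span_eq[THEN iffD2], intro conjI subsetI)
    fix v assume "v \<in> (\<lambda>p. snd p *\<^sub>R a (fst p)) ` J"
    then show "v \<in> span (a ` fst ` J)" by (auto intro!: span_scale intro: span_base)
  next
    fix v assume "v \<in> a ` fst ` J"
    then obtain p where p: "p \<in> J" "v = a (fst p)" by blast
    have "snd p *\<^sub>R (snd p *\<^sub>R a (fst p)) \<in> span ((\<lambda>p. snd p *\<^sub>R a (fst p)) ` J)"
      using p(1) by (intro span_scale[OF span_base]) auto
    then show "v \<in> span ((\<lambda>p. snd p *\<^sub>R a (fst p)) ` J)" using p assms[OF p(1)] by auto
  qed
  then show ?thesis using dim_span by metis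
qed

lemma finite_uniform_radius:
  assumes "finite Q" "\<And>q. q \<in> Q \<Longrightarrow> \<exists>d>0. P q d"
    and mono: "\<And>q d d'. P q d \<Longrightarrow> d' \<le> d \<Longrightarrow> P q d'"
  shows "\<exists>d>0::real. \<forall>q\<in>Q. P q d"
  using assms(1,2)
proof (induction Q)
  case empty
  show ?case by (intro exI[of _ 1]) auto
next
  case (insert q Q)
  then obtain d1 d2 where "d1 > 0" "\<forall>q\<in>Q. P q d1" "d2 > 0" "P q d2" by (metis insertCI)
  then show ?case using mono by (intro exI[of _ "min d1 d2"]) auto
qed

text \<open>The index type is left open so that signed copies of a system are again an instance.
  Derivatives are taken in both variables, while the rank condition concerns the second component
  alone.\<close>

locale constant_rank_constraints =
  fixes Q :: "'q set"
    and h :: "'q \<Rightarrow> 'a::euclidean_space \<times> 'b::euclidean_space \<Rightarrow> real"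
    and G :: "'q \<Rightarrow> 'a \<times> 'b \<Rightarrow> 'a \<times> 'b"
    and x0 :: 'a and y0 :: 'b
  assumes finite_Q: "finite Q"
    and deriv: "\<And>q z. q \<in> Q \<Longrightarrow> GDERIV (h q) z :> G q z"
    and cont: "\<And>q. q \<in> Q \<Longrightarrow> continuous_on UNIV (G q)"
    and rank: "\<And>K. K \<subseteq> Q \<Longrightarrow> \<forall>\<^sub>F z in nhds (x0, y0).
       dim ((\<lambda>q. snd (G q z)) ` K) = dim ((\<lambda>q. snd (G q (x0, y0))) ` K)"
begin

abbreviation D :: "'q \<Rightarrow> 'a \<times> 'b \<Rightarrow> 'b" where "D q z \<equiv> snd (G q z)"

section \<open>Local consequences of constant rank\<close>

lemma isCont_G: "q \<in> Q \<Longrightarrow> isCont (G q) z"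
  using cont continuous_on_eq_continuous_at by blast

lemma tendsto_D: "q \<in> Q \<Longrightarrow> (g \<longlongrightarrow> z) F \<Longrightarrow> ((\<lambda>k. D q (g k)) \<longlongrightarrow> D q z) F"
  by (intro tendsto_snd isCont_tendsto_compose[OF isCont_G])

lemma tendsto_h: "q \<in> Q \<Longrightarrow> (g \<longlongrightarrow> z) F \<Longrightarrow> ((\<lambda>k. h q (g k)) \<longlongrightarrow> h q z) F"
  by (intro isCont_tendsto_compose[OF GDERIV_isCont[OF deriv]])

lemma restrict: "K \<subseteq> Q \<Longrightarrow> constant_rank_constraints K h G x0 y0"
  by unfold_locales (use finite_Q finite_subset deriv cont rank in auto)

text \<open>Constraints in \<open>E\<close> are added with reversed sign, which turns them into
  equations; every rank stays that of the underlying unsigned family.\<close>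

lemma signed:
  assumes "E \<subseteq> Q"
  shows "constant_rank_constraints (Q \<times> {1} \<union> E \<times> {- 1})
    (\<lambda>p z. snd p * h (fst p) z) (\<lambda>p z. snd p *\<^sub>R G (fst p) z) x0 y0"
proof
  show "finite (Q \<times> {1::real} \<union> E \<times> {- 1})" using finite_Q assms finite_subset by auto
next
  fix p and z :: "'a \<times> 'b" assume "p \<in> Q \<times> {1::real} \<union> E \<times> {- 1}"
  then have "fst p \<in> Q" using assms by auto
  then show "GDERIV (\<lambda>z. snd p * h (fst p) z) z :> snd p *\<^sub>R G (fst p) z"
    by (intro GDERIV_cmult deriv)
  show "continuous_on UNIV (\<lambda>z. snd p *\<^sub>R G (fst p) z)"
    using cont[OF \<open>fst p \<in> Q\<close>] by (intro continuous_intros)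
next
  fix K assume K: "K \<subseteq> Q \<times> {1::real} \<union> E \<times> {- 1}"
  then have "fst ` K \<subseteq> Q" using assms by (auto dest!: subsetD[OF K])
  moreover have "dim ((\<lambda>p. snd (snd p *\<^sub>R G (fst p) z)) ` K) = dim ((\<lambda>q. D q z) ` fst ` K)" for z
    using dim_signed_family[of K "\<lambda>q. D q z"] K by force
  ultimately show "\<forall>\<^sub>F z in nhds (x0, y0).
      dim ((\<lambda>p. snd (snd p *\<^sub>R G (fst p) z)) ` K) =
      dim ((\<lambda>p. snd (snd p *\<^sub>R G (fst p) (x0, y0))) ` K)"
    using rank[of "fst ` K"] by simp
qed

text \<open>Here the linearization is taken at the moving point \<open>z\<close>, where the
  multiplier relations hold. Moving the gradient from \<open>(x0, y0)\<close> to \<open>z\<close>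
  uses up the second half of \<open>e\<close>.\<close>

lemma uniform_gradient:
  assumes e: "e > 0"
  obtains d where "d > 0"
    "\<And>q z z'. q \<in> Q \<Longrightarrow> z \<in> ball (x0, y0) d \<Longrightarrow> z' \<in> ball (x0, y0) d \<Longrightarrow>
       \<bar>h q z' - h q z - G q z \<bullet> (z' - z)\<bar> \<le> e * norm (z' - z)"
proof -
  let ?P = "\<lambda>q d. \<forall>z\<in>ball (x0, y0) d. \<forall>z'\<in>ball (x0, y0) d.
      \<bar>h q z' - h q z - G q z \<bullet> (z' - z)\<bar> \<le> e * norm (z' - z)"
  have "\<exists>d>0. \<forall>q\<in>Q. ?P q d"
  proof (rule finite_uniform_radius[OF finite_Q])
    fix q assume q: "q \<in> Q"
    obtain d1 where d1: "d1 > 0" "\<And>z z'. z \<in> ball (x0, y0) d1 \<Longrightarrow> z' \<in> ball (x0, y0) d1 \<Longrightarrow>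
       \<bar>h q z' - h q z - G q (x0, y0) \<bullet> (z' - z)\<bar> \<le> e / 2 * norm (z' - z)"
      using strict_gradient[OF deriv[OF q] isCont_G[OF q], of "e / 2" "(x0, y0)"] e by auto
    obtain d2 where d2: "d2 > 0" "\<And>z. dist z (x0, y0) < d2 \<Longrightarrow> dist (G q z) (G q (x0, y0)) < e / 2"
      using isCont_G[OF q, of "(x0, y0)"] half_gt_zero[OF e]
      unfolding continuous_at_eps_delta by blast
    have "\<bar>h q z' - h q z - G q z \<bullet> (z' - z)\<bar> \<le> e * norm (z' - z)"
      if z: "z \<in> ball (x0, y0) (min d1 d2)" "z' \<in> ball (x0, y0) (min d1 d2)" for z z'
    proof -
      have "\<bar>(G q z - G q (x0, y0)) \<bullet> (z' - z)\<bar> \<le> norm (G q z - G q (x0, y0)) * norm (z' - z)"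
        by (rule Cauchy_Schwarz_ineq2)
      also have "\<dots> \<le> e / 2 * norm (z' - z)"
        using d2(2)[of z] z by (intro mult_right_mono) (auto simp: dist_norm norm_minus_commute)
      finally have "\<bar>G q z \<bullet> (z' - z) - G q (x0, y0) \<bullet> (z' - z)\<bar> \<le> e / 2 * norm (z' - z)"
        by (simp add: inner_diff_left)
      moreover have "\<bar>h q z' - h q z - G q (x0, y0) \<bullet> (z' - z)\<bar> \<le> e / 2 * norm (z' - z)"
        using d1(2)[of z z'] z by auto
      moreover have "e * norm (z' - z) = e / 2 * norm (z' - z) + e / 2 * norm (z' - z)" by simp
      ultimately show ?thesis by linarith
    qed
    then show "\<exists>d>0. ?P q d" using d1(1) d2(1) by (intro exI[of _ "min d1 d2"]) auto
  next
    fix q d d' assume "?P q d" "d' \<le> d"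
    then show "?P q d'" by (meson subset_ball subsetD)
  qed
  then show ?thesis using that by blast
qed

lemma lin_indep_near:
  obtains C where "C > 0"
    "\<forall>\<^sub>F z in nhds (x0, y0). \<forall>J\<subseteq>Q.
       (lin_indep_family (\<lambda>q. D q z) J \<longleftrightarrow> lin_indep_family (\<lambda>q. D q (x0, y0)) J) \<and>
       (lin_indep_family (\<lambda>q. D q (x0, y0)) J \<longrightarrow>
          (\<forall>c. (\<Sum>q\<in>J. \<bar>c q\<bar>) \<le> C * norm (\<Sum>q\<in>J. c q *\<^sub>R D q z)))"
proof -
  have "\<exists>C>0. \<forall>\<^sub>F z in nhds (x0, y0). lin_indep_family (\<lambda>q. D q (x0, y0)) J \<longrightarrow>
          (\<forall>c. (\<Sum>q\<in>J. \<bar>c q\<bar>) \<le> C * norm (\<Sum>q\<in>J. c q *\<^sub>R D q z))" if J: "J \<in> Pow Q" for J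
  proof (cases "lin_indep_family (\<lambda>q. D q (x0, y0)) J")
    case True
    have fJ: "finite J" using J finite_Q finite_subset by blast
    obtain e C where eC: "e > 0" "C > 0"
      "\<And>A c. (\<And>q. q \<in> J \<Longrightarrow> norm (A q - D q (x0, y0)) \<le> e) \<Longrightarrow>
         (\<Sum>q\<in>J. \<bar>c q\<bar>) \<le> C * norm (\<Sum>q\<in>J. c q *\<^sub>R A q)"
      using lin_indep_family_coeff_bound[OF fJ True] by blast
    have "\<forall>\<^sub>F z in nhds (x0, y0). \<forall>q\<in>J. dist (D q z) (D q (x0, y0)) < e"
      using J by (intro eventually_ball_finite[OF fJ] ballI tendstoD[OF tendsto_D eC(1)])
        (auto simp: filterlim_ident)
    then have "\<forall>\<^sub>F z in nhds (x0, y0). \<forall>c. (\<Sum>q\<in>J. \<bar>c q\<bar>) \<le> C * norm (\<Sum>q\<in>J. c q *\<^sub>R D q z)"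
    proof eventually_elim
      case (elim z)
      show ?case
      proof
        fix c
        show "(\<Sum>q\<in>J. \<bar>c q\<bar>) \<le> C * norm (\<Sum>q\<in>J. c q *\<^sub>R D q z)"
          using elim by (intro eC(3)) (auto simp: dist_norm less_imp_le)
      qed
    qed
    then show ?thesis using eC(2) by (intro exI[of _ C]) (auto elim: eventually_mono)
  qed (intro exI[of _ 1], simp)
  then obtain Cf where Cf: "\<And>J. J \<in> Pow Q \<Longrightarrow> Cf J > 0"
    "\<And>J. J \<in> Pow Q \<Longrightarrow> \<forall>\<^sub>F z in nhds (x0, y0). lin_indep_family (\<lambda>q. D q (x0, y0)) J \<longrightarrow>
          (\<forall>c. (\<Sum>q\<in>J. \<bar>c q\<bar>) \<le> Cf J * norm (\<Sum>q\<in>J. c q *\<^sub>R D q z))"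
    using bchoice[of "Pow Q" "\<lambda>J C. C > 0 \<and> (\<forall>\<^sub>F z in nhds (x0, y0).
       lin_indep_family (\<lambda>q. D q (x0, y0)) J \<longrightarrow>
          (\<forall>c. (\<Sum>q\<in>J. \<bar>c q\<bar>) \<le> C * norm (\<Sum>q\<in>J. c q *\<^sub>R D q z)))"] by blast
  \<comment> \<open>Summing the positive constants of all subfamilies dominates each of
    them.\<close>
  define C where "C = (\<Sum>J\<in>Pow Q. Cf J)"
  have CfC: "Cf J \<le> C" if "J \<in> Pow Q" for J
    unfolding C_def using that finite_Q Cf(1) by (intro member_le_sum) (auto intro: less_imp_le)
  have "C > 0" using CfC[of "{}"] Cf(1)[of "{}"] by auto
  have "\<forall>\<^sub>F z in nhds (x0, y0). \<forall>J\<in>Pow Q.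
      lin_indep_family (\<lambda>q. D q (x0, y0)) J \<longrightarrow>
          (\<forall>c. (\<Sum>q\<in>J. \<bar>c q\<bar>) \<le> Cf J * norm (\<Sum>q\<in>J. c q *\<^sub>R D q z))"
    using Cf(2) finite_Q by (intro eventually_ball_finite ballI) auto
  moreover have "\<forall>\<^sub>F z in nhds (x0, y0). \<forall>J\<in>Pow Q.
      dim ((\<lambda>q. D q z) ` J) = dim ((\<lambda>q. D q (x0, y0)) ` J)"
    using rank finite_Q by (intro eventually_ball_finite ballI) auto
  ultimately have "\<forall>\<^sub>F z in nhds (x0, y0). \<forall>J\<subseteq>Q.
       (lin_indep_family (\<lambda>q. D q z) J \<longleftrightarrow> lin_indep_family (\<lambda>q. D q (x0, y0)) J) \<and>
       (lin_indep_family (\<lambda>q. D q (x0, y0)) J \<longrightarrow>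
          (\<forall>c. (\<Sum>q\<in>J. \<bar>c q\<bar>) \<le> C * norm (\<Sum>q\<in>J. c q *\<^sub>R D q z)))"
  proof eventually_elim
    case (elim z)
    show ?case
    proof (intro allI impI conjI)
      fix J assume J: "J \<subseteq> Q"
      then have fJ: "finite J" using finite_Q finite_subset by blast
      show "lin_indep_family (\<lambda>q. D q z) J \<longleftrightarrow> lin_indep_family (\<lambda>q. D q (x0, y0)) J"
        using elim(2) J by (simp add: lin_indep_family_iff_dim[OF fJ])
      fix c assume "lin_indep_family (\<lambda>q. D q (x0, y0)) J"
      then have "(\<Sum>q\<in>J. \<bar>c q\<bar>) \<le> Cf J * norm (\<Sum>q\<in>J. c q *\<^sub>R D q z)" using elim(1) J by blast
      also have "\<dots> \<le> C * norm (\<Sum>q\<in>J. c q *\<^sub>R D q z)" using CfC J by (intro mult_right_mono) auto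
      finally show "(\<Sum>q\<in>J. \<bar>c q\<bar>) \<le> C * norm (\<Sum>q\<in>J. c q *\<^sub>R D q z)" .
    qed
  qed
  then show ?thesis using that \<open>C > 0\<close> by blast
qed

text \<open>The supporting family is independent at the reference point and not merely at
  \<open>z\<close>; this gives coefficient bounds that are uniform in \<open>z\<close>.\<close>

lemma multipliers_near:
  "\<forall>\<^sub>F z in nhds (x0, y0). \<forall>\<phi> F r.
     (\<forall>y. GDERIV \<phi> y :> F y) \<longrightarrow> isCont F (snd z) \<longrightarrow> r > 0 \<longrightarrow> (\<forall>q\<in>Q. h q z \<le> 0) \<longrightarrow>
     (\<forall>y\<in>cball (snd z) r. (\<forall>q\<in>Q. h q (fst z, y) \<le> 0) \<longrightarrow> \<phi> (snd z) \<le> \<phi> y) \<longrightarrow>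
     (\<exists>J m. J \<subseteq> Q \<and> (\<forall>q\<in>J. h q z = 0 \<and> m q \<ge> 0) \<and> lin_indep_family (\<lambda>q. D q (x0, y0)) J \<and>
        F (snd z) + (\<Sum>q\<in>J. m q *\<^sub>R D q z) = 0)"
proof -
  let ?P = "\<lambda>z. \<forall>J\<subseteq>Q. lin_indep_family (\<lambda>q. D q z) J \<longleftrightarrow> lin_indep_family (\<lambda>q. D q (x0, y0)) J"
  obtain C where "\<forall>\<^sub>F z in nhds (x0, y0). \<forall>J\<subseteq>Q.
       (lin_indep_family (\<lambda>q. D q z) J \<longleftrightarrow> lin_indep_family (\<lambda>q. D q (x0, y0)) J) \<and>
       (lin_indep_family (\<lambda>q. D q (x0, y0)) J \<longrightarrow>
          (\<forall>c. (\<Sum>q\<in>J. \<bar>c q\<bar>) \<le> C * norm (\<Sum>q\<in>J. c q *\<^sub>R D q z)))"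
    using lin_indep_near by blast
  then have "\<forall>\<^sub>F z in nhds (x0, y0). ?P z" by (rule eventually_mono) blast
  \<comment> \<open>The qualification condition is required on a neighbourhood of \<open>z\<close>,
    hence the iterated \<open>eventually\<close>.\<close>
  then have "\<forall>\<^sub>F z in nhds (x0, y0). \<forall>\<^sub>F z' in nhds z. ?P z'" by (simp only: eventually_eventually)
  then show ?thesis
  proof eventually_elim
    case (elim z)
    have Pz: "?P z" using eventually_nhds_x_imp_x[OF elim] .
    obtain x y where z: "z = (x, y)" by force
    show ?case
    proof (intro allI impI)
      fix \<phi> F and r :: real
      assume A: "\<forall>y. GDERIV \<phi> y :> F y" "isCont F (snd z)" "r > 0" "\<forall>q\<in>Q. h q z \<le> 0"
        "\<forall>y\<in>cball (snd z) r. (\<forall>q\<in>Q. h q (fst z, y) \<le> 0) \<longrightarrow> \<phi> (snd z) \<le> \<phi> y"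
      have lim: "((\<lambda>y. (x, y)) \<longlongrightarrow> (x, y)) (nhds y)"
        by (intro tendsto_intros) (simp add: filterlim_ident)
      obtain J m where "J \<subseteq> Q" "\<And>q. q \<in> J \<Longrightarrow> h q (x, y) = 0" "\<And>q. q \<in> J \<Longrightarrow> m q \<ge> 0"
        "lin_indep_family (\<lambda>q. D q (x, y)) J" "F y + (\<Sum>q\<in>J. m q *\<^sub>R D q (x, y)) = 0"
      proof (rule multipliers_exist[OF finite_Q, of \<phi> F y "\<lambda>q y. h q (x, y)" "\<lambda>q y. D q (x, y)" r])
        show "isCont F y" using A z by simp
        show "isCont (\<lambda>y. D q (x, y)) y" if "q \<in> Q" for q
          unfolding isCont_def by (intro tendsto_D that tendsto_intros)
        show "\<forall>\<^sub>F y' in nhds y. lin_indep_family (\<lambda>q. D q (x, y')) J \<longrightarrow>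
            lin_indep_family (\<lambda>q. D q (x, y)) J" if "J \<subseteq> Q" for J
        proof -
          have "\<forall>\<^sub>F y' in nhds y. ?P (x, y')"
            using elim lim unfolding z filterlim_iff by blast
          then show ?thesis by eventually_elim (use Pz z that in auto)
        qed
      qed (use A z deriv in \<open>auto intro: GDERIV_partial_snd\<close>)
      then show "\<exists>J m. J \<subseteq> Q \<and> (\<forall>q\<in>J. h q z = 0 \<and> m q \<ge> 0) \<and>
          lin_indep_family (\<lambda>q. D q (x0, y0)) J \<and> F (snd z) + (\<Sum>q\<in>J. m q *\<^sub>R D q z) = 0"
        using Pz z by (intro exI[of _ J] exI[of _ m]) auto
    qed
  qed
qed

text \<open>The residual controls the distance: at the projection \<open>y\<close> of \<open>z\<close> onto the feasible set, \<open>z - y\<close>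
  is a conic combination of active gradients with coefficients of size \<open>O(norm (z - y))\<close>.\<close>

theorem error_bound:
  obtains M \<epsilon> where "M > 0" "\<epsilon> > 0"
    "\<And>x z y'. norm (x - x0) < \<epsilon> \<Longrightarrow> norm (z - y0) < \<epsilon> \<Longrightarrow> norm (y' - y0) < \<epsilon> \<Longrightarrow>
       (\<And>q. q \<in> Q \<Longrightarrow> h q (x, y') \<le> 0) \<Longrightarrow>
       \<exists>y. (\<forall>q\<in>Q. h q (x, y) \<le> 0) \<and> norm (z - y) \<le> M * (\<Sum>q\<in>Q. max 0 (h q (x, z)))"
proof -
  obtain C where C: "C > 0"
    "\<forall>\<^sub>F z in nhds (x0, y0). \<forall>J\<subseteq>Q.
       (lin_indep_family (\<lambda>q. D q z) J \<longleftrightarrow> lin_indep_family (\<lambda>q. D q (x0, y0)) J) \<and>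
       (lin_indep_family (\<lambda>q. D q (x0, y0)) J \<longrightarrow>
          (\<forall>c. (\<Sum>q\<in>J. \<bar>c q\<bar>) \<le> C * norm (\<Sum>q\<in>J. c q *\<^sub>R D q z)))"
    using lin_indep_near by blast
  \<comment> \<open>With coefficients summing to at most \<open>C * N\<close> and linearization
    errors of at most \<open>e * N\<close>, the total error is half of the square of
    \<open>N\<close> and can be absorbed.\<close>
  define e where "e = 1 / (2 * C)"
  have e: "e > 0" using C(1) by (simp add: e_def)
  obtain d1 where d1: "d1 > 0"
    "\<And>q z z'. q \<in> Q \<Longrightarrow> z \<in> ball (x0, y0) d1 \<Longrightarrow> z' \<in> ball (x0, y0) d1 \<Longrightarrow>
       \<bar>h q z' - h q z - G q z \<bullet> (z' - z)\<bar> \<le> e * norm (z' - z)"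
    using uniform_gradient[OF e] by blast
  have "\<forall>\<^sub>F z in nhds (x0, y0).
      (\<forall>J c. J \<subseteq> Q \<longrightarrow> lin_indep_family (\<lambda>q. D q (x0, y0)) J \<longrightarrow>
          (\<Sum>q\<in>J. \<bar>c q\<bar>) \<le> C * norm (\<Sum>q\<in>J. c q *\<^sub>R D q z)) \<and>
      (\<forall>\<phi> F r. (\<forall>y. GDERIV \<phi> y :> F y) \<longrightarrow> isCont F (snd z) \<longrightarrow> r > 0 \<longrightarrow> (\<forall>q\<in>Q. h q z \<le> 0) \<longrightarrow>
     (\<forall>y\<in>cball (snd z) r. (\<forall>q\<in>Q. h q (fst z, y) \<le> 0) \<longrightarrow> \<phi> (snd z) \<le> \<phi> y) \<longrightarrow>
     (\<exists>J m. J \<subseteq> Q \<and> (\<forall>q\<in>J. h q z = 0 \<and> m q \<ge> 0) \<and> lin_indep_family (\<lambda>q. D q (x0, y0)) J \<and>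
        F (snd z) + (\<Sum>q\<in>J. m q *\<^sub>R D q z) = 0))"
    by (rule eventually_conj[OF eventually_mono[OF C(2)] multipliers_near]) blast
  then obtain d2 where d2: "d2 > 0" and near: "\<And>z. dist z (x0, y0) < d2 \<Longrightarrow>
      (\<forall>J c. J \<subseteq> Q \<longrightarrow> lin_indep_family (\<lambda>q. D q (x0, y0)) J \<longrightarrow>
          (\<Sum>q\<in>J. \<bar>c q\<bar>) \<le> C * norm (\<Sum>q\<in>J. c q *\<^sub>R D q z)) \<and>
      (\<forall>\<phi> F r. (\<forall>y. GDERIV \<phi> y :> F y) \<longrightarrow> isCont F (snd z) \<longrightarrow> r > 0 \<longrightarrow> (\<forall>q\<in>Q. h q z \<le> 0) \<longrightarrow>
     (\<forall>y\<in>cball (snd z) r. (\<forall>q\<in>Q. h q (fst z, y) \<le> 0) \<longrightarrow> \<phi> (snd z) \<le> \<phi> y) \<longrightarrow>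
     (\<exists>J m. J \<subseteq> Q \<and> (\<forall>q\<in>J. h q z = 0 \<and> m q \<ge> 0) \<and> lin_indep_family (\<lambda>q. D q (x0, y0)) J \<and>
        F (snd z) + (\<Sum>q\<in>J. m q *\<^sub>R D q z) = 0))"
    unfolding eventually_nhds_metric by auto
  \<comment> \<open>The nearest feasible point \<open>y\<close> is no farther from \<open>z\<close>
    than \<open>y'\<close> is, hence within \<open>3 * \<epsilon>\<close> of \<open>y0\<close>; the
    first component accounts for the remaining quarter.\<close>
  define \<epsilon> where "\<epsilon> = min d1 d2 / 4"
  have \<epsilon>: "\<epsilon> > 0" using d1 d2 by (simp add: \<epsilon>_def)
  have "\<exists>y. (\<forall>q\<in>Q. h q (x, y) \<le> 0) \<and> norm (z - y) \<le> 2 * C * (\<Sum>q\<in>Q. max 0 (h q (x, z)))"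
    if A: "norm (x - x0) < \<epsilon>" "norm (z - y0) < \<epsilon>" "norm (y' - y0) < \<epsilon>"
      "\<And>q. q \<in> Q \<Longrightarrow> h q (x, y') \<le> 0" for x z y'
  proof -
    let ?S = "{y. \<forall>q\<in>Q. h q (x, y) \<le> 0}"
    let ?H = "\<Sum>q\<in>Q. max 0 (h q (x, z))"
    have "?S = (\<Inter>q\<in>Q. {y. h q (x, y) \<le> 0})" by auto
    moreover have "closed {y. h q (x, y) \<le> 0}" if "q \<in> Q" for q
      using GDERIV_isCont[OF GDERIV_partial_snd[OF deriv[OF that]]]
      by (intro closed_Collect_le continuous_at_imp_continuous_on) auto
    ultimately have closed: "closed ?S" by auto
    have nonempty: "?S \<noteq> {}" using A(4) by blast
    obtain y where y: "y \<in> ?S" "\<And>y''. y'' \<in> ?S \<Longrightarrow> dist z y \<le> dist z y''"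
      using distance_attains_inf[OF closed nonempty, of z] by blast
    define N where "N = norm (z - y)"
    have N: "N \<le> norm (z - y')" using y(2)[of y'] A(4) by (simp add: N_def dist_norm)
    have ny: "norm (y - y0) < 3 * \<epsilon>"
    proof -
      have "norm (z - y') \<le> norm (z - y0) + norm (y' - y0)"
        using norm_triangle_ineq4[of "z - y0" "y' - y0"] by simp
      moreover have "norm (y - y0) \<le> norm (z - y0) + norm (z - y)"
        using norm_triangle_ineq4[of "z - y0" "z - y"] by simp
      ultimately show ?thesis using A N N_def by linarith
    qed
    have dP: "dist (x, w) (x0, y0) < min d1 d2" if "norm (w - y0) < 3 * \<epsilon>" for w
    proof -
      have "min d1 d2 = \<epsilon> + 3 * \<epsilon>" by (simp add: \<epsilon>_def)
      then show ?thesis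
        using norm_Pair_le[of "x - x0" "w - y0"] that A(1) unfolding dist_norm by simp
    qed
    have H: "?H \<ge> 0" by (intro sum_nonneg) auto
    have "N \<le> 2 * C * ?H"
    proof (cases "N = 0")
      case True
      then show ?thesis using H C(1) by simp
    next
      case False
      then have Npos: "N > 0" by (simp add: N_def)
      have near_xy: "dist (x, y) (x0, y0) < d2" using dP[OF ny] by simp
      have a1: "\<forall>w. GDERIV (\<lambda>w. (norm (w - z))\<^sup>2 / 2) w :> w - z"
        by (intro allI GDERIV_half_square_dist)
      have a2: "isCont (\<lambda>w. w - z) (snd (x, y))" by (intro continuous_intros)
      have a3: "\<forall>q\<in>Q. h q (x, y) \<le> 0" using y(1) by simp
      have a4: "\<forall>w\<in>cball (snd (x, y)) 1. (\<forall>q\<in>Q. h q (fst (x, y), w) \<le> 0) \<longrightarrow>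
          (norm (snd (x, y) - z))\<^sup>2 / 2 \<le> (norm (w - z))\<^sup>2 / 2"
        using y(2) by (simp add: dist_norm norm_minus_commute power_mono)
      have "\<exists>J m. J \<subseteq> Q \<and> (\<forall>q\<in>J. h q (x, y) = 0 \<and> m q \<ge> 0) \<and>
          lin_indep_family (\<lambda>q. D q (x0, y0)) J \<and>
          snd (x, y) - z + (\<Sum>q\<in>J. m q *\<^sub>R D q (x, y)) = 0"
        by (rule near[OF near_xy, THEN conjunct2, THEN spec, THEN spec, THEN spec, THEN mp[OF _ a1],
              THEN mp[OF _ a2], THEN mp[OF _ zero_less_one], THEN mp[OF _ a3], THEN mp[OF _ a4]])
      then obtain J m where J: "J \<subseteq> Q" and act: "\<And>q. q \<in> J \<Longrightarrow> h q (x, y) = 0 \<and> m q \<ge> 0"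
        and L: "lin_indep_family (\<lambda>q. D q (x0, y0)) J" and st: "z - y = (\<Sum>q\<in>J. m q *\<^sub>R D q (x, y))"
        by (auto simp: algebra_simps)
      have "(\<Sum>q\<in>J. \<bar>m q\<bar>) \<le> C * norm (\<Sum>q\<in>J. m q *\<^sub>R D q (x, y))"
        using near[of "(x, y)"] dP[OF ny] J L by auto
      then have mC: "(\<Sum>q\<in>J. m q) \<le> C * N" using act st by (simp add: N_def cong: sum.cong)
      \<comment> \<open>Pairing the multiplier relation with \<open>z - y\<close> turns it into
        values of constraints: those in \<open>J\<close> vanish at \<open>y\<close>, so their slopes
        towards \<open>z\<close> are bounded by their values at \<open>z\<close>.\<close>
      have "N\<^sup>2 = (\<Sum>q\<in>J. m q *\<^sub>R D q (x, y)) \<bullet> (z - y)"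
        unfolding N_def power2_norm_eq_inner st[symmetric] ..
      also have "\<dots> = (\<Sum>q\<in>J. m q * (D q (x, y) \<bullet> (z - y)))" by (simp add: inner_sum_left)
      also have "\<dots> \<le> (\<Sum>q\<in>J. m q * (?H + e * N))"
      proof (intro sum_mono mult_left_mono)
        fix q assume q: "q \<in> J"
        then have "\<bar>h q (x, z) - h q (x, y) - G q (x, y) \<bullet> ((x, z) - (x, y))\<bar> \<le> e * norm ((x, z) - (x, y))"
          using J dP[OF ny] dP[of z] A(2) \<epsilon> by (intro d1(2)) (auto simp: dist_commute)
        then have "D q (x, y) \<bullet> (z - y) \<le> h q (x, z) + e * N"
          using act[OF q] by (simp add: inner_prod_def norm_Pair N_def)
        moreover have "max 0 (h q (x, z)) \<le> ?H"
          using q J finite_Q by (intro member_le_sum) auto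
        ultimately show "D q (x, y) \<bullet> (z - y) \<le> ?H + e * N" by linarith
      qed (use act in auto)
      also have "\<dots> = (\<Sum>q\<in>J. m q) * (?H + e * N)" by (simp add: sum_distrib_right)
      also have "\<dots> \<le> C * N * (?H + e * N)"
        using mC H e Npos by (intro mult_right_mono) auto
      also have "\<dots> = N * (C * ?H + N / 2)" using C(1) by (simp add: e_def field_simps)
      finally have "N \<le> C * ?H + N / 2" using Npos by (simp add: power2_eq_square)
      then show ?thesis by simp
    qed
    then show ?thesis using y(1) N_def by auto
  qed
  then show ?thesis using that[of "2 * C" \<epsilon>] C(1) \<epsilon> by auto
qed

end

text \<open>The displacement \<open>Y k - W k\<close> has the same order as \<open>t k\<close>, so
  its first order effect need not vanish by size. Stationarity in the second variable cancels it,
  and only the derivative along \<open>u\<close> remains.\<close>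

lemma lagrangian_quotient:
  fixes L :: "'a::real_inner \<times> 'b::real_inner \<Rightarrow> real"
  assumes deriv: "\<And>z. GDERIV L z :> F z" and cont: "isCont F (x0, y0)"
    and stationary: "snd (F (x0, y0)) = 0"
    and t: "\<And>k. t k > 0" "t \<longlonglongrightarrow> 0" and YW: "Y \<longlonglongrightarrow> y0" "W \<longlonglongrightarrow> y0"
    and C: "\<forall>\<^sub>F k in sequentially. norm (Y k - W k) \<le> C * t k"
  shows "(\<lambda>k. (L (x0 + t k *\<^sub>R u, Y k) - L (x0, W k)) / t k) \<longlonglongrightarrow> fst (F (x0, y0)) \<bullet> u"
proof -
  have X: "(\<lambda>k. x0 + t k *\<^sub>R u) \<longlonglongrightarrow> x0"
    using t(2) by (auto intro!: tendsto_eq_intros)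
  have "(\<lambda>k. (L (x0 + t k *\<^sub>R u, Y k) - L (x0, W k) -
      F (x0, y0) \<bullet> ((x0 + t k *\<^sub>R u, Y k) - (x0, W k))) / t k) \<longlonglongrightarrow> 0"
  proof (rule strict_gradient_quotient[OF deriv cont t(1)])
    show "(\<lambda>k. (x0, W k)) \<longlonglongrightarrow> (x0, y0)" "(\<lambda>k. (x0 + t k *\<^sub>R u, Y k)) \<longlonglongrightarrow> (x0, y0)"
      using YW X by (auto intro: tendsto_Pair)
    show "\<forall>\<^sub>F k in sequentially. norm ((x0 + t k *\<^sub>R u, Y k) - (x0, W k)) \<le> (norm u + C) * t k"
      using C
    proof eventually_elim
      case (elim k)
      then show ?case
        using norm_Pair_le[of "t k *\<^sub>R u" "Y k - W k"] t(1)[of k] by (simp add: algebra_simps)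
    qed
  qed
  moreover have "(L (x0 + t k *\<^sub>R u, Y k) - L (x0, W k) -
      F (x0, y0) \<bullet> ((x0 + t k *\<^sub>R u, Y k) - (x0, W k))) / t k =
      (L (x0 + t k *\<^sub>R u, Y k) - L (x0, W k)) / t k - fst (F (x0, y0)) \<bullet> u" for k
    using t(1)[of k] stationary by (simp add: inner_prod_def diff_divide_distrib)
  ultimately show ?thesis by (simp add: LIM_zero_iff)
qed

context constant_rank_constraints
begin

text \<open>The error bound for the signed system, in which opposite inequalities express the
  equations; the negative copies add at most the absolute values on \<open>E\<close> to the
  residual.\<close>

lemma error_bound_equalities:
  assumes E: "E \<subseteq> Q"
  obtains M \<epsilon> where "M > 0" "\<epsilon> > 0"
    "\<And>x z y'. norm (x - x0) < \<epsilon> \<Longrightarrow> norm (z - y0) < \<epsilon> \<Longrightarrow> norm (y' - y0) < \<epsilon> \<Longrightarrow>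
       (\<And>q. q \<in> Q \<Longrightarrow> h q (x, y') \<le> 0) \<Longrightarrow> (\<And>q. q \<in> E \<Longrightarrow> h q (x, y') = 0) \<Longrightarrow>
       \<exists>y. (\<forall>q\<in>Q. h q (x, y) \<le> 0) \<and> (\<forall>q\<in>E. h q (x, y) = 0) \<and>
         norm (z - y) \<le> M * ((\<Sum>q\<in>Q. max 0 (h q (x, z))) + (\<Sum>q\<in>E. \<bar>h q (x, z)\<bar>))"
proof -
  interpret S: constant_rank_constraints "Q \<times> {1} \<union> E \<times> {- 1}"
    "\<lambda>p z. snd p * h (fst p) z" "\<lambda>p z. snd p *\<^sub>R G (fst p) z" x0 y0
    by (rule signed[OF E])
  have fE: "finite E" using E finite_Q finite_subset by blast
  obtain M \<epsilon> where M: "M > 0" "\<epsilon> > 0" and eb: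
    "\<And>x z y'. norm (x - x0) < \<epsilon> \<Longrightarrow> norm (z - y0) < \<epsilon> \<Longrightarrow> norm (y' - y0) < \<epsilon> \<Longrightarrow>
       (\<And>p. p \<in> Q \<times> {1} \<union> E \<times> {- 1} \<Longrightarrow> snd p * h (fst p) (x, y') \<le> 0) \<Longrightarrow>
       \<exists>y. (\<forall>p\<in>Q \<times> {1} \<union> E \<times> {- 1}. snd p * h (fst p) (x, y) \<le> 0) \<and>
         norm (z - y) \<le> M * (\<Sum>p\<in>Q \<times> {1} \<union> E \<times> {- 1}. max 0 (snd p * h (fst p) (x, z)))"
    using S.error_bound by blast
  have "\<exists>y. (\<forall>q\<in>Q. h q (x, y) \<le> 0) \<and> (\<forall>q\<in>E. h q (x, y) = 0) \<and>
         norm (z - y) \<le> M * ((\<Sum>q\<in>Q. max 0 (h q (x, z))) + (\<Sum>q\<in>E. \<bar>h q (x, z)\<bar>))"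
    if A: "norm (x - x0) < \<epsilon>" "norm (z - y0) < \<epsilon>" "norm (y' - y0) < \<epsilon>"
       "\<And>q. q \<in> Q \<Longrightarrow> h q (x, y') \<le> 0" "\<And>q. q \<in> E \<Longrightarrow> h q (x, y') = 0" for x z y'
  proof -
    have "snd p * h (fst p) (x, y') \<le> 0" if "p \<in> Q \<times> {1} \<union> E \<times> {- 1}" for p
      using that A(4,5) by auto
    from eb[OF A(1-3) this] obtain y where
      y: "\<And>p. p \<in> Q \<times> {1} \<union> E \<times> {- 1} \<Longrightarrow> snd p * h (fst p) (x, y) \<le> 0"
        "norm (z - y) \<le> M * (\<Sum>p\<in>Q \<times> {1} \<union> E \<times> {- 1}. max 0 (snd p * h (fst p) (x, z)))" by blast
    have le: "h q (x, y) \<le> 0" if "q \<in> Q" for q using y(1)[of "(q, 1)"] that by simp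
    have "h q (x, y) = 0" if "q \<in> E" for q
      using y(1)[of "(q, - 1)"] le[of q] that E by auto
    moreover have "(\<Sum>p\<in>Q \<times> {1} \<union> E \<times> {- 1}. max 0 (snd p * h (fst p) (x, z))) =
        (\<Sum>p\<in>Q \<times> {1}. max 0 (snd p * h (fst p) (x, z))) + (\<Sum>p\<in>E \<times> {- 1}. max 0 (snd p * h (fst p) (x, z)))"
      using finite_Q fE by (intro sum.union_disjoint) auto
    moreover have "(\<Sum>p\<in>Q \<times> {1}. max 0 (snd p * h (fst p) (x, z))) = (\<Sum>q\<in>Q. max 0 (h q (x, z)))"
      by (rule sum.reindex_bij_witness[where i = "\<lambda>q. (q, 1)" and j = fst]) auto
    moreover have "(\<Sum>p\<in>E \<times> {- 1}. max 0 (snd p * h (fst p) (x, z))) \<le> (\<Sum>q\<in>E. \<bar>h q (x, z)\<bar>)"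
    proof -
      have "(\<Sum>p\<in>E \<times> {- 1}. max 0 (snd p * h (fst p) (x, z))) = (\<Sum>q\<in>E. max 0 (- h q (x, z)))"
        by (rule sum.reindex_bij_witness[where i = "\<lambda>q. (q, - 1)" and j = fst]) auto
      also have "\<dots> \<le> (\<Sum>q\<in>E. \<bar>h q (x, z)\<bar>)" by (intro sum_mono) auto
      finally show ?thesis .
    qed
    ultimately have "norm (z - y) \<le> M * ((\<Sum>q\<in>Q. max 0 (h q (x, z))) + (\<Sum>q\<in>E. \<bar>h q (x, z)\<bar>))"
      using y(2) M(1) by (smt (verit) mult_left_mono)
    then show ?thesis using le \<open>\<And>q. q \<in> E \<Longrightarrow> h q (x, y) = 0\<close> by blast
  qed
  then show ?thesis using that M by blast
qed

text \<open>Under constant rank, a positive dependence of the gradients at a point forces the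
  corresponding inequalities to be active on the whole nearby feasible set: project onto the set
  where all of them are active and compare first order terms along the persisting relation.\<close>

lemma positive_dependence_forces_equality:
  assumes K: "J \<union> N \<subseteq> Q" "J \<inter> N = {}"
    and Y: "Y \<longlonglongrightarrow> y0" "\<And>k q. q \<in> J \<Longrightarrow> h q (x0, Y k) = 0" "\<And>k q. q \<in> N \<Longrightarrow> h q (x0, Y k) \<le> 0"
    and active: "\<And>q. q \<in> J \<union> N \<Longrightarrow> h q (x0, y0) = 0"
    and b: "\<And>q. q \<in> N \<Longrightarrow> b q > 0" "(\<Sum>q\<in>J \<union> N. b q *\<^sub>R D q (x0, y0)) = 0"
  shows "\<forall>\<^sub>F k in sequentially. \<forall>q\<in>N. h q (x0, Y k) = 0"
proof -
  let ?K = "J \<union> N"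
  have fK: "finite ?K" and fN: "finite N" and fJ: "finite J"
    using K finite_Q by (auto dest: finite_subset)
  interpret K: constant_rank_constraints ?K h G x0 y0 by (rule restrict[OF K(1)])
  obtain M \<epsilon> where M: "M > 0" "\<epsilon> > 0" and eb:
    "\<And>x z y'. norm (x - x0) < \<epsilon> \<Longrightarrow> norm (z - y0) < \<epsilon> \<Longrightarrow> norm (y' - y0) < \<epsilon> \<Longrightarrow>
       (\<And>q. q \<in> ?K \<Longrightarrow> h q (x, y') \<le> 0) \<Longrightarrow> (\<And>q. q \<in> ?K \<Longrightarrow> h q (x, y') = 0) \<Longrightarrow>
       \<exists>y. (\<forall>q\<in>?K. h q (x, y) \<le> 0) \<and> (\<forall>q\<in>?K. h q (x, y) = 0) \<and>
         norm (z - y) \<le> M * ((\<Sum>q\<in>?K. max 0 (h q (x, z))) + (\<Sum>q\<in>?K. \<bar>h q (x, z)\<bar>))"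
    using K.error_bound_equalities[OF order_refl] by blast
  \<comment> \<open>This is the entire residual of \<open>Y k\<close> for the system with equations
    on \<open>J \<union> N\<close>; the aim is to show that it is eventually zero.\<close>
  define \<sigma> where "\<sigma> = (\<lambda>k. \<Sum>q\<in>N. \<bar>h q (x0, Y k)\<bar>)"
  have sumK: "(\<Sum>q\<in>?K. f q) = (\<Sum>q\<in>J. f q) + (\<Sum>q\<in>N. f q)" for f :: "'q \<Rightarrow> real"
    using K(2) fJ fN by (intro sum.union_disjoint) auto
  have res: "(\<Sum>q\<in>?K. max 0 (h q (x0, Y k))) + (\<Sum>q\<in>?K. \<bar>h q (x0, Y k)\<bar>) = \<sigma> k" for k
    unfolding sumK \<sigma>_def using Y(2,3) by simp
  have limh: "(\<lambda>k. h q (x0, Y k)) \<longlonglongrightarrow> h q (x0, y0)" if "q \<in> ?K" for q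
    using that K(1) Y(1) by (intro tendsto_h tendsto_intros) auto
  have "\<sigma> \<longlonglongrightarrow> (\<Sum>q\<in>N. \<bar>h q (x0, y0)\<bar>)"
    unfolding \<sigma>_def using limh by (intro tendsto_intros) auto
  then have \<sigma>0: "\<sigma> \<longlonglongrightarrow> 0" using active by simp
  \<comment> \<open>The nearby solution of the equations that the error bound asks for is
    \<open>y0\<close> itself.\<close>
  have "\<exists>y. norm (Y k - y0) < \<epsilon> \<longrightarrow> (\<forall>q\<in>?K. h q (x0, y) = 0) \<and> norm (Y k - y) \<le> M * \<sigma> k" for k
    using eb[of x0 "Y k" y0] M active unfolding res by auto
  from choice[OF allI[OF this]] obtain W where
    W: "\<forall>k. norm (Y k - y0) < \<epsilon> \<longrightarrow> (\<forall>q\<in>?K. h q (x0, W k) = 0) \<and> norm (Y k - W k) \<le> M * \<sigma> k" ..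
  have "\<forall>\<^sub>F k in sequentially. norm (Y k - y0) < \<epsilon>"
    using tendstoD[OF Y(1) M(2)] by (simp add: dist_norm)
  then have evW: "\<forall>\<^sub>F k in sequentially. (\<forall>q\<in>?K. h q (x0, W k) = 0) \<and> norm (Y k - W k) \<le> M * \<sigma> k"
    by (rule eventually_mono) (use W in blast)
  have "(\<lambda>k. Y k - W k) \<longlonglongrightarrow> 0"
  proof (rule Lim_null_comparison)
    show "\<forall>\<^sub>F k in sequentially. norm (Y k - W k) \<le> M * \<sigma> k" using evW by (rule eventually_mono) blast
    show "(\<lambda>k. M * \<sigma> k) \<longlonglongrightarrow> 0" using \<sigma>0 by (rule tendsto_mult_right_zero)
  qed
  from tendsto_diff[OF Y(1) this] have limW: "W \<longlonglongrightarrow> y0" by simp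
  then have limW': "(\<lambda>k. (x0, W k)) \<longlonglongrightarrow> (x0, y0)" by (intro tendsto_intros)
  obtain c where c: "\<forall>\<^sub>F k in sequentially. (\<Sum>q\<in>?K. c k q *\<^sub>R D q (x0, W k)) = 0"
    "\<And>q. q \<in> ?K \<Longrightarrow> (\<lambda>k. c k q) \<longlonglongrightarrow> b q"
  proof (rule linear_relation_persists[OF fK _ _ b(2), of "\<lambda>k q. D q (x0, W k)"])
    show "(\<lambda>k. D q (x0, W k)) \<longlonglongrightarrow> D q (x0, y0)" if "q \<in> ?K" for q
      using that K(1) limW' by (intro tendsto_D) auto
    show "\<forall>\<^sub>F k in sequentially. dim ((\<lambda>q. D q (x0, W k)) ` ?K) = dim ((\<lambda>q. D q (x0, y0)) ` ?K)"
      using limW' rank[OF K(1)] unfolding filterlim_iff by blast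
  qed blast
  obtain b0 where b0: "b0 > 0" "\<And>q. q \<in> N \<Longrightarrow> b0 \<le> b q"
    using finite_uniform_radius[of N "\<lambda>q d. d \<le> b q"] fN b(1) by (metis order.refl order_trans)
  define B where "B = (\<Sum>q\<in>?K. \<bar>b q\<bar>) + 1"
  have B: "B > 0" unfolding B_def by (simp add: add_nonneg_pos sum_nonneg)
  have evB: "\<forall>\<^sub>F k in sequentially. (\<Sum>q\<in>?K. \<bar>c k q\<bar>) < B"
  proof -
    have "(\<lambda>k. \<Sum>q\<in>?K. \<bar>c k q\<bar>) \<longlonglongrightarrow> (\<Sum>q\<in>?K. \<bar>b q\<bar>)" using c(2) by (intro tendsto_intros) auto
    then show ?thesis by (rule order_tendstoD) (simp add: B_def)
  qed
  have evb: "\<forall>\<^sub>F k in sequentially. \<forall>q\<in>N. b0 / 2 < c k q"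
    using b0 by (intro eventually_ball_finite[OF fN] ballI order_tendstoD(1)[OF c(2)]) fastforce+
  \<comment> \<open>The linearization errors then add up to at most
    \<open>b0 / 4 * \<sigma> k\<close>, half of the gain \<open>b0 / 2 * \<sigma> k\<close> coming
    from the positive coefficients on \<open>N\<close>.\<close>
  define e where "e = b0 / (4 * B * M)"
  have e: "e > 0" "e * B * M = b0 / 4" using b0(1) B M(1) by (auto simp: e_def)
  obtain d where d: "d > 0"
    "\<And>q z z'. q \<in> Q \<Longrightarrow> z \<in> ball (x0, y0) d \<Longrightarrow> z' \<in> ball (x0, y0) d \<Longrightarrow>
       \<bar>h q z' - h q z - G q z \<bullet> (z' - z)\<bar> \<le> e * norm (z' - z)"
    using uniform_gradient[OF e(1)] by blast
  have "\<forall>\<^sub>F k in sequentially. dist (x0, W k) (x0, y0) < d" "\<forall>\<^sub>F k in sequentially. dist (x0, Y k) (x0, y0) < d"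
    using tendstoD[OF limW' d(1)] tendstoD[OF tendsto_Pair[OF tendsto_const Y(1)] d(1)] by blast+
  with evW c(1) evB evb show ?thesis
  proof eventually_elim
    case (elim k)
    let ?N = "norm (Y k - W k)"
    have "c k q * h q (x0, Y k) \<ge> c k q * (D q (x0, W k) \<bullet> (Y k - W k)) - \<bar>c k q\<bar> * (e * ?N)"
      if q: "q \<in> ?K" for q
    proof -
      have "\<bar>h q (x0, Y k) - h q (x0, W k) - G q (x0, W k) \<bullet> ((x0, Y k) - (x0, W k))\<bar>
          \<le> e * norm ((x0, Y k) - (x0, W k))"
        using elim q K(1) by (intro d(2)) (auto simp: dist_commute)
      then have "\<bar>h q (x0, Y k) - D q (x0, W k) \<bullet> (Y k - W k)\<bar> \<le> e * ?N"
        using elim(1) q by (simp add: inner_prod_def norm_Pair)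
      then have "\<bar>c k q\<bar> * \<bar>h q (x0, Y k) - D q (x0, W k) \<bullet> (Y k - W k)\<bar> \<le> \<bar>c k q\<bar> * (e * ?N)"
        by (intro mult_left_mono) auto
      then show ?thesis unfolding abs_mult[symmetric] right_diff_distrib by linarith
    qed
    \<comment> \<open>The weighted sum of constraint values is estimated twice: the relation at
      \<open>W k\<close> removes its linear part, leaving only errors below, while feasibility on
      \<open>N\<close> makes it at most \<open>- (b0 / 2 * \<sigma> k)\<close>. Together they force
      \<open>\<sigma> k\<close> to be zero.\<close>
    then have "(\<Sum>q\<in>?K. c k q * (D q (x0, W k) \<bullet> (Y k - W k)) - \<bar>c k q\<bar> * (e * ?N))
        \<le> (\<Sum>q\<in>?K. c k q * h q (x0, Y k))"
      by (intro sum_mono)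
    moreover have "(\<Sum>q\<in>?K. c k q * (D q (x0, W k) \<bullet> (Y k - W k))) = 0"
    proof -
      have "(\<Sum>q\<in>?K. c k q *\<^sub>R D q (x0, W k)) \<bullet> (Y k - W k) = 0" using elim(2) by simp
      then show ?thesis by (simp add: inner_sum_left)
    qed
    moreover have "(\<Sum>q\<in>?K. \<bar>c k q\<bar>) * (e * ?N) \<le> B * (e * (M * \<sigma> k))"
      using elim B e(1) by (intro mult_mono) (auto simp: sum_nonneg)
    moreover have "(\<Sum>q\<in>?K. c k q * h q (x0, Y k)) \<le> - (b0 / 2 * \<sigma> k)"
    proof -
      have "(\<Sum>q\<in>?K. c k q * h q (x0, Y k)) = (\<Sum>q\<in>N. c k q * h q (x0, Y k))"
        unfolding sumK using Y(2) by simp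
      also have "\<dots> \<le> (\<Sum>q\<in>N. - (b0 / 2 * \<bar>h q (x0, Y k)\<bar>))"
      proof (rule sum_mono)
        fix q assume q: "q \<in> N"
        have "b0 / 2 * \<bar>h q (x0, Y k)\<bar> \<le> c k q * \<bar>h q (x0, Y k)\<bar>"
          using elim(4) q by (intro mult_right_mono) auto
        then show "c k q * h q (x0, Y k) \<le> - (b0 / 2 * \<bar>h q (x0, Y k)\<bar>)" using Y(3)[OF q] by simp
      qed
      also have "\<dots> = - (b0 / 2 * \<sigma> k)" by (simp add: \<sigma>_def sum_negf sum_distrib_left)
      finally show ?thesis .
    qed
    ultimately have "b0 / 2 * \<sigma> k \<le> B * (e * (M * \<sigma> k))"
      by (simp add: sum_subtractf sum_distrib_right)
    also have "\<dots> = b0 / 4 * \<sigma> k" using e(2) by (simp add: ac_simps)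
    finally have "\<sigma> k \<le> 0" using b0(1) by (simp add: mult_le_cancel_right)
    then have "\<forall>q\<in>N. \<bar>h q (x0, Y k)\<bar> = 0"
      using fN unfolding \<sigma>_def
      by (subst sum_nonneg_eq_0_iff[symmetric]) (auto intro!: order_antisym sum_nonneg)
    then show ?case by simp
  qed
qed

end

section \<open>Farkas' lemma and linear programming duality\<close>

text \<open>The explicit combinations form the conic hull of finitely many vectors, which is closed
  although the coefficients may be unbounded.\<close>

lemma closed_finite_cone:
  fixes a :: "'q \<Rightarrow> 'b::euclidean_space"
  assumes Q: "finite Q"
  defines "C \<equiv> {\<Sum>q\<in>Q. l q *\<^sub>R a q |l. \<forall>q\<in>Q. 0 \<le> l q}"
  shows "convex_cone C" "closed C" "\<And>q. q \<in> Q \<Longrightarrow> a q \<in> C"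
proof -
  have "C = convex_cone hull (a ` Q)"
  proof (rule hull_unique[symmetric])
    show "a ` Q \<subseteq> C"
    proof
      fix v assume "v \<in> a ` Q"
      then obtain q where q: "q \<in> Q" "v = a q" by blast
      have "(\<Sum>p\<in>Q. (if p = q then 1 else 0) *\<^sub>R a p) = (\<Sum>p\<in>{q}. (if p = q then 1 else 0) *\<^sub>R a p)"
        using q Q by (intro sum.mono_neutral_right) auto
      then show "v \<in> C" unfolding C_def using q
        by (intro CollectI exI[of _ "\<lambda>p. if p = q then 1 else 0"]) auto
    qed
    show "convex_cone C" unfolding convex_cone_iff
    proof (intro conjI ballI allI impI)
      show "0 \<in> C" unfolding C_def by (auto intro!: exI[of _ "\<lambda>_. 0"])
    next
      fix x y assume "x \<in> C" "y \<in> C"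
      then obtain l m where "\<forall>q\<in>Q. 0 \<le> l q" "x = (\<Sum>q\<in>Q. l q *\<^sub>R a q)"
        "\<forall>q\<in>Q. 0 \<le> m q" "y = (\<Sum>q\<in>Q. m q *\<^sub>R a q)" unfolding C_def by blast
      then show "x + y \<in> C" unfolding C_def
        by (intro CollectI exI[of _ "\<lambda>q. l q + m q"]) (auto simp: scaleR_add_left sum.distrib)
    next
      fix x c assume "x \<in> C" "(c::real) \<ge> 0"
      then obtain l where "\<forall>q\<in>Q. 0 \<le> l q" "x = (\<Sum>q\<in>Q. l q *\<^sub>R a q)" unfolding C_def by blast
      then show "c *\<^sub>R x \<in> C" unfolding C_def using \<open>c \<ge> 0\<close>
        by (intro CollectI exI[of _ "\<lambda>q. c * l q"]) (auto simp: scaleR_sum_right)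
    qed
    fix T assume T: "a ` Q \<subseteq> T" "convex_cone T"
    show "C \<subseteq> T"
    proof
      fix v assume "v \<in> C"
      then obtain l where l: "\<forall>q\<in>Q. 0 \<le> l q" "v = (\<Sum>q\<in>Q. l q *\<^sub>R a q)" unfolding C_def by blast
      have "(\<Sum>q\<in>R. l q *\<^sub>R a q) \<in> T" if "finite R" "R \<subseteq> Q" for R
        using that
      proof (induction R)
        case (insert q R)
        then show ?case
          using T(1) l(1) by (simp add: convex_cone_add[OF T(2)] convex_cone_scaleR[OF T(2)] image_subset_iff)
      qed (simp add: convex_cone_contains_0[OF T(2)])
      then show "v \<in> T" using l(2) Q by blast
    qed
  qed
  then show "convex_cone C" "closed C" "\<And>q. q \<in> Q \<Longrightarrow> a q \<in> C"
    using closed_convex_cone_hull[of "a ` Q"] Q convex_cone_convex_cone_hull by (auto simp: hull_inc)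
qed

text \<open>A hyperplane separates \<open>w\<close> from the closed cone; scaling invariance lets
  its normal be nonnegative on the cone, and negating the normal gives \<open>v\<close>.\<close>

lemma farkas_homogeneous:
  fixes a :: "'q \<Rightarrow> 'b::euclidean_space"
  assumes Q: "finite Q" and no: "\<And>l. (\<And>q. q \<in> Q \<Longrightarrow> 0 \<le> l q) \<Longrightarrow> (\<Sum>q\<in>Q. l q *\<^sub>R a q) \<noteq> w"
  obtains v where "\<And>q. q \<in> Q \<Longrightarrow> a q \<bullet> v \<le> 0" "w \<bullet> v > 0"
proof -
  let ?C = "{\<Sum>q\<in>Q. l q *\<^sub>R a q |l. \<forall>q\<in>Q. 0 \<le> l q}"
  note C = closed_finite_cone[OF Q, where a = a]
  have "w \<notin> ?C" using no by blast
  moreover have "convex ?C" using C(1) unfolding convex_cone_def by blast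
  ultimately obtain p b where p: "p \<bullet> w < b" "\<And>x. x \<in> ?C \<Longrightarrow> b < p \<bullet> x"
    using separating_hyperplane_closed_point[of ?C w] C(2) by blast
  have b: "b < 0" using p(2)[OF convex_cone_contains_0[OF C(1)]] by simp
  have "p \<bullet> x \<ge> 0" if x: "x \<in> ?C" for x
  proof (rule ccontr)
    assume "\<not> p \<bullet> x \<ge> 0"
    then have neg: "p \<bullet> x < 0" by simp
    \<comment> \<open>This multiple meets the level \<open>b\<close> exactly, against the strict
      separation.\<close>
    have "(b / (p \<bullet> x)) *\<^sub>R x \<in> ?C"
      using x b neg by (intro convex_cone_scaleR[OF C(1)]) (auto intro: divide_nonpos_nonpos)
    from p(2)[OF this] neg show False by simp
  qed
  then have "p \<bullet> a q \<ge> 0" if "q \<in> Q" for q using C(3)[OF that] by blast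
  then show ?thesis using p(1) b by (intro that[of "- p"]) (auto simp: inner_commute)
qed

text \<open>Homogenization: the right-hand side becomes an extra coordinate, a certificate of
  unsolvability becomes a representation of \<open>(0, 1)\<close>, and dividing by the last
  coordinate returns to the original system.\<close>

lemma farkas_inhomogeneous:
  fixes a :: "'q \<Rightarrow> 'b::euclidean_space" and b :: "'q \<Rightarrow> real"
  assumes Q: "finite Q"
    and no: "\<And>l. (\<And>q. q \<in> Q \<Longrightarrow> 0 \<le> l q) \<Longrightarrow> (\<Sum>q\<in>Q. l q *\<^sub>R a q) = 0 \<Longrightarrow> (\<Sum>q\<in>Q. l q * b q) \<ge> 0"
  obtains v where "\<And>q. q \<in> Q \<Longrightarrow> a q \<bullet> v \<le> b q"
proof -
  obtain p where p: "\<And>q. q \<in> Q \<Longrightarrow> (a q, - b q) \<bullet> p \<le> 0" "(0, 1) \<bullet> p > 0"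
  proof (rule farkas_homogeneous[OF Q, of "\<lambda>q. (a q, - b q)" "(0, 1)"])
    fix l :: "'q \<Rightarrow> real" assume l: "\<And>q. q \<in> Q \<Longrightarrow> 0 \<le> l q"
    show "(\<Sum>q\<in>Q. l q *\<^sub>R (a q, - b q)) \<noteq> (0, 1)"
    proof
      assume "(\<Sum>q\<in>Q. l q *\<^sub>R (a q, - b q)) = (0, 1)"
      then have "(\<Sum>q\<in>Q. l q *\<^sub>R a q) = 0" "(\<Sum>q\<in>Q. l q * (- b q)) = 1"
        by (auto simp: prod_eq_iff fst_sum snd_sum)
      then show False using no[of l] l by (simp add: sum_negf)
    qed
  qed blast
  have s: "snd p > 0" using p(2) by (simp add: inner_prod_def)
  show ?thesis
  proof
    fix q assume "q \<in> Q"
    then have "a q \<bullet> fst p \<le> b q * snd p" using p(1) by (force simp: inner_prod_def)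
    then show "a q \<bullet> ((1 / snd p) *\<^sub>R fst p) \<le> b q" using s by (simp add: pos_divide_le_eq)
  qed
qed

text \<open>By Farkas' lemma the hypothesis \<open>primal\<close> says that the program of minimizing \<open>c \<bullet> v\<close> subject to
  \<open>a q \<bullet> v + b q \<le> 0\<close> is feasible.\<close>

theorem linear_programming_duality:
  fixes a :: "'q \<Rightarrow> 'b::euclidean_space" and b :: "'q \<Rightarrow> real"
  assumes Q: "finite Q"
    and dual: "\<And>q. q \<in> Q \<Longrightarrow> 0 \<le> l0 q" "(\<Sum>q\<in>Q. l0 q *\<^sub>R a q) = - c"
    and primal: "\<And>l. (\<And>q. q \<in> Q \<Longrightarrow> 0 \<le> l q) \<Longrightarrow> (\<Sum>q\<in>Q. l q *\<^sub>R a q) = 0 \<Longrightarrow> (\<Sum>q\<in>Q. l q * b q) \<le> 0"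
  obtains v l where "\<And>q. q \<in> Q \<Longrightarrow> a q \<bullet> v + b q \<le> 0" "\<And>q. q \<in> Q \<Longrightarrow> 0 \<le> l q"
    "(\<Sum>q\<in>Q. l q *\<^sub>R a q) = - c" "c \<bullet> v = (\<Sum>q\<in>Q. l q * b q)"
proof -
  have weak: "(\<Sum>q\<in>Q. l q * b q) \<le> c \<bullet> v"
    if "\<And>q. q \<in> Q \<Longrightarrow> a q \<bullet> v + b q \<le> 0" "\<And>q. q \<in> Q \<Longrightarrow> 0 \<le> l q" "(\<Sum>q\<in>Q. l q *\<^sub>R a q) = - c" for v l
  proof -
    have "(\<Sum>q\<in>Q. l q * b q) \<le> (\<Sum>q\<in>Q. l q * - (a q \<bullet> v))"
    proof (intro sum_mono mult_left_mono)
      fix q assume "q \<in> Q"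
      then show "b q \<le> - (a q \<bullet> v)" using that(1)[of q] by linarith
    qed (use that(2) in auto)
    also have "\<dots> = - ((\<Sum>q\<in>Q. l q *\<^sub>R a q) \<bullet> v)" by (simp add: inner_sum_left sum_negf)
    finally show ?thesis using that(3) by simp
  qed
  obtain v0 where v0: "\<And>q. q \<in> Q \<Longrightarrow> a q \<bullet> v0 \<le> - b q"
    using farkas_inhomogeneous[OF Q, of a "\<lambda>q. - b q"] primal by (auto simp: sum_negf)
  then have v0': "\<And>q. q \<in> Q \<Longrightarrow> a q \<bullet> v0 + b q \<le> 0" by fastforce
  define V where "V = {\<Sum>q\<in>Q. l q * b q |l. (\<forall>q\<in>Q. 0 \<le> l q) \<and> (\<Sum>q\<in>Q. l q *\<^sub>R a q) = - c}"
  have V: "V \<noteq> {}" "bdd_above V"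
    using dual weak[OF v0'] unfolding V_def bdd_above_def by blast+
  define d where "d = Sup V"
  have "d \<in> V"
  proof -
    \<comment> \<open>The attainable dual values are a slice of a closed cone in one more dimension,
      so the supremum is attained.\<close>
    let ?C = "{\<Sum>q\<in>Q. l q *\<^sub>R (a q, b q) |l. \<forall>q\<in>Q. 0 \<le> l q}"
    have CV: "(- c, r) \<in> ?C \<longleftrightarrow> r \<in> V" for r
      unfolding V_def by (simp add: prod_eq_iff fst_sum snd_sum) metis
    have "closed ((\<lambda>r. (- c, r)) -` ?C)"
      by (intro closed_vimage closed_finite_cone(2)[OF Q] continuous_intros)
    moreover have "(\<lambda>r. (- c, r)) -` ?C = V" using CV by blast
    ultimately have "closed V" by simp
    then show ?thesis unfolding d_def using V closed_contains_Sup by blast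
  qed
  then obtain l where l: "\<And>q. q \<in> Q \<Longrightarrow> 0 \<le> l q" "(\<Sum>q\<in>Q. l q *\<^sub>R a q) = - c" "(\<Sum>q\<in>Q. l q * b q) = d"
    unfolding V_def by blast
  \<comment> \<open>The index \<open>None\<close> carries the extra inequality
    \<open>c \<bullet> v \<le> d\<close>, so solvability of the enlarged system yields a primal
    point matching the dual optimum.\<close>
  have "\<exists>v. \<forall>i\<in>insert None (Some ` Q). (case i of None \<Rightarrow> c | Some q \<Rightarrow> a q) \<bullet> v
          \<le> (case i of None \<Rightarrow> d | Some q \<Rightarrow> - b q)"
  proof (rule farkas_inhomogeneous[of "insert None (Some ` Q)"])
    show "finite (insert None (Some ` Q))" using Q by simp
    fix m assume m: "\<And>i. i \<in> insert None (Some ` Q) \<Longrightarrow> 0 \<le> m i"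
      "(\<Sum>i\<in>insert None (Some ` Q). m i *\<^sub>R (case i of None \<Rightarrow> c | Some q \<Rightarrow> a q)) = 0"
    have split: "(\<Sum>i\<in>insert None (Some ` Q). f i) = f None + (\<Sum>q\<in>Q. f (Some q))"
      for f :: "'q option \<Rightarrow> 'e::comm_monoid_add"
      using Q by (subst sum.insert) (auto simp: sum.reindex)
    have eq: "(\<Sum>q\<in>Q. m (Some q) *\<^sub>R a q) = - (m None *\<^sub>R c)"
      using m(2) unfolding split by (simp add: add_eq_0_iff)
    have "(\<Sum>q\<in>Q. m (Some q) * b q) \<le> m None * d"
    \<comment> \<open>With weight zero on the objective this is \<open>primal\<close>; with positive
      weight, dividing by it gives a dual feasible vector, whose value is at most
      \<open>d\<close>.\<close>
    proof (cases "m None = 0")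
      case True
      then show ?thesis using primal[of "\<lambda>q. m (Some q)"] m(1) eq by simp
    next
      case False
      then have pos: "m None > 0" using m(1)[of None] by simp
      have "(\<Sum>q\<in>Q. (m (Some q) / m None) *\<^sub>R a q) = (1 / m None) *\<^sub>R (\<Sum>q\<in>Q. m (Some q) *\<^sub>R a q)"
        by (simp add: scaleR_sum_right)
      also have "\<dots> = - c" using eq pos by simp
      finally have "(\<Sum>q\<in>Q. (m (Some q) / m None) * b q) \<in> V"
        unfolding V_def using m(1) pos by (intro CollectI exI[of _ "\<lambda>q. m (Some q) / m None"]) auto
      then have "(\<Sum>q\<in>Q. (m (Some q) / m None) * b q) \<le> d"
        unfolding d_def using V(2) by (rule cSup_upper)
      moreover have "(\<Sum>q\<in>Q. (m (Some q) / m None) * b q) = (\<Sum>q\<in>Q. m (Some q) * b q) / m None"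
        by (simp add: sum_divide_distrib)
      ultimately show ?thesis using pos by (simp add: pos_divide_le_eq mult.commute)
    qed
    then show "(\<Sum>i\<in>insert None (Some ` Q). m i * (case i of None \<Rightarrow> d | Some q \<Rightarrow> - b q)) \<ge> 0"
      unfolding split by (simp add: sum_negf)
  qed blast
  then obtain v where v: "c \<bullet> v \<le> d" "\<And>q. q \<in> Q \<Longrightarrow> a q \<bullet> v \<le> - b q" by auto
  have v': "\<And>q. q \<in> Q \<Longrightarrow> a q \<bullet> v + b q \<le> 0" using v(2) by fastforce
  show ?thesis using that[OF v' l(1,2)] weak[OF v' l(1,2)] v(1) l(3) by auto
qed

section \<open>Difference quotients along feasible sequences\<close>

context constant_rank_constraints
begin

text \<open>Resetting the parameter to \<open>x0\<close> changes each constraint by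
  \<open>O(t)\<close>. The residual at \<open>Y k\<close> is therefore \<open>O(t)\<close>, and the
  error bound converts it into a displacement of that order.\<close>

lemma project_onto_reference:
  assumes J: "J \<subseteq> Q"
    and base: "\<And>q. q \<in> Q \<Longrightarrow> h q (x0, y0) \<le> 0" "\<And>q. q \<in> J \<Longrightarrow> h q (x0, y0) = 0"
    and t: "\<And>k. t k > 0" "t \<longlonglongrightarrow> 0" and Y: "Y \<longlonglongrightarrow> y0"
    and feas: "\<And>k q. q \<in> Q \<Longrightarrow> h q (x0 + t k *\<^sub>R u, Y k) \<le> 0"
      "\<And>k q. q \<in> J \<Longrightarrow> h q (x0 + t k *\<^sub>R u, Y k) = 0"
  obtains W C where "W \<longlonglongrightarrow> y0" "\<And>k q. q \<in> Q \<Longrightarrow> h q (x0, W k) \<le> 0" "\<And>k q. q \<in> J \<Longrightarrow> h q (x0, W k) = 0"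
    "\<forall>\<^sub>F k in sequentially. norm (Y k - W k) \<le> C * t k"
proof -
  obtain M \<epsilon> where M: "M > 0" "\<epsilon> > 0" and eb:
    "\<And>x z y'. norm (x - x0) < \<epsilon> \<Longrightarrow> norm (z - y0) < \<epsilon> \<Longrightarrow> norm (y' - y0) < \<epsilon> \<Longrightarrow>
       (\<And>q. q \<in> Q \<Longrightarrow> h q (x, y') \<le> 0) \<Longrightarrow> (\<And>q. q \<in> J \<Longrightarrow> h q (x, y') = 0) \<Longrightarrow>
       \<exists>y. (\<forall>q\<in>Q. h q (x, y) \<le> 0) \<and> (\<forall>q\<in>J. h q (x, y) = 0) \<and>
         norm (z - y) \<le> M * ((\<Sum>q\<in>Q. max 0 (h q (x, z))) + (\<Sum>q\<in>J. \<bar>h q (x, z)\<bar>))"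
    using error_bound_equalities[OF J] by blast
  let ?R = "\<lambda>k. (\<Sum>q\<in>Q. max 0 (h q (x0, Y k))) + (\<Sum>q\<in>J. \<bar>h q (x0, Y k)\<bar>)"
  \<comment> \<open>A Lipschitz constant of the constraint near the reference point, times the speed
    of the parameter; the summand 1 is the error allowed in \<open>strict_gradient\<close>.\<close>
  define L where "L = (\<lambda>q. (norm (G q (x0, y0)) + 1) * norm u)"
  have X: "(\<lambda>k. x0 + t k *\<^sub>R u) \<longlonglongrightarrow> x0" using t(2) by (auto intro!: tendsto_eq_intros)
  have "\<forall>\<^sub>F k in sequentially. \<forall>q\<in>Q. \<bar>h q (x0, Y k) - h q (x0 + t k *\<^sub>R u, Y k)\<bar> \<le> L q * t k"
  proof (rule eventually_ball_finite[OF finite_Q], rule ballI)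
    fix q assume q: "q \<in> Q"
    obtain d where d: "d > 0" "\<And>z z'. z \<in> ball (x0, y0) d \<Longrightarrow> z' \<in> ball (x0, y0) d \<Longrightarrow>
       \<bar>h q z' - h q z - G q (x0, y0) \<bullet> (z' - z)\<bar> \<le> 1 * norm (z' - z)"
      using strict_gradient[OF deriv[OF q] isCont_G[OF q] zero_less_one, of "(x0, y0)"] by auto
    have "\<forall>\<^sub>F k in sequentially. dist (x0, Y k) (x0, y0) < d"
      "\<forall>\<^sub>F k in sequentially. dist (x0 + t k *\<^sub>R u, Y k) (x0, y0) < d"
      using tendstoD[OF tendsto_Pair[OF tendsto_const Y] d(1)] tendstoD[OF tendsto_Pair[OF X Y] d(1)]
      by blast+
    then show "\<forall>\<^sub>F k in sequentially. \<bar>h q (x0, Y k) - h q (x0 + t k *\<^sub>R u, Y k)\<bar> \<le> L q * t k"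
    proof eventually_elim
      case (elim k)
      let ?d = "(x0, Y k) - (x0 + t k *\<^sub>R u, Y k)"
      have n: "norm ?d = t k * norm u" using t(1)[of k] by (simp add: norm_Pair)
      have "\<bar>h q (x0, Y k) - h q (x0 + t k *\<^sub>R u, Y k) - G q (x0, y0) \<bullet> ?d\<bar> \<le> 1 * norm ?d"
        using elim by (intro d(2)) (auto simp: dist_commute)
      moreover have "\<bar>G q (x0, y0) \<bullet> ?d\<bar> \<le> norm (G q (x0, y0)) * norm ?d"
        by (rule Cauchy_Schwarz_ineq2)
      moreover have "L q * t k = norm (G q (x0, y0)) * norm ?d + 1 * norm ?d"
        unfolding n L_def by (simp add: algebra_simps)
      ultimately show ?case by linarith
    qed
  qed
  then have R: "\<forall>\<^sub>F k in sequentially. ?R k \<le> (sum L Q + sum L J) * t k"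
  proof eventually_elim
    case (elim k)
    have "max 0 (h q (x0, Y k)) \<le> L q * t k" if "q \<in> Q" for q
      using elim feas(1)[OF that, of k] that abs_ge_zero order_trans by fastforce
    moreover have "\<bar>h q (x0, Y k)\<bar> \<le> L q * t k" if "q \<in> J" for q
      using bspec[OF elim subsetD[OF J that]] feas(2)[OF that, of k] by simp
    ultimately have "?R k \<le> (\<Sum>q\<in>Q. L q * t k) + (\<Sum>q\<in>J. L q * t k)"
      by (intro add_mono sum_mono)
    then show ?case by (simp add: sum_distrib_right[symmetric] distrib_right)
  qed
  \<comment> \<open>For the indices with \<open>Y k\<close> far away the default is
    \<open>y0\<close>, so the constraints hold for all \<open>k\<close>.\<close>
  have "\<exists>y. (\<forall>q\<in>Q. h q (x0, y) \<le> 0) \<and> (\<forall>q\<in>J. h q (x0, y) = 0) \<and>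
      (norm (Y k - y0) < \<epsilon> \<longrightarrow> norm (Y k - y) \<le> M * ?R k)" for k
    using eb[of x0 "Y k" y0] M base by (cases "norm (Y k - y0) < \<epsilon>") auto
  from choice[OF allI[OF this]] obtain W where W: "\<forall>k. (\<forall>q\<in>Q. h q (x0, W k) \<le> 0) \<and>
      (\<forall>q\<in>J. h q (x0, W k) = 0) \<and> (norm (Y k - y0) < \<epsilon> \<longrightarrow> norm (Y k - W k) \<le> M * ?R k)" ..
  define C where "C = M * (sum L Q + sum L J)"
  have "\<forall>\<^sub>F k in sequentially. norm (Y k - y0) < \<epsilon>"
    using tendstoD[OF Y M(2)] by (simp add: dist_norm)
  with R have C: "\<forall>\<^sub>F k in sequentially. norm (Y k - W k) \<le> C * t k"
  proof eventually_elim
    case (elim k)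
    then have "norm (Y k - W k) \<le> M * ?R k" using W by blast
    also have "\<dots> \<le> C * t k" unfolding C_def mult.assoc using elim M(1) by (intro mult_left_mono) auto
    finally show ?case .
  qed
  have "(\<lambda>k. Y k - W k) \<longlonglongrightarrow> 0"
    using C by (rule Lim_null_comparison) (rule tendsto_mult_right_zero[OF t(2)])
  from tendsto_diff[OF Y this] have "W \<longlonglongrightarrow> y0" by simp
  then show ?thesis using that[of W C] W C by blast
qed

text \<open>The multiplier \<open>l\<close>, whose support \<open>J\<close> is active along the sequence, only serves to transfer the
  estimate to an arbitrary multiplier \<open>m\<close>: on the constraints outside \<open>J\<close>, the difference \<open>m - l\<close> is
  a positive dependence.\<close>

theorem lower_bound:
  assumes \<phi>: "\<And>z. GDERIV \<phi> z :> F z" "isCont F (x0, y0)"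
    and active: "\<And>q. q \<in> Q \<Longrightarrow> h q (x0, y0) = 0"
    and opt: "\<forall>\<^sub>F y in nhds y0. (\<forall>q\<in>Q. h q (x0, y) \<le> 0) \<longrightarrow> \<phi> (x0, y0) \<le> \<phi> (x0, y)"
    and t: "\<And>k. t k > 0" "t \<longlonglongrightarrow> 0" and Y: "Y \<longlonglongrightarrow> y0"
    and feas: "\<And>k q. q \<in> Q \<Longrightarrow> h q (x0 + t k *\<^sub>R u, Y k) \<le> 0"
    and J: "J \<subseteq> Q" "\<And>k q. q \<in> J \<Longrightarrow> h q (x0 + t k *\<^sub>R u, Y k) = 0"
      "snd (F (x0, y0)) + (\<Sum>q\<in>J. l q *\<^sub>R D q (x0, y0)) = 0"
    and m: "\<And>q. q \<in> Q \<Longrightarrow> m q \<ge> 0" "snd (F (x0, y0)) + (\<Sum>q\<in>Q. m q *\<^sub>R D q (x0, y0)) = 0"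
    and e: "e > 0"
  shows "\<forall>\<^sub>F k in sequentially. (\<phi> (x0 + t k *\<^sub>R u, Y k) - \<phi> (x0, y0)) / t k
     > fst (F (x0, y0)) \<bullet> u + (\<Sum>q\<in>Q. m q * (fst (G q (x0, y0)) \<bullet> u)) - e"
proof -
  have base: "\<And>q. q \<in> Q \<Longrightarrow> h q (x0, y0) \<le> 0" "\<And>q. q \<in> J \<Longrightarrow> h q (x0, y0) = 0"
    using active J(1) by auto
  obtain W C where W: "W \<longlonglongrightarrow> y0" "\<And>k q. q \<in> Q \<Longrightarrow> h q (x0, W k) \<le> 0"
      "\<And>k q. q \<in> J \<Longrightarrow> h q (x0, W k) = 0"
    and C: "\<forall>\<^sub>F k in sequentially. norm (Y k - W k) \<le> C * t k"
    using project_onto_reference[OF J(1) base t Y feas J(2)] by blast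
  define N where "N = {q \<in> Q - J. m q > 0}"
  have fJ: "finite J" and fN: "finite N" using J(1) finite_Q finite_subset by (auto simp: N_def)
  have mQ: "(\<Sum>q\<in>Q. m q *\<^sub>R f q) = (\<Sum>q\<in>J. m q *\<^sub>R f q) + (\<Sum>q\<in>N. m q *\<^sub>R f q)"
    for f :: "'q \<Rightarrow> 'e::real_vector"
  proof -
    have "(\<Sum>q\<in>Q. m q *\<^sub>R f q) = (\<Sum>q\<in>J \<union> N. m q *\<^sub>R f q)"
    proof (rule sum.mono_neutral_right[OF finite_Q])
      show "J \<union> N \<subseteq> Q" using J(1) by (auto simp: N_def)
      show "\<forall>q\<in>Q - (J \<union> N). m q *\<^sub>R f q = 0"
        using m(1) by (force simp: N_def order_less_le)
    qed
    also have "\<dots> = (\<Sum>q\<in>J. m q *\<^sub>R f q) + (\<Sum>q\<in>N. m q *\<^sub>R f q)"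
      using fJ fN by (intro sum.union_disjoint) (auto simp: N_def)
    finally show ?thesis .
  qed
  have evN: "\<forall>\<^sub>F k in sequentially. \<forall>q\<in>N. h q (x0, W k) = 0"
  \<comment> \<open>Subtracting the two stationarity equations cancels the objective. On
    \<open>J\<close> the coefficients may have either sign, since those constraints already hold
    with equality at \<open>W k\<close>.\<close>
  proof (rule positive_dependence_forces_equality[where b = "\<lambda>q. if q \<in> J then m q - l q else m q"])
    have "(\<Sum>q\<in>J \<union> N. (if q \<in> J then m q - l q else m q) *\<^sub>R D q (x0, y0)) =
        (\<Sum>q\<in>J. (if q \<in> J then m q - l q else m q) *\<^sub>R D q (x0, y0)) +
        (\<Sum>q\<in>N. (if q \<in> J then m q - l q else m q) *\<^sub>R D q (x0, y0))"
      using fJ fN by (intro sum.union_disjoint) (auto simp: N_def)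
    also have "(\<Sum>q\<in>N. (if q \<in> J then m q - l q else m q) *\<^sub>R D q (x0, y0)) =
        (\<Sum>q\<in>N. m q *\<^sub>R D q (x0, y0))"
      by (intro sum.cong) (auto simp: N_def)
    also have "(\<Sum>q\<in>J. (if q \<in> J then m q - l q else m q) *\<^sub>R D q (x0, y0)) =
        (\<Sum>q\<in>J. m q *\<^sub>R D q (x0, y0)) - (\<Sum>q\<in>J. l q *\<^sub>R D q (x0, y0))"
      by (simp add: scaleR_left_diff_distrib sum_subtractf)
    finally have sum_eq: "(\<Sum>q\<in>J \<union> N. (if q \<in> J then m q - l q else m q) *\<^sub>R D q (x0, y0)) =
        (\<Sum>q\<in>J. m q *\<^sub>R D q (x0, y0)) - (\<Sum>q\<in>J. l q *\<^sub>R D q (x0, y0)) +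
        (\<Sum>q\<in>N. m q *\<^sub>R D q (x0, y0))" .
    show "(\<Sum>q\<in>J \<union> N. (if q \<in> J then m q - l q else m q) *\<^sub>R D q (x0, y0)) = 0"
    proof -
      have "(\<Sum>q\<in>J. l q *\<^sub>R D q (x0, y0)) =
          (\<Sum>q\<in>J. m q *\<^sub>R D q (x0, y0)) + (\<Sum>q\<in>N. m q *\<^sub>R D q (x0, y0))"
        using J(3) m(2) unfolding mQ by (metis add_left_cancel)
      then show ?thesis using sum_eq by simp
    qed
  qed (use W J(1) active in \<open>auto simp: N_def\<close>)
  define L where "L = (\<lambda>z. \<phi> z + (\<Sum>q\<in>Q. m q * h q z))"
  define GL where "GL = (\<lambda>z. F z + (\<Sum>q\<in>Q. m q *\<^sub>R G q z))"
  have "(\<lambda>k. (L (x0 + t k *\<^sub>R u, Y k) - L (x0, W k)) / t k) \<longlonglongrightarrow> fst (GL (x0, y0)) \<bullet> u"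
  proof (rule lagrangian_quotient[OF _ _ _ t Y W(1) C])
    show "GDERIV L z :> GL z" for z
      unfolding L_def GL_def by (intro GDERIV_add GDERIV_sum GDERIV_cmult \<phi> deriv)
    show "isCont GL (x0, y0)" unfolding GL_def using \<phi>(2) isCont_G by (intro continuous_intros) auto
    show "snd (GL (x0, y0)) = 0" using m(2) by (simp add: GL_def snd_sum)
  qed
  moreover have "fst (GL (x0, y0)) \<bullet> u =
      fst (F (x0, y0)) \<bullet> u + (\<Sum>q\<in>Q. m q * (fst (G q (x0, y0)) \<bullet> u))"
    by (simp add: GL_def fst_sum inner_add_left inner_sum_left)
  ultimately have "\<forall>\<^sub>F k in sequentially. (L (x0 + t k *\<^sub>R u, Y k) - L (x0, W k)) / t k >
      fst (F (x0, y0)) \<bullet> u + (\<Sum>q\<in>Q. m q * (fst (G q (x0, y0)) \<bullet> u)) - e"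
    using e by (intro order_tendstoD(1)) auto
  moreover have "\<forall>\<^sub>F k in sequentially. (\<forall>q\<in>Q. h q (x0, W k) \<le> 0) \<longrightarrow> \<phi> (x0, y0) \<le> \<phi> (x0, W k)"
    using W(1) opt unfolding filterlim_iff by blast
  ultimately show ?thesis using evN
  proof eventually_elim
    case (elim k)
    \<comment> \<open>Every constraint with a nonzero coefficient vanishes at \<open>W k\<close>, by
      the choice of \<open>J\<close> and by \<open>evN\<close>; at \<open>Y k\<close> feasibility
      only gives that \<open>L\<close> is at most the objective.\<close>
    have "L (x0, W k) = \<phi> (x0, W k)"
      using mQ[of "\<lambda>q. h q (x0, W k)"] elim(3) W(3) by (simp add: L_def)
    moreover have "L (x0 + t k *\<^sub>R u, Y k) \<le> \<phi> (x0 + t k *\<^sub>R u, Y k)"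
      using feas m(1) by (auto simp: L_def intro!: sum_nonpos mult_nonneg_nonpos)
    moreover have "\<phi> (x0, y0) \<le> \<phi> (x0, W k)" using elim(2) W(2) by blast
    ultimately have "(L (x0 + t k *\<^sub>R u, Y k) - L (x0, W k)) / t k \<le>
        (\<phi> (x0 + t k *\<^sub>R u, Y k) - \<phi> (x0, y0)) / t k"
      using t(1)[of k] by (intro divide_right_mono) auto
    then show ?case using elim(1) by linarith
  qed
qed

text \<open>With zero objective every difference quotient is zero and \<open>m\<close> is a
  multiplier, so \<open>lower_bound\<close> gives the claim. This supplies the hypothesis
  \<open>primal\<close> of linear programming duality.\<close>

lemma recession_nonpositive:
  assumes active: "\<And>q. q \<in> Q \<Longrightarrow> h q (x0, y0) = 0"
    and t: "\<And>k. t k > 0" "t \<longlonglongrightarrow> 0" and Y: "Y \<longlonglongrightarrow> y0"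
    and feas: "\<And>k q. q \<in> Q \<Longrightarrow> h q (x0 + t k *\<^sub>R u, Y k) \<le> 0"
    and m: "\<And>q. q \<in> Q \<Longrightarrow> m q \<ge> 0" "(\<Sum>q\<in>Q. m q *\<^sub>R D q (x0, y0)) = 0"
  shows "(\<Sum>q\<in>Q. m q * (fst (G q (x0, y0)) \<bullet> u)) \<le> 0"
proof (rule field_le_epsilon)
  fix e :: real assume "e > 0"
  then have "\<forall>\<^sub>F k in sequentially. ((\<lambda>z. 0) (x0 + t k *\<^sub>R u, Y k) - (\<lambda>z. 0) (x0, y0)) / t k
     > fst ((\<lambda>z. 0 :: 'a \<times> 'b) (x0, y0)) \<bullet> u + (\<Sum>q\<in>Q. m q * (fst (G q (x0, y0)) \<bullet> u)) - e"
    using m by (intro lower_bound[where J = "{}" and \<phi> = "\<lambda>z. 0" and F = "\<lambda>z. 0" and Y = Y and t = t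
          and e = e and m = m and u = u] active t Y feas) (auto simp: GDERIV_const)
  then show "(\<Sum>q\<in>Q. m q * (fst (G q (x0, y0)) \<bullet> u)) \<le> 0 + e"
    by (auto dest: eventually_happens)
qed

text \<open>Moving along the line in direction \<open>v\<close> violates the active constraints by
  \<open>o(t)\<close> only. The correction to a feasible point is then \<open>o(t)\<close> and does
  not affect the quotient; the sequence \<open>Y\<close> guarantees the feasible points near
  \<open>y0\<close> that the error bound presupposes.\<close>

theorem upper_bound:
  assumes \<phi>: "\<And>z. GDERIV \<phi> z :> F z" "isCont F (x0, y0)"
    and active: "\<And>q. q \<in> Q \<Longrightarrow> h q (x0, y0) = 0"
    and t: "\<And>k. t k > 0" "t \<longlonglongrightarrow> 0" and Y: "Y \<longlonglongrightarrow> y0"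
    and feas: "\<And>k q. q \<in> Q \<Longrightarrow> h q (x0 + t k *\<^sub>R u, Y k) \<le> 0"
    and v: "\<And>q. q \<in> Q \<Longrightarrow> G q (x0, y0) \<bullet> (u, v) \<le> 0"
  obtains W where "W \<longlonglongrightarrow> y0" "\<And>k q. q \<in> Q \<Longrightarrow> h q (x0 + t k *\<^sub>R u, W k) \<le> 0"
    "(\<lambda>k. (\<phi> (x0 + t k *\<^sub>R u, W k) - \<phi> (x0, y0)) / t k) \<longlonglongrightarrow> F (x0, y0) \<bullet> (u, v)"
proof -
  obtain M \<epsilon> where M: "M > 0" "\<epsilon> > 0" and eb:
    "\<And>x z y'. norm (x - x0) < \<epsilon> \<Longrightarrow> norm (z - y0) < \<epsilon> \<Longrightarrow> norm (y' - y0) < \<epsilon> \<Longrightarrow>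
       (\<And>q. q \<in> Q \<Longrightarrow> h q (x, y') \<le> 0) \<Longrightarrow>
       \<exists>y. (\<forall>q\<in>Q. h q (x, y) \<le> 0) \<and> norm (z - y) \<le> M * (\<Sum>q\<in>Q. max 0 (h q (x, z)))"
    using error_bound by blast
  define X Z where "X = (\<lambda>k. x0 + t k *\<^sub>R u)" and "Z = (\<lambda>k. y0 + t k *\<^sub>R v)"
  have X: "X \<longlonglongrightarrow> x0" and Z: "Z \<longlonglongrightarrow> y0"
    unfolding X_def Z_def using t(2) by (auto intro!: tendsto_eq_intros)
  have quot: "(\<lambda>k. (\<psi> (X k, Z k) - \<psi> (x0, y0)) / t k) \<longlonglongrightarrow> \<Psi> (x0, y0) \<bullet> (u, v)"
    if \<psi>: "\<And>z. GDERIV \<psi> z :> \<Psi> z" "isCont \<Psi> (x0, y0)" for \<psi> \<Psi>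
  proof -
    have eq: "(X k, Z k) - (x0, y0) = t k *\<^sub>R (u, v)" for k by (simp add: X_def Z_def)
    have "(\<lambda>k. (\<psi> (X k, Z k) - \<psi> (x0, y0) - \<Psi> (x0, y0) \<bullet> ((X k, Z k) - (x0, y0))) / t k) \<longlonglongrightarrow> 0"
    proof (rule strict_gradient_quotient[OF \<psi> t(1)])
      show "\<forall>\<^sub>F k in sequentially. norm ((X k, Z k) - (x0, y0)) \<le> norm (u, v) * t k"
        unfolding eq using t(1) by (auto intro!: always_eventually simp: less_imp_le simp del: scaleR_Pair)
    qed (intro tendsto_Pair X Z tendsto_const)+
    moreover have "(\<psi> (X k, Z k) - \<psi> (x0, y0) - \<Psi> (x0, y0) \<bullet> ((X k, Z k) - (x0, y0))) / t k =
        (\<psi> (X k, Z k) - \<psi> (x0, y0)) / t k - \<Psi> (x0, y0) \<bullet> (u, v)" for k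
      unfolding eq using t(1)[of k] by (simp add: diff_divide_distrib del: scaleR_Pair)
    ultimately show ?thesis by (simp add: LIM_zero_iff)
  qed
  let ?R = "\<lambda>k. \<Sum>q\<in>Q. max 0 (h q (X k, Z k))"
  have R: "(\<lambda>k. ?R k / t k) \<longlonglongrightarrow> 0"
  proof -
    have "(\<lambda>k. \<Sum>q\<in>Q. max 0 ((h q (X k, Z k) - h q (x0, y0)) / t k)) \<longlonglongrightarrow>
        (\<Sum>q\<in>Q. max 0 (G q (x0, y0) \<bullet> (u, v)))"
      by (intro tendsto_sum tendsto_max tendsto_const quot deriv isCont_G)
    moreover have "(\<Sum>q\<in>Q. max 0 (G q (x0, y0) \<bullet> (u, v))) = 0" using v by (simp add: max_absorb1)
    moreover have "(\<Sum>q\<in>Q. max 0 ((h q (X k, Z k) - h q (x0, y0)) / t k)) = ?R k / t k" for k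
      using t(1)[of k] active unfolding sum_divide_distrib
      by (intro sum.cong) (auto simp: max_def zero_le_divide_iff divide_le_0_iff)
    ultimately show ?thesis by simp
  qed
  \<comment> \<open>Outside the range of the error bound \<open>Y k\<close> serves as the feasible
    default.\<close>
  have "\<exists>y. (\<forall>q\<in>Q. h q (X k, y) \<le> 0) \<and> (norm (X k - x0) < \<epsilon> \<longrightarrow> norm (Z k - y0) < \<epsilon> \<longrightarrow>
      norm (Y k - y0) < \<epsilon> \<longrightarrow> norm (Z k - y) \<le> M * ?R k)" for k
    using eb[of "X k" "Z k" "Y k"] feas[of _ k]
    by (cases "norm (X k - x0) < \<epsilon> \<and> norm (Z k - y0) < \<epsilon> \<and> norm (Y k - y0) < \<epsilon>") (auto simp: X_def)
  from choice[OF allI[OF this]] obtain W where W: "\<forall>k. (\<forall>q\<in>Q. h q (X k, W k) \<le> 0) \<and>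
      (norm (X k - x0) < \<epsilon> \<longrightarrow> norm (Z k - y0) < \<epsilon> \<longrightarrow>
      norm (Y k - y0) < \<epsilon> \<longrightarrow> norm (Z k - W k) \<le> M * ?R k)" ..
  have "\<forall>\<^sub>F k in sequentially. norm (X k - x0) < \<epsilon>" "\<forall>\<^sub>F k in sequentially. norm (Z k - y0) < \<epsilon>"
    "\<forall>\<^sub>F k in sequentially. norm (Y k - y0) < \<epsilon>"
    using tendstoD[OF X M(2)] tendstoD[OF Z M(2)] tendstoD[OF Y M(2)] by (simp_all add: dist_norm)
  then have ev: "\<forall>\<^sub>F k in sequentially. norm (Z k - W k) \<le> M * ?R k"
    by eventually_elim (use W in blast)
  have slope: "(\<lambda>k. (W k - Z k) /\<^sub>R t k) \<longlonglongrightarrow> 0"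
  proof (rule Lim_null_comparison)
    show "\<forall>\<^sub>F k in sequentially. norm ((W k - Z k) /\<^sub>R t k) \<le> M * (?R k / t k)"
      using ev
    proof eventually_elim
      case (elim k)
      then have "norm (Z k - W k) / t k \<le> M * ?R k / t k" using t(1)[of k] by (intro divide_right_mono) auto
      then show ?case using t(1)[of k] by (simp add: norm_minus_commute divide_inverse_commute)
    qed
    show "(\<lambda>k. M * (?R k / t k)) \<longlonglongrightarrow> 0" using R by (rule tendsto_mult_right_zero)
  qed
  have WZ: "W k = Z k + t k *\<^sub>R ((W k - Z k) /\<^sub>R t k)" for k using t(1)[of k] by simp
  have "(\<lambda>k. Z k + t k *\<^sub>R ((W k - Z k) /\<^sub>R t k)) \<longlonglongrightarrow> y0 + 0 *\<^sub>R 0"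
    by (intro tendsto_intros Z t(2) slope)
  then have limW: "W \<longlonglongrightarrow> y0" unfolding WZ[symmetric] by simp
  have "\<forall>\<^sub>F k in sequentially. norm ((W k - Z k) /\<^sub>R t k) < 1"
    using tendstoD[OF slope zero_less_one] by (simp add: dist_norm)
  then have bound: "\<forall>\<^sub>F k in sequentially. norm ((X k, W k) - (X k, Z k)) \<le> 1 * t k"
  proof eventually_elim
    case (elim k)
    then show ?case using t(1)[of k] by (simp add: norm_Pair divide_inverse_commute[symmetric] pos_divide_less_eq)
  qed
  have "(\<lambda>k. (\<phi> (X k, W k) - \<phi> (X k, Z k) - F (x0, y0) \<bullet> ((X k, W k) - (X k, Z k))) / t k) \<longlonglongrightarrow> 0"
    by (intro strict_gradient_quotient[OF \<phi> t(1) _ _ bound] tendsto_Pair X Z limW)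
  moreover have "(\<lambda>k. snd (F (x0, y0)) \<bullet> ((W k - Z k) /\<^sub>R t k)) \<longlonglongrightarrow> snd (F (x0, y0)) \<bullet> 0"
    by (intro tendsto_intros slope)
  \<comment> \<open>The quotient splits into the linearization error of the correction, its first
    order effect, and the quotient along the line; only the last has a limit that can be
    nonzero.\<close>
  ultimately have "(\<lambda>k. (\<phi> (X k, W k) - \<phi> (X k, Z k) - F (x0, y0) \<bullet> ((X k, W k) - (X k, Z k))) / t k
      + snd (F (x0, y0)) \<bullet> ((W k - Z k) /\<^sub>R t k) + (\<phi> (X k, Z k) - \<phi> (x0, y0)) / t k)
      \<longlonglongrightarrow> 0 + snd (F (x0, y0)) \<bullet> 0 + F (x0, y0) \<bullet> (u, v)"
    by (intro tendsto_add quot[OF \<phi>])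
  moreover have "(\<phi> (X k, W k) - \<phi> (X k, Z k) - F (x0, y0) \<bullet> ((X k, W k) - (X k, Z k))) / t k
      + snd (F (x0, y0)) \<bullet> ((W k - Z k) /\<^sub>R t k) + (\<phi> (X k, Z k) - \<phi> (x0, y0)) / t k =
      (\<phi> (X k, W k) - \<phi> (x0, y0)) / t k" for k
  proof -
    have "snd (F (x0, y0)) \<bullet> ((W k - Z k) /\<^sub>R t k) = snd (F (x0, y0)) \<bullet> (W k - Z k) / t k"
      by (simp add: divide_inverse mult.commute)
    then show ?thesis by (simp add: inner_prod_def diff_divide_distrib)
  qed
  ultimately have "(\<lambda>k. (\<phi> (X k, W k) - \<phi> (x0, y0)) / t k) \<longlonglongrightarrow> F (x0, y0) \<bullet> (u, v)" by simp
  then show ?thesis using that limW W unfolding X_def by blast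
qed

text \<open>Multipliers at the local minimizers \<open>Y k\<close> are supported on families
  independent at the reference point, so their coefficients converge once the support is frozen. The
  limit multiplier inherits a support that is active all along the subsequence, not just in the
  limit.\<close>

lemma multipliers_along_sequence:
  assumes \<phi>: "\<And>z. GDERIV \<phi> z :> F z" "continuous_on UNIV F"
    and XY: "X \<longlonglongrightarrow> x0" "Y \<longlonglongrightarrow> y0" and feas: "\<And>k q. q \<in> Q \<Longrightarrow> h q (X k, Y k) \<le> 0"
    and opt: "\<forall>\<^sub>F k in sequentially. \<exists>r>0. \<forall>y\<in>cball (Y k) r.
       (\<forall>q\<in>Q. h q (X k, y) \<le> 0) \<longrightarrow> \<phi> (X k, Y k) \<le> \<phi> (X k, y)"
  obtains s J l where "strict_mono (s :: nat \<Rightarrow> nat)" "J \<subseteq> Q" "\<And>q. q \<in> J \<Longrightarrow> l q \<ge> 0"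
    "\<And>k q. q \<in> J \<Longrightarrow> h q (X (s k), Y (s k)) = 0"
    "snd (F (x0, y0)) + (\<Sum>q\<in>J. l q *\<^sub>R D q (x0, y0)) = 0"
proof -
  have lim: "(\<lambda>k. (X k, Y k)) \<longlonglongrightarrow> (x0, y0)" using XY by (rule tendsto_Pair)
  have isF: "isCont F z" for z using \<phi>(2) continuous_on_eq_continuous_at by blast
  let ?P = "\<lambda>k J m. J \<subseteq> Q \<and> (\<forall>q\<in>J. h q (X k, Y k) = 0 \<and> m q \<ge> 0) \<and>
      lin_indep_family (\<lambda>q. D q (x0, y0)) J \<and>
      snd (F (X k, Y k)) + (\<Sum>q\<in>J. m q *\<^sub>R D q (X k, Y k)) = 0"
  have "\<forall>\<^sub>F k in sequentially. \<forall>\<phi> F r.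
     (\<forall>y. GDERIV \<phi> y :> F y) \<longrightarrow> isCont F (snd (X k, Y k)) \<longrightarrow> r > 0 \<longrightarrow> (\<forall>q\<in>Q. h q (X k, Y k) \<le> 0) \<longrightarrow>
     (\<forall>y\<in>cball (snd (X k, Y k)) r. (\<forall>q\<in>Q. h q (fst (X k, Y k), y) \<le> 0) \<longrightarrow> \<phi> (snd (X k, Y k)) \<le> \<phi> y) \<longrightarrow>
     (\<exists>J m. J \<subseteq> Q \<and> (\<forall>q\<in>J. h q (X k, Y k) = 0 \<and> m q \<ge> 0) \<and> lin_indep_family (\<lambda>q. D q (x0, y0)) J \<and>
        F (snd (X k, Y k)) + (\<Sum>q\<in>J. m q *\<^sub>R D q (X k, Y k)) = 0)"
    by (rule eventually_compose_filterlim[OF multipliers_near lim])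
  then have "\<forall>\<^sub>F k in sequentially. \<exists>J m. ?P k J m"
    using opt
  proof eventually_elim
    case (elim k)
    then obtain r where r: "r > 0" "\<forall>y\<in>cball (Y k) r. (\<forall>q\<in>Q. h q (X k, y) \<le> 0) \<longrightarrow> \<phi> (X k, Y k) \<le> \<phi> (X k, y)"
      by blast
    have "isCont (\<lambda>y. snd (F (X k, y))) (Y k)"
      unfolding isCont_def by (intro tendsto_snd isCont_tendsto_compose[OF isF] tendsto_intros)
    then show ?case
      using elim(1)[THEN spec[of _ "\<lambda>y. \<phi> (X k, y)"], THEN spec[of _ "\<lambda>y. snd (F (X k, y))"],
          THEN spec[of _ r]] r feas GDERIV_partial_snd[OF \<phi>(1)] by simp
  qed
  then obtain N where "\<forall>k\<ge>N. \<exists>J m. ?P k J m" unfolding eventually_sequentially by blast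
  then have "\<forall>k. \<exists>Jm. ?P (k + N) (fst Jm) (snd Jm)" unfolding split_paired_Ex fst_conv snd_conv by simp
  from choice[OF this] obtain Jm where Jm: "\<forall>k. ?P (k + N) (fst (Jm k)) (snd (Jm k))" ..
  have "\<And>k. fst (Jm k) \<in> Pow Q" using Jm by blast
  then obtain s J where s: "strict_mono (s :: nat \<Rightarrow> nat)" and J: "\<And>k. fst (Jm (s k)) = J"
    using finite_range_constant_subseq[of "Pow Q" "\<lambda>k. fst (Jm k)"] finite_Q by blast
  define s' where "s' = (\<lambda>k. s k + N)"
  have s': "strict_mono s'" using s by (simp add: s'_def strict_mono_def)
  define m where "m = (\<lambda>k. snd (Jm (s k)))"
  have P: "?P (s' k) J (m k)" for k using spec[OF Jm, of "s k"] unfolding s'_def m_def J .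
  have JQ: "J \<subseteq> Q" using P[of 0] by blast
  then have fJ: "finite J" using finite_Q finite_subset by blast
  have lim': "(\<lambda>k. (X (s' k), Y (s' k))) \<longlonglongrightarrow> (x0, y0)"
    using LIMSEQ_subseq_LIMSEQ[OF lim s'] by (simp add: o_def)
  have "(\<lambda>k. - snd (F (X (s' k), Y (s' k)))) \<longlonglongrightarrow> - snd (F (x0, y0))"
    by (intro tendsto_minus tendsto_snd isCont_tendsto_compose[OF isF] lim')
  moreover have "- snd (F (X (s' k), Y (s' k))) = (\<Sum>q\<in>J. m k q *\<^sub>R D q (X (s' k), Y (s' k)))" for k
    using P[of k] by (simp add: neg_eq_iff_add_eq_0)
  ultimately have sum: "(\<lambda>k. \<Sum>q\<in>J. m k q *\<^sub>R D q (X (s' k), Y (s' k))) \<longlonglongrightarrow> - snd (F (x0, y0))" by simp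
  have "lin_indep_family (\<lambda>q. D q (x0, y0)) J" using P[of 0] by blast
  from lin_indep_family_coeff_tendsto[OF fJ this tendsto_D[OF _ lim'] sum] JQ
  obtain l where l: "\<And>q. q \<in> J \<Longrightarrow> (\<lambda>k. m k q) \<longlonglongrightarrow> l q"
      "(\<Sum>q\<in>J. l q *\<^sub>R D q (x0, y0)) = - snd (F (x0, y0))"
    by blast
  show ?thesis
  proof (rule that[OF s' JQ])
    show "l q \<ge> 0" if "q \<in> J" for q
      using l(1)[OF that] P that by (intro LIMSEQ_le_const[of "\<lambda>k. m k q"]) auto
    show "h q (X (s' k), Y (s' k)) = 0" if "q \<in> J" for k q using P that by blast
    show "snd (F (x0, y0)) + (\<Sum>q\<in>J. l q *\<^sub>R D q (x0, y0)) = 0" using l(2) by simp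
  qed
qed

end

section \<open>Directional derivative of the value function\<close>

text \<open>The gradient represents the derivative in coordinates. The map \<open>P\<close> is the
  identity for the objective and a coordinate for the constraints.\<close>

lemma continuously_differentiable_gradient:
  fixes h :: "'a::euclidean_space \<Rightarrow> 'c::real_normed_vector" and P :: "'c \<Rightarrow> real"
  assumes "continuously_differentiable h" "bounded_linear P"
  obtains G where "\<And>z. GDERIV (\<lambda>z. P (h z)) z :> G z" "continuous_on UNIV G"
proof -
  obtain h' :: "'a \<Rightarrow> 'a \<Rightarrow>\<^sub>L 'c"
    where h': "\<And>z. (h has_derivative blinfun_apply (h' z)) (at z)" "continuous_on UNIV h'"
    using assms(1) unfolding continuously_differentiable_def by blast
  define G where "G = (\<lambda>z. \<Sum>b\<in>Basis. P (h' z b) *\<^sub>R b)"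
  have eq: "w \<bullet> G z = P (h' z w)" for w z
  proof -
    have lin: "linear (\<lambda>w. P (h' z w))"
      using bounded_linear_compose[OF assms(2) blinfun.bounded_linear_right]
      by (rule bounded_linear.linear)
    have "w \<bullet> G z = (\<Sum>b\<in>Basis. (w \<bullet> b) *\<^sub>R P (h' z b))"
      by (simp add: G_def inner_sum_right mult.commute)
    also have "\<dots> = P (h' z (\<Sum>b\<in>Basis. (w \<bullet> b) *\<^sub>R b))"
      by (subst linear_sum[OF lin]) (simp only: linear_cmul[OF lin])
    finally show ?thesis by (simp add: euclidean_representation)
  qed
  show ?thesis
  proof
    show "GDERIV (\<lambda>z. P (h z)) z :> G z" for z
      unfolding gderiv_def eq using bounded_linear.has_derivative[OF assms(2) h'(1)] .
    show "continuous_on UNIV G"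
      unfolding G_def by (intro continuous_intros bounded_linear.continuous_on[OF assms(2)] h'(2))
  qed
qed

lemma gradient_eqI:
  assumes "GDERIV h z :> d"
  shows "gradient h z = d"
  unfolding gradient_def
proof (rule the_equality)
  show "GDERIV h z :> d" by fact
  fix d' assume "GDERIV h z :> d'"
  then have "(\<lambda>w. w \<bullet> d') = (\<lambda>w. w \<bullet> d)"
    using assms unfolding gderiv_def by (rule has_derivative_unique)
  then have "(d' - d) \<bullet> d' = (d' - d) \<bullet> d" by metis
  then have "(d' - d) \<bullet> (d' - d) = 0" by (simp add: inner_diff_right)
  then show "d' = d" by simp
qed

lemma value_function_at_solution:
  assumes "y \<in> solution_map f g x"
  shows "value_function f g x = ereal (f (x, y))"
  unfolding value_function_def
proof (rule antisym)
  show "(INF y\<in>feasible_map g x. ereal (f (x, y))) \<le> ereal (f (x, y))"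
    using assms by (intro INF_lower) (simp add: solution_map_def)
  show "ereal (f (x, y)) \<le> (INF y\<in>feasible_map g x. ereal (f (x, y)))"
    using assms by (intro INF_greatest) (simp add: solution_map_def)
qed

theorem proposition4p4:
  fixes f :: "(real ^ 'n) \<times> (real ^ 'm) \<Rightarrow> real"
    and g :: "(real ^ 'n) \<times> (real ^ 'm) \<Rightarrow> real ^ 'p"
    and xbar u :: "real ^ 'n" and ybar :: "real ^ 'm"
  assumes "continuously_differentiable f"
    and "continuously_differentiable g"
    and "(xbar, ybar) \<in> gph (solution_map f g)"
    and "inner_semicontinuous_dir (solution_map f g) xbar ybar u"
    and "RCR_regular g xbar ybar"
  shows "dir_differentiable (value_function f g) xbar u
    \<and> is_minimum (dir_deriv (value_function f g) xbar u)
        ((\<lambda>v. gradient f (xbar, ybar) \<bullet> (u, v)) ` linearization_cone g xbar ybar u)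
    \<and> is_maximum (dir_deriv (value_function f g) xbar u)
        ((\<lambda>l. gradient (\<lambda>x. lagrangian f g x ybar l) xbar \<bullet> u) ` multipliers f g xbar ybar)"
proof -
  let ?z0 = "(xbar, ybar)"
  define Q where "Q = active_set g xbar ybar"
  obtain F where F: "\<And>z. GDERIV f z :> F z" "continuous_on UNIV F"
    using continuously_differentiable_gradient[OF assms(1) bounded_linear_ident] by blast
  have "\<exists>G. (\<forall>z. GDERIV (\<lambda>z. g z $ i) z :> G z) \<and> continuous_on UNIV G" for i
    using continuously_differentiable_gradient[OF assms(2) bounded_linear_vec_nth[of i]] by blast
  then have "\<exists>G. \<forall>i. (\<forall>z. GDERIV (\<lambda>z. g z $ i) z :> G i z) \<and> continuous_on UNIV (G i)"
    by (intro choice allI)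
  then obtain G where G: "\<And>i z. GDERIV (\<lambda>z. g z $ i) z :> G i z" "\<And>i. continuous_on UNIV (G i)"
    by blast
  have isF: "isCont F z" for z using F(2) continuous_on_eq_continuous_at by blast
  interpret constant_rank_constraints Q "\<lambda>i z. g z $ i" G xbar ybar
  proof
    fix K assume "K \<subseteq> Q"
    moreover obtain \<delta> where "\<delta> > 0" and \<delta>: "\<forall>K\<subseteq>Q. \<exists>r. \<forall>(x', y')\<in>ball ?z0 \<delta>.
        dim ((\<lambda>j. gradient (\<lambda>y. g (x', y) $ j) y') ` K) = r"
      using assms(5) unfolding RCR_regular_def Q_def by blast
    ultimately obtain r where "\<forall>(x', y')\<in>ball ?z0 \<delta>.
        dim ((\<lambda>j. gradient (\<lambda>y. g (x', y) $ j) y') ` K) = r"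
      by blast
    then have "dim ((\<lambda>j. gradient (\<lambda>y. g (fst z, y) $ j) (snd z)) ` K) = r"
      if "z \<in> ball ?z0 \<delta>" for z
      using bspec[of _ _ z] that by (simp add: case_prod_unfold)
    moreover have "gradient (\<lambda>y. g (fst z, y) $ j) (snd z) = snd (G j z)" for j z
      by (intro gradient_eqI GDERIV_partial_snd) (simp add: G)
    ultimately have "dim ((\<lambda>j. snd (G j z)) ` K) = r" if "z \<in> ball ?z0 \<delta>" for z using that by simp
    then show "\<forall>\<^sub>F z in nhds ?z0. dim ((\<lambda>j. snd (G j z)) ` K) = dim ((\<lambda>j. snd (G j ?z0)) ` K)"
      using \<open>\<delta> > 0\<close> unfolding eventually_nhds_metric
      by (intro exI[of _ \<delta>]) (auto simp: dist_commute)
  qed (use G in auto)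
  have sol: "ybar \<in> solution_map f g xbar" using assms(3) by (simp add: gph_def)
  have g0: "g ?z0 $ i \<le> 0" for i
    using sol by (simp add: solution_map_def feasible_map_def less_eq_vec_def)
  have active: "g ?z0 $ q = 0" if "q \<in> Q" for q using that by (simp add: Q_def active_set_def)
  \<comment> \<open>Inactive constraints stay strictly negative nearby, so locally the active ones
    alone decide feasibility.\<close>
  have local_feas: "\<forall>\<^sub>F z in nhds ?z0. (\<forall>q\<in>Q. g z $ q \<le> 0) \<longrightarrow> snd z \<in> feasible_map g (fst z)"
  proof -
    have "\<forall>\<^sub>F z in nhds ?z0. \<forall>i\<in>- Q. g z $ i < 0"
    proof (rule eventually_ball_finite, simp, rule ballI)
      fix i assume "i \<in> - Q"
      then have "g ?z0 $ i < 0" using g0[of i] by (auto simp: Q_def active_set_def order_less_le)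
      moreover have "((\<lambda>z. g z $ i) \<longlongrightarrow> g ?z0 $ i) (nhds ?z0)"
        by (rule isCont_tendsto_compose[OF GDERIV_isCont[OF G(1)]]) (simp add: filterlim_ident)
      ultimately show "\<forall>\<^sub>F z in nhds ?z0. g z $ i < 0" by (intro order_tendstoD(2))
    qed
    then show ?thesis
      by (rule eventually_mono) (force simp: feasible_map_def less_eq_vec_def intro: less_imp_le)
  qed
  have local_opt: "\<forall>\<^sub>F y in nhds ybar. (\<forall>q\<in>Q. g (xbar, y) $ q \<le> 0) \<longrightarrow> f ?z0 \<le> f (xbar, y)"
  proof -
    have "((\<lambda>y. (xbar, y)) \<longlongrightarrow> ?z0) (nhds ybar)" by (intro tendsto_intros) (simp add: filterlim_ident)
    from eventually_compose_filterlim[OF local_feas this] show ?thesis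
      by (rule eventually_mono) (use sol in \<open>simp add: solution_map_def\<close>)
  qed
  define good where "good = (\<lambda>(t :: nat \<Rightarrow> real) Y. (\<forall>k. t k > 0) \<and> t \<longlonglongrightarrow> 0 \<and> Y \<longlonglongrightarrow> ybar \<and>
      (\<forall>k. Y k \<in> solution_map f g (xbar + t k *\<^sub>R u)))"
  have goodD: "t k > 0" "t \<longlonglongrightarrow> 0" "Y \<longlonglongrightarrow> ybar" "Y k \<in> solution_map f g (xbar + t k *\<^sub>R u)"
      "g (xbar + t k *\<^sub>R u, Y k) $ q \<le> 0" "(\<lambda>k. xbar + t k *\<^sub>R u) \<longlonglongrightarrow> xbar" if "good t Y" for t Y k q
  proof -
    show *: "t k > 0" "t \<longlonglongrightarrow> 0" "Y \<longlonglongrightarrow> ybar" "Y k \<in> solution_map f g (xbar + t k *\<^sub>R u)"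
      using that by (auto simp: good_def)
    show "g (xbar + t k *\<^sub>R u, Y k) $ q \<le> 0"
      using *(4) by (simp add: solution_map_def feasible_map_def less_eq_vec_def)
    show "(\<lambda>k. xbar + t k *\<^sub>R u) \<longlonglongrightarrow> xbar" using *(2) by (auto intro!: tendsto_eq_intros)
  qed
  have good_subseq: "good (\<lambda>k. t (s k)) (\<lambda>k. Y (s k))" if "good t Y" "strict_mono s" for t Y s
    using that LIMSEQ_subseq_LIMSEQ[OF _ that(2), of t] LIMSEQ_subseq_LIMSEQ[OF _ that(2), of Y]
    by (auto simp: good_def o_def)
  \<comment> \<open>Inner semi-continuity is applied to the constant sequence of directions
    \<open>u\<close>.\<close>
  have good_exists: "\<exists>Y. good t Y" if "\<And>k. t k > 0" "t \<longlonglongrightarrow> 0" for t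
    using assms(4) that unfolding inner_semicontinuous_dir_def good_def by (metis tendsto_const)
  have mult_seq: "\<exists>s J l. strict_mono (s :: nat \<Rightarrow> nat) \<and> J \<subseteq> Q \<and> (\<forall>q\<in>J. l q \<ge> 0) \<and>
      (\<forall>k. \<forall>q\<in>J. g (xbar + t (s k) *\<^sub>R u, Y (s k)) $ q = 0) \<and>
      snd (F ?z0) + (\<Sum>q\<in>J. l q *\<^sub>R D q ?z0) = 0" if good: "good t Y" for t Y
  proof -
    have lim: "(\<lambda>k. (xbar + t k *\<^sub>R u, Y k)) \<longlonglongrightarrow> ?z0" using goodD[OF good] by (intro tendsto_Pair)
    \<comment> \<open>The iterated \<open>eventually\<close> gives each solution \<open>Y k\<close>
      its own radius on which the active constraints describe feasibility.\<close>
    have "\<forall>\<^sub>F z in nhds ?z0. \<forall>\<^sub>F z' in nhds z. (\<forall>q\<in>Q. g z' $ q \<le> 0) \<longrightarrow> snd z' \<in> feasible_map g (fst z')"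
      using local_feas by (simp only: eventually_eventually)
    from eventually_compose_filterlim[OF this lim]
    have "\<forall>\<^sub>F k in sequentially. \<exists>r>0. \<forall>y\<in>cball (Y k) r.
       (\<forall>q\<in>Q. g (xbar + t k *\<^sub>R u, y) $ q \<le> 0) \<longrightarrow> f (xbar + t k *\<^sub>R u, Y k) \<le> f (xbar + t k *\<^sub>R u, y)"
    proof eventually_elim
      case (elim k)
      then obtain d where d: "d > 0" "\<And>z'. dist z' (xbar + t k *\<^sub>R u, Y k) < d \<Longrightarrow>
          (\<forall>q\<in>Q. g z' $ q \<le> 0) \<Longrightarrow> snd z' \<in> feasible_map g (fst z')"
        unfolding eventually_nhds_metric by blast
      show ?case
      proof (intro exI[of _ "d / 2"] conjI ballI impI)
        fix y assume y: "y \<in> cball (Y k) (d / 2)" "\<forall>q\<in>Q. g (xbar + t k *\<^sub>R u, y) $ q \<le> 0"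
        have "dist (xbar + t k *\<^sub>R u, y) (xbar + t k *\<^sub>R u, Y k) < d"
          using y(1) d(1) by (simp add: dist_Pair_Pair dist_commute)
        from d(2)[OF this y(2)] show "f (xbar + t k *\<^sub>R u, Y k) \<le> f (xbar + t k *\<^sub>R u, y)"
          using goodD(4)[OF good] by (simp add: solution_map_def)
      qed (use d in simp)
    qed
    then show ?thesis
      by (rule multipliers_along_sequence[OF F goodD(6,3)[OF good] goodD(5)[OF good]]) blast
  qed
  obtain v l where v: "\<And>q. q \<in> Q \<Longrightarrow> D q ?z0 \<bullet> v + fst (G q ?z0) \<bullet> u \<le> 0"
    and l: "\<And>q. q \<in> Q \<Longrightarrow> 0 \<le> l q" "(\<Sum>q\<in>Q. l q *\<^sub>R D q ?z0) = - snd (F ?z0)"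
    and opt: "snd (F ?z0) \<bullet> v = (\<Sum>q\<in>Q. l q * (fst (G q ?z0) \<bullet> u))"
  proof -
    \<comment> \<open>A single sequence of step sizes is enough here: its limit multiplier makes the
      dual program feasible, and its solutions yield the recession condition for the primal
      one.\<close>
    obtain Y where good: "good (\<lambda>k. inverse (real (Suc k))) Y"
      using good_exists[OF _ LIMSEQ_inverse_real_of_nat] by auto
    obtain J l0 where J: "J \<subseteq> Q" "\<forall>q\<in>J. l0 q \<ge> 0" "snd (F ?z0) + (\<Sum>q\<in>J. l0 q *\<^sub>R D q ?z0) = 0"
      using mult_seq[OF good] by blast
    show thesis
    proof (rule linear_programming_duality[OF finite_Q,
          where a = "\<lambda>q. D q ?z0" and b = "\<lambda>q. fst (G q ?z0) \<bullet> u" and c = "snd (F ?z0)"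
            and ?l0.0 = "\<lambda>q. if q \<in> J then l0 q else 0"])
      have "(\<Sum>q\<in>Q. (if q \<in> J then l0 q else 0) *\<^sub>R D q ?z0) = (\<Sum>q\<in>J. l0 q *\<^sub>R D q ?z0)"
        using J(1) finite_Q by (intro sum.mono_neutral_cong_right) auto
      then show "(\<Sum>q\<in>Q. (if q \<in> J then l0 q else 0) *\<^sub>R D q ?z0) = - snd (F ?z0)"
        using J(3) by (simp add: add_eq_0_iff)
    next
      fix m assume "\<And>q. q \<in> Q \<Longrightarrow> 0 \<le> m q" "(\<Sum>q\<in>Q. m q *\<^sub>R D q ?z0) = 0"
      then show "(\<Sum>q\<in>Q. m q * (fst (G q ?z0) \<bullet> u)) \<le> 0"
        by (intro recession_nonpositive[OF active goodD(1,2,3,5)[OF good]])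
    next
      fix v l assume "\<And>q. q \<in> Q \<Longrightarrow> D q ?z0 \<bullet> v + fst (G q ?z0) \<bullet> u \<le> 0"
        "\<And>q. q \<in> Q \<Longrightarrow> 0 \<le> l q" "(\<Sum>q\<in>Q. l q *\<^sub>R D q ?z0) = - snd (F ?z0)"
        "snd (F ?z0) \<bullet> v = (\<Sum>q\<in>Q. l q * (fst (G q ?z0) \<bullet> u))"
      then show thesis by (rule that)
    qed (use J(2) in auto)
  qed
  define d where "d = F ?z0 \<bullet> (u, v)"
  have d_dual: "d = fst (F ?z0) \<bullet> u + (\<Sum>q\<in>Q. l q * (fst (G q ?z0) \<bullet> u))"
    using opt by (simp add: d_def inner_prod_def)
  have weak: "fst (F ?z0) \<bullet> u + (\<Sum>q\<in>Q. l' q * (fst (G q ?z0) \<bullet> u)) \<le> F ?z0 \<bullet> (u, v')"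
    if "\<And>q. q \<in> Q \<Longrightarrow> 0 \<le> l' q" "(\<Sum>q\<in>Q. l' q *\<^sub>R D q ?z0) = - snd (F ?z0)"
      "\<And>q. q \<in> Q \<Longrightarrow> G q ?z0 \<bullet> (u, v') \<le> 0" for l' v'
  proof -
    have "(\<Sum>q\<in>Q. l' q * (G q ?z0 \<bullet> (u, v'))) \<le> 0"
      using that by (intro sum_nonpos mult_nonneg_nonpos) auto
    moreover have "(\<Sum>q\<in>Q. l' q * (G q ?z0 \<bullet> (u, v'))) =
        (\<Sum>q\<in>Q. l' q * (fst (G q ?z0) \<bullet> u)) + (\<Sum>q\<in>Q. l' q *\<^sub>R D q ?z0) \<bullet> v'"
      by (simp add: inner_prod_def inner_sum_left sum.distrib distrib_left)
    ultimately show ?thesis using that(2) by (simp add: inner_prod_def)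
  qed
  have vG: "G q ?z0 \<bullet> (u, v) \<le> 0" if "q \<in> Q" for q
    using v[OF that] by (simp add: inner_prod_def add.commute)
  have seq_lim: "(\<lambda>k. (f (xbar + t k *\<^sub>R u, Y k) - f ?z0) / t k) \<longlonglongrightarrow> d" if good: "good t Y" for t Y
  proof (rule order_tendstoI)
    fix a assume a: "d < a"
    obtain W where W: "W \<longlonglongrightarrow> ybar" "\<And>k q. q \<in> Q \<Longrightarrow> g (xbar + t k *\<^sub>R u, W k) $ q \<le> 0"
      "(\<lambda>k. (f (xbar + t k *\<^sub>R u, W k) - f ?z0) / t k) \<longlonglongrightarrow> d"
      using upper_bound[OF F(1) isF active goodD(1,2,3,5)[OF good] vG] unfolding d_def by blast
    have "\<forall>\<^sub>F k in sequentially. (f (xbar + t k *\<^sub>R u, W k) - f ?z0) / t k < a"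
      using W(3) a by (rule order_tendstoD)
    moreover have "\<forall>\<^sub>F k in sequentially. f (xbar + t k *\<^sub>R u, Y k) \<le> f (xbar + t k *\<^sub>R u, W k)"
      using eventually_compose_filterlim[OF local_feas tendsto_Pair[OF goodD(6)[OF good] W(1)]]
      by (rule eventually_mono) (use W(2) goodD(4)[OF good] in \<open>auto simp: solution_map_def\<close>)
    ultimately show "\<forall>\<^sub>F k in sequentially. (f (xbar + t k *\<^sub>R u, Y k) - f ?z0) / t k < a"
    proof eventually_elim
      case (elim k)
      have "(f (xbar + t k *\<^sub>R u, Y k) - f ?z0) / t k \<le> (f (xbar + t k *\<^sub>R u, W k) - f ?z0) / t k"
        using elim(2) goodD(1)[OF good, of k] by (intro divide_right_mono) auto
      then show ?case using elim(1) by linarith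
    qed
  next
    fix a assume a: "a < d"
    show "\<forall>\<^sub>F k in sequentially. a < (f (xbar + t k *\<^sub>R u, Y k) - f ?z0) / t k"
    \<comment> \<open>A violating subsequence is needed because a multiplier support is frozen only
      along a subsequence: the lower bound on a further subsequence contradicts the
      violation.\<close>
    proof (rule ccontr)
      assume "\<not> ?thesis"
      from not_eventually_sequentiallyD[OF this] obtain r where r: "strict_mono (r :: nat \<Rightarrow> nat)"
        "\<And>k. \<not> a < (f (xbar + t (r k) *\<^sub>R u, Y (r k)) - f ?z0) / t (r k)"
        by blast
      obtain s J l0 where s: "strict_mono (s :: nat \<Rightarrow> nat)" and J: "J \<subseteq> Q"
          "\<And>k q. q \<in> J \<Longrightarrow> g (xbar + t (r (s k)) *\<^sub>R u, Y (r (s k))) $ q = 0"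
          "snd (F ?z0) + (\<Sum>q\<in>J. l0 q *\<^sub>R D q ?z0) = 0"
        using mult_seq[OF good_subseq[OF good r(1)]] by blast
      note good' = good_subseq[OF good_subseq[OF good r(1)] s]
      have "snd (F ?z0) + (\<Sum>q\<in>Q. l q *\<^sub>R D q ?z0) = 0" using l(2) by simp
      from lower_bound[OF F(1) isF active local_opt goodD(1,2,3,5)[OF good'] J l(1) this, of "d - a"]
      have "\<forall>\<^sub>F k in sequentially. (f (xbar + t (r (s k)) *\<^sub>R u, Y (r (s k))) - f ?z0) / t (r (s k)) > a"
        using a unfolding d_dual by simp
      then show False using r(2) by (auto dest: eventually_happens)
    qed
  qed
  \<comment> \<open>Each sequence of step sizes gets its own solutions from
    \<open>good_exists\<close>, and all of them lead to the same \<open>d\<close>.\<close>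
  have dir: "has_dir_deriv (value_function f g) xbar u d"
    unfolding has_dir_deriv_def tendsto_at_iff_sequentially
  proof (intro allI impI)
    fix t :: "nat \<Rightarrow> real" assume t: "\<forall>i. t i \<in> {0<..} - {0}" "t \<longlonglongrightarrow> 0"
    then obtain Y where good: "good t Y" using good_exists[of t] by auto
    have "(\<lambda>k. ereal ((f (xbar + t k *\<^sub>R u, Y k) - f ?z0) / t k)) \<longlonglongrightarrow> ereal d"
      using seq_lim[OF good] by simp
    moreover have "(value_function f g (xbar + t k *\<^sub>R u) - value_function f g xbar) / ereal (t k) =
        ereal ((f (xbar + t k *\<^sub>R u, Y k) - f ?z0) / t k)" for k
      using value_function_at_solution[OF sol] value_function_at_solution[OF goodD(4)[OF good, of k]]
        goodD(1)[OF good, of k] by simp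
    ultimately show "((\<lambda>t. (value_function f g (xbar + t *\<^sub>R u) - value_function f g xbar) / ereal t) \<circ> t)
        \<longlonglongrightarrow> ereal d" by (simp add: o_def)
  qed
  have deriv_eq: "dir_deriv (value_function f g) xbar u = d"
    unfolding dir_deriv_def
  proof (rule the_equality)
    show "has_dir_deriv (value_function f g) xbar u d" by (rule dir)
    fix d' assume "has_dir_deriv (value_function f g) xbar u d'"
    then have "ereal d' = ereal d"
      using dir unfolding has_dir_deriv_def by (intro tendsto_unique[OF trivial_limit_at_right_real])
    then show "d' = d" by simp
  qed
  have grad_f: "gradient f ?z0 = F ?z0" and grad_g: "gradient (\<lambda>z. g z $ i) ?z0 = G i ?z0" for i
    using F(1) G(1) by (auto intro: gradient_eqI)
  have cone: "w \<in> linearization_cone g xbar ybar u \<longleftrightarrow> (\<forall>q\<in>Q. G q ?z0 \<bullet> (u, w) \<le> 0)" for w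
    by (simp add: linearization_cone_def Q_def grad_g)
  have is_min: "is_minimum d ((\<lambda>v. gradient f ?z0 \<bullet> (u, v)) ` linearization_cone g xbar ybar u)"
    unfolding is_minimum_def grad_f
  proof (intro conjI ballI)
    show "d \<in> (\<lambda>v. F ?z0 \<bullet> (u, v)) ` linearization_cone g xbar ybar u"
      using vG by (intro image_eqI[of _ _ v]) (auto simp: d_def cone)
    fix a assume "a \<in> (\<lambda>v. F ?z0 \<bullet> (u, v)) ` linearization_cone g xbar ybar u"
    then obtain w where "\<forall>q\<in>Q. G q ?z0 \<bullet> (u, w) \<le> 0" "a = F ?z0 \<bullet> (u, w)" by (auto simp: cone)
    then show "d \<le> a" unfolding d_dual using weak[OF l] by blast
  qed
  have lag: "GDERIV (\<lambda>z. f z + g z \<bullet> m) z :> F z + (\<Sum>i\<in>UNIV. (m $ i) *\<^sub>R G i z)" for m z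
  proof -
    have "g z \<bullet> m = (\<Sum>i\<in>UNIV. m $ i * g z $ i)" for z by (simp add: inner_vec_def mult.commute)
    then show ?thesis by (auto intro!: GDERIV_add GDERIV_sum GDERIV_cmult F(1) G(1))
  qed
  have lag_y: "gradient (\<lambda>y'. lagrangian f g xbar y' m) ybar =
      snd (F ?z0) + (\<Sum>i\<in>UNIV. (m $ i) *\<^sub>R D i ?z0)" for m
    unfolding lagrangian_def using gradient_eqI[OF GDERIV_partial_snd[OF lag]] by (simp add: snd_sum)
  have lag_x: "gradient (\<lambda>x. lagrangian f g x ybar m) xbar \<bullet> u =
      fst (F ?z0) \<bullet> u + (\<Sum>i\<in>UNIV. m $ i * (fst (G i ?z0) \<bullet> u))" for m
    unfolding lagrangian_def using gradient_eqI[OF GDERIV_partial_fst[OF lag]]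
    by (simp add: fst_sum inner_add_left inner_sum_left)
  have mult_char: "m \<in> multipliers f g xbar ybar \<longleftrightarrow> (\<forall>i. m $ i \<ge> 0) \<and> (\<forall>i\<in>- Q. m $ i = 0) \<and>
      (\<Sum>q\<in>Q. (m $ q) *\<^sub>R D q ?z0) = - snd (F ?z0)" for m
  proof -
    \<comment> \<open>All products have the same sign at a feasible point, so the inner product
      vanishes only if each of them does.\<close>
    have "g ?z0 \<bullet> m = 0 \<longleftrightarrow> (\<forall>i\<in>- Q. m $ i = 0)" if "\<forall>i. m $ i \<ge> 0"
    proof -
      have "g ?z0 \<bullet> m = - (\<Sum>i\<in>UNIV. - (g ?z0 $ i) * m $ i)"
        by (simp add: inner_vec_def sum_negf)
      also have "\<dots> = 0 \<longleftrightarrow> (\<forall>i\<in>UNIV. - (g ?z0 $ i) * m $ i = 0)"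
        using g0 that by (subst neg_equal_0_iff_equal, intro sum_nonneg_eq_0_iff) (auto intro: mult_nonpos_nonneg)
      also have "\<dots> \<longleftrightarrow> (\<forall>i\<in>- Q. m $ i = 0)" by (auto simp: Q_def active_set_def)
      finally show ?thesis .
    qed
    moreover have "(\<Sum>i\<in>UNIV. (m $ i) *\<^sub>R D i ?z0) = (\<Sum>q\<in>Q. (m $ q) *\<^sub>R D q ?z0)"
      if "\<forall>i\<in>- Q. m $ i = 0"
      using that by (intro sum.mono_neutral_right) auto
    ultimately show ?thesis
      unfolding multipliers_def lag_y by (auto simp: less_eq_vec_def add_eq_0_iff)
  qed
  have lag_x': "gradient (\<lambda>x. lagrangian f g x ybar m) xbar \<bullet> u =
      fst (F ?z0) \<bullet> u + (\<Sum>q\<in>Q. m $ q * (fst (G q ?z0) \<bullet> u))" if "\<forall>i\<in>- Q. m $ i = 0" for m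
  proof -
    have "(\<Sum>i\<in>UNIV. m $ i * (fst (G i ?z0) \<bullet> u)) = (\<Sum>q\<in>Q. m $ q * (fst (G q ?z0) \<bullet> u))"
      using that by (intro sum.mono_neutral_right) auto
    then show ?thesis unfolding lag_x by simp
  qed
  have is_max: "is_maximum d ((\<lambda>l. gradient (\<lambda>x. lagrangian f g x ybar l) xbar \<bullet> u) ` multipliers f g xbar ybar)"
    unfolding is_maximum_def
  proof (intro conjI ballI)
    \<comment> \<open>Zero on the inactive constraints is what complementarity demands.\<close>
    let ?m = "\<chi> i. if i \<in> Q then l i else 0"
    show "d \<in> (\<lambda>l. gradient (\<lambda>x. lagrangian f g x ybar l) xbar \<bullet> u) ` multipliers f g xbar ybar"
    proof (rule image_eqI[of _ _ ?m])
      show "d = gradient (\<lambda>x. lagrangian f g x ybar ?m) xbar \<bullet> u" by (subst lag_x') (auto simp: d_dual)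
      show "?m \<in> multipliers f g xbar ybar" using l by (auto simp: mult_char)
    qed
    fix a assume "a \<in> (\<lambda>l. gradient (\<lambda>x. lagrangian f g x ybar l) xbar \<bullet> u) ` multipliers f g xbar ybar"
    then obtain m where m: "m \<in> multipliers f g xbar ybar"
      "a = gradient (\<lambda>x. lagrangian f g x ybar m) xbar \<bullet> u" by blast
    then show "a \<le> d"
      unfolding d_def using weak[of "\<lambda>q. m $ q" v] vG by (simp add: mult_char lag_x')
  qed
  show ?thesis
    using dir is_min is_max unfolding deriv_eq dir_differentiable_def by blast
qed

end
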